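(* Let $n\in\{3,4\}$ and let $\mathcal{T}_n$ be the set of all strongly square free, totally-reflective genera of positive definite $\mathbb{Z}$-lattices of dimension $n$. For a genus $\mathcal{G}$ of determinant $d=\det\mathcal{G}$ let $\mathcal{P}(d)$ be the power set of the set of all prime factors of $d$. Then $$\bigcup_{\mathcal{G}\in\mathcal{T}_n}\ \bigcup_{I\in\mathcal{P}(\det\mathcal{G})}\{\mathrm{D}_I(\mathcal{G})\}$$ is the set of all square free, totally-reflective, primitive genera of positive definite $\mathbb{Z}$-lattices in dimension $n$.
   Context: A $\mathbb{Z}$-lattice is a pair $(L,b)$ with $L$ a free $\mathbb{Z}$-module of finite rank and $b:L\times L\to\mathbb{Q}$ a symmetric bilinear form; it is integral if $b(L,L)\subseteq\mathbb{Z}$. For a scalar $\alpha$, ${}^{\alpha}L$ denotes $(L,\alpha b)$. $L^{\#}=\{v\in L\otimes\mathbb{Q} : b(x,v)\in\mathbb{Z}\text{ for all }x\in L\}$ is the dual lattice. An integral lattice is primitive if it is not of the form ${}^{\alpha}M$ with $M$ integral and $\alpha\ge2$ an integer. Two lattices are in the same genus if they become isometric over $\mathbb{Z}_p$ for all primes $p$ and over $\mathbb{R}$; the determinant of a genus is the common determinant of its lattices. $L$ is square free if for every prime $p$ it has a Jordan decomposition $L\otimes\mathbb{Z}_p\cong L_0\perp{}^{p}L_1$ with $L_0,L_1$ unimodular $\mathbb{Z}_p$-lattices (possibly zero-dimensional), and strongly square free if moreover $\dim L_0\ge\dim L_1$ for every $p$. A genus has one of these properties if its lattices do. A root of $L$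 is a nonzero primitive vector $v\in L$ (that is, $v/m\notin L$ for all integers $m>1$) such that $s_v(x)=x-\frac{2b(x,v)}{b(v,v)}v$ satisfies $s_v(L)=L$. A positive definite integral lattice is reflective if its roots generate a sublattice of the same rank. A genus is totally-reflective if every lattice in it is reflective. For a prime $p$, the partial dual of an integral lattice $L$ at $p$ is $\mathrm{D}_p(L):={}^{p}\!\left(\tfrac1pL\cap L^{\#}\right)$. Partial duals at different primes commute; for a finite set $I=\{p_1,\dots,p_k\}$ of primes, $\mathrm{D}_I:=\mathrm{D}_{p_1}\circ\cdots\circ\mathrm{D}_{p_k}$, with $\mathrm{D}_\emptyset=\mathrm{id}$. For a genus $\mathcal{G}$ containing $L$, $\mathrm{D}_I(\mathcal{G})$ denotes the genus of $\mathrm{D}_I(L)$ (which does not depend on the choice of $L$). *)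

theory Defs
  imports "HOL-Analysis.Analysis" "HOL-Algebra.QuotRing"
begin

section \<open>Lattices\<close>

text \<open>
  A lattice of rank n is a pair (L, b), where L is the set of integral combinations of a basis of
  the rational space of dimension n = CARD('n), which plays the role of the tensor product of L
  with the rationals, and b is a symmetric bilinear form on this space.  It is determined by its
  restriction to L.  Every free module of rank n over the integers with a symmetric bilinear form
  arises in this way, up to isometry.
\<close>

type_synonym 'n lattice = "(rat ^ 'n) set \<times> (rat ^ 'n \<Rightarrow> rat ^ 'n \<Rightarrow> rat)"

definition is_int_basis :: "('n::finite \<Rightarrow> rat ^ 'n) \<Rightarrow> (rat ^ 'n) set \<Rightarrow> bool" where
  "is_int_basis e L \<longleftrightarrow> inj e \<and> vec.independent (range e) \<and>
     L = {\<Sum>i\<in>UNIV. of_int (c i) *s e i | c :: 'n \<Rightarrow> int. True}"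

definition full_rank_lattice :: "(rat ^ 'n::finite) set \<Rightarrow> bool" where
  "full_rank_lattice L \<longleftrightarrow> (\<exists>e. is_int_basis e L)"

definition symmetric_bilinear :: "(rat ^ 'n::finite \<Rightarrow> rat ^ 'n \<Rightarrow> rat) \<Rightarrow> bool" where
  "symmetric_bilinear b \<longleftrightarrow>
     (\<forall>x y. b x y = b y x) \<and> (\<forall>x. Vector_Spaces.linear (*s) (*) (b x))"

definition is_lattice :: "'n::finite lattice \<Rightarrow> bool" where
  "is_lattice = (\<lambda>(L, b). full_rank_lattice L \<and> symmetric_bilinear b)"

definition integral_lattice :: "'n::finite lattice \<Rightarrow> bool" where
  "integral_lattice = (\<lambda>(L, b). \<forall>x\<in>L. \<forall>y\<in>L. b x y \<in> \<int>)"

definition positive_definite :: "'n::finite lattice \<Rightarrow> bool" where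
  "positive_definite = (\<lambda>(L, b). \<forall>x\<in>L. x \<noteq> 0 \<longrightarrow> b x x > 0)"

definition rescale :: "rat \<Rightarrow> 'n::finite lattice \<Rightarrow> 'n lattice" where
  "rescale a = (\<lambda>(L, b). (L, \<lambda>x y. a * b x y))"

definition dual :: "'n::finite lattice \<Rightarrow> (rat ^ 'n) set" where
  "dual = (\<lambda>(L, b). {v. \<forall>x\<in>L. b x v \<in> \<int>})"

definition primitive_lattice :: "'n::finite lattice \<Rightarrow> bool" where
  "primitive_lattice M \<longleftrightarrow> integral_lattice M \<and>
     \<not> (\<exists>(a::int) N. a \<ge> 2 \<and> is_lattice N \<and> integral_lattice N \<and> M = rescale (of_int a) N)"

definition lattice_det :: "'n::finite lattice \<Rightarrow> rat" where
  "lattice_det = (\<lambda>(L, b). THE d. \<exists>e. is_int_basis e L \<and> d = det (\<chi> i j. b (e i) (e j)))"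


section \<open>Roots\<close>

definition reflection :: "(rat ^ 'n \<Rightarrow> rat ^ 'n \<Rightarrow> rat) \<Rightarrow> rat ^ 'n \<Rightarrow> rat ^ 'n \<Rightarrow> rat ^ 'n" where
  "reflection b v x = x - (2 * b x v / b v v) *s v"

definition roots :: "'n::finite lattice \<Rightarrow> (rat ^ 'n) set" where
  "roots = (\<lambda>(L, b). {v\<in>L. v \<noteq> 0 \<and> (\<forall>m::int. m > 1 \<longrightarrow> (1 / of_int m) *s v \<notin> L) \<and>
     b v v \<noteq> 0 \<and> reflection b v ` L = L})"

definition int_span :: "(rat ^ 'n::finite) set \<Rightarrow> (rat ^ 'n) set" where
  "int_span X = {\<Sum>v\<in>F. of_int (c v) *s v | (F :: (rat ^ 'n) set) (c :: rat ^ 'n \<Rightarrow> int).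
     finite F \<and> F \<subseteq> X}"

definition reflective :: "'n::finite lattice \<Rightarrow> bool" where
  "reflective L \<longleftrightarrow> positive_definite L \<and> integral_lattice L \<and> full_rank_lattice (int_span (roots L))"


section \<open>The p-adic numbers\<close>

definition padic_abs :: "nat \<Rightarrow> rat \<Rightarrow> real" where
  "padic_abs p x = (if x = 0 then 0 else
     real p powi (int (multiplicity (int p) (snd (quotient_of x))) -
                  int (multiplicity (int p) (fst (quotient_of x)))))"

text \<open>
  The field of p-adic numbers is the completion of the rationals: Cauchy sequences modulo null
  sequences with respect to the p-adic absolute value.
\<close>

definition padic_cauchy :: "nat \<Rightarrow> (nat \<Rightarrow> rat) ring" where
  "padic_cauchy p =
     \<lparr>carrier = {X. \<forall>e>0. \<exists>N. \<forall>m\<ge>N. \<forall>n\<ge>N. padic_abs p (X m - X n) < e},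
      monoid.mult = (\<lambda>X Y n. X n * Y n), one = (\<lambda>_. 1),
      zero = (\<lambda>_. 0), add = (\<lambda>X Y n. X n + Y n)\<rparr>"

definition padic_null :: "nat \<Rightarrow> (nat \<Rightarrow> rat) set" where
  "padic_null p = {X. (\<lambda>n. padic_abs p (X n)) \<longlonglongrightarrow> 0}"

definition padic_field :: "nat \<Rightarrow> (nat \<Rightarrow> rat) set ring" where
  "padic_field p = padic_cauchy p Quot padic_null p"

definition padic_of_rat :: "nat \<Rightarrow> rat \<Rightarrow> (nat \<Rightarrow> rat) set" where
  "padic_of_rat p q = padic_null p +>\<^bsub>padic_cauchy p\<^esub> (\<lambda>_. q)"

definition padic_ints :: "nat \<Rightarrow> (nat \<Rightarrow> rat) set set" where
  "padic_ints p = {x \<in> carrier (padic_field p). \<exists>X\<in>x. \<forall>n. padic_abs p (X n) \<le> 1}"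

definition real_field :: "real ring" where
  "real_field = \<lparr>carrier = UNIV, monoid.mult = (*), one = 1, zero = 0, add = (+)\<rparr>"


section \<open>Base change\<close>

text \<open>
  In the following, K is a field, S is a subring of K, and h embeds the rationals into K.  The
  K-vector space of dimension n consists of the functions from the index type 'n to the carrier
  of K.  As L is spanned by a basis of the rational space, the base change of L to S is the S-span
  of the image of L in this vector space.
\<close>

inductive_set lin_span :: "'k ring \<Rightarrow> 'k set \<Rightarrow> ('n \<Rightarrow> 'k) set \<Rightarrow> ('n \<Rightarrow> 'k) set"
  for K :: "'k ring" and S :: "'k set" and X :: "('n \<Rightarrow> 'k) set" where
  zero: "(\<lambda>i. \<zero>\<^bsub>K\<^esub>) \<in> lin_span K S X"
| step: "c \<in> S \<Longrightarrow> v \<in> X \<Longrightarrow> x \<in> lin_span K S X \<Longrightarrow> (\<lambda>i. c \<otimes>\<^bsub>K\<^esub> v i \<oplus>\<^bsub>K\<^esub> x i) \<in> lin_span K S X"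

definition base_change ::
    "'k ring \<Rightarrow> 'k set \<Rightarrow> (rat \<Rightarrow> 'k) \<Rightarrow> 'n::finite lattice \<Rightarrow> ('n \<Rightarrow> 'k) set" where
  "base_change K S h = (\<lambda>(L, b). lin_span K S ((\<lambda>v i. h (v $ i)) ` L))"

definition base_change_form ::
    "'k ring \<Rightarrow> (rat \<Rightarrow> 'k) \<Rightarrow> 'n::finite lattice \<Rightarrow> ('n \<Rightarrow> 'k) \<Rightarrow> ('n \<Rightarrow> 'k) \<Rightarrow> 'k" where
  "base_change_form K h = (\<lambda>(L, b) x y. \<Oplus>\<^bsub>K\<^esub>i\<in>UNIV. \<Oplus>\<^bsub>K\<^esub>j\<in>UNIV.
     x i \<otimes>\<^bsub>K\<^esub> y j \<otimes>\<^bsub>K\<^esub> h (b (axis i 1) (axis j 1)))"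

definition isometric_over ::
    "'k ring \<Rightarrow> 'k set \<Rightarrow> (rat \<Rightarrow> 'k) \<Rightarrow> 'n::finite lattice \<Rightarrow> 'n lattice \<Rightarrow> bool" where
  "isometric_over K S h L M \<longleftrightarrow>
     (\<exists>f. bij_betw f (base_change K S h L) (base_change K S h M) \<and>
       (\<forall>x\<in>base_change K S h L. \<forall>y\<in>base_change K S h L.
          f (\<lambda>i. x i \<oplus>\<^bsub>K\<^esub> y i) = (\<lambda>i. f x i \<oplus>\<^bsub>K\<^esub> f y i)) \<and>
       (\<forall>c\<in>S. \<forall>x\<in>base_change K S h L. f (\<lambda>i. c \<otimes>\<^bsub>K\<^esub> x i) = (\<lambda>i. c \<otimes>\<^bsub>K\<^esub> f x i)) \<and>
       (\<forall>x\<in>base_change K S h L. \<forall>y\<in>base_change K S h L.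
          base_change_form K h M (f x) (f y) = base_change_form K h L x y))"

definition isometric_padic :: "nat \<Rightarrow> 'n::finite lattice \<Rightarrow> 'n lattice \<Rightarrow> bool" where
  "isometric_padic p = isometric_over (padic_field p) (padic_ints p) (padic_of_rat p)"

definition isometric_real :: "'n::finite lattice \<Rightarrow> 'n lattice \<Rightarrow> bool" where
  "isometric_real = isometric_over real_field UNIV of_rat"


section \<open>Genera\<close>

definition genus_rel :: "('n::finite lattice \<times> 'n lattice) set" where
  "genus_rel = {(L, M). is_lattice L \<and> is_lattice M \<and>
     (\<forall>p. prime p \<longrightarrow> isometric_padic p L M) \<and> isometric_real L M}"

definition genera :: "'n::finite lattice set set" where
  "genera = {L. is_lattice L} // genus_rel"

definition genus_det :: "'n::finite lattice set \<Rightarrow> rat" where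
  "genus_det G = (THE d. \<forall>L\<in>G. lattice_det L = d)"

text \<open>Determinants of integral lattices are integers, represented here as rational numbers.\<close>

definition prime_divisors :: "rat \<Rightarrow> nat set" where
  "prime_divisors d = {p. prime p \<and> (\<exists>k::int. d = of_nat p * of_int k)}"

definition positive_definite_genus :: "'n::finite lattice set \<Rightarrow> bool" where
  "positive_definite_genus G \<longleftrightarrow> (\<forall>L\<in>G. positive_definite L)"

definition primitive_genus :: "'n::finite lattice set \<Rightarrow> bool" where
  "primitive_genus G \<longleftrightarrow> (\<forall>L\<in>G. primitive_lattice L)"

definition totally_reflective :: "'n::finite lattice set \<Rightarrow> bool" where
  "totally_reflective G \<longleftrightarrow> (\<forall>L\<in>G. reflective L)"


section \<open>Square free lattices\<close>

definition is_free_basis :: "'k ring \<Rightarrow> 'k set \<Rightarrow> ('n \<Rightarrow> 'k) set \<Rightarrow> ('n \<Rightarrow> 'k) set \<Rightarrow> bool" where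
  "is_free_basis K S B A \<longleftrightarrow> finite B \<and> B \<subseteq> A \<and> lin_span K S B = A \<and>
     (\<forall>c. (\<forall>v\<in>B. c v \<in> S) \<and> (\<forall>i. (\<Oplus>\<^bsub>K\<^esub>v\<in>B. c v \<otimes>\<^bsub>K\<^esub> v i) = \<zero>\<^bsub>K\<^esub>)
        \<longrightarrow> (\<forall>v\<in>B. c v = \<zero>\<^bsub>K\<^esub>))"

text \<open>
  A free module A of rank r over the p-adic integers, contained in the p-adic vector space of
  dimension n, is unimodular with respect to a form if it equals its dual, which is formed within
  the subspace spanned by A.
\<close>

definition padic_unimodular ::
    "nat \<Rightarrow> (('n \<Rightarrow> (nat \<Rightarrow> rat) set) \<Rightarrow> ('n \<Rightarrow> (nat \<Rightarrow> rat) set) \<Rightarrow> (nat \<Rightarrow> rat) set) \<Rightarrow>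
     nat \<Rightarrow> ('n \<Rightarrow> (nat \<Rightarrow> rat) set) set \<Rightarrow> bool" where
  "padic_unimodular p \<beta> r A \<longleftrightarrow>
     (\<exists>B. is_free_basis (padic_field p) (padic_ints p) B A \<and> card B = r) \<and>
     A = {w \<in> lin_span (padic_field p) (carrier (padic_field p)) A. \<forall>x\<in>A. \<beta> x w \<in> padic_ints p}"

text \<open>
  The decomposition is internal: A0 and A1 are orthogonal complementary submodules of the base
  change of L to the p-adic integers.  Here A1 is a unimodular lattice scaled by p, that is,
  A1 is unimodular with respect to the form multiplied by 1/p.
\<close>

definition jordan_decomposition :: "nat \<Rightarrow> 'n::finite lattice \<Rightarrow> nat \<Rightarrow> nat \<Rightarrow> bool" where
  "jordan_decomposition p L r0 r1 \<longleftrightarrow>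
     (let K = padic_field p; h = padic_of_rat p; Lp = base_change K (padic_ints p) h L in
      \<exists>A0 A1. A0 \<subseteq> Lp \<and> A1 \<subseteq> Lp \<and>
        Lp = {\<lambda>i. x i \<oplus>\<^bsub>K\<^esub> y i | x y. x \<in> A0 \<and> y \<in> A1} \<and> A0 \<inter> A1 = {\<lambda>i. \<zero>\<^bsub>K\<^esub>} \<and>
        (\<forall>x\<in>A0. \<forall>y\<in>A1. base_change_form K h L x y = \<zero>\<^bsub>K\<^esub>) \<and>
        padic_unimodular p (base_change_form K h L) r0 A0 \<and>
        padic_unimodular p (base_change_form K h (rescale (1 / of_nat p) L)) r1 A1)"

definition square_free_lattice :: "'n::finite lattice \<Rightarrow> bool" where
  "square_free_lattice L \<longleftrightarrow> (\<forall>p. prime p \<longrightarrow> (\<exists>r0 r1. jordan_decomposition p L r0 r1))"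

definition strongly_square_free_lattice :: "'n::finite lattice \<Rightarrow> bool" where
  "strongly_square_free_lattice L \<longleftrightarrow>
     (\<forall>p. prime p \<longrightarrow> (\<exists>r0 r1. jordan_decomposition p L r0 r1 \<and> r0 \<ge> r1))"

definition square_free_genus :: "'n::finite lattice set \<Rightarrow> bool" where
  "square_free_genus G \<longleftrightarrow> (\<forall>L\<in>G. square_free_lattice L)"

definition strongly_square_free_genus :: "'n::finite lattice set \<Rightarrow> bool" where
  "strongly_square_free_genus G \<longleftrightarrow> (\<forall>L\<in>G. strongly_square_free_lattice L)"


section \<open>Partial duals\<close>

definition partial_dual :: "nat \<Rightarrow> 'n::finite lattice \<Rightarrow> 'n lattice" where
  "partial_dual p = (\<lambda>(L, b).
     rescale (of_nat p) ((\<lambda>x. (1 / of_nat p) *s x) ` L \<inter> dual (L, b), b))"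

text \<open>
  The partial duals at the primes in a finite set are composed in the order of the primes.  The
  order is immaterial, as partial duals of integral lattices at different primes commute.
\<close>

definition partial_dual_set :: "nat set \<Rightarrow> 'n::finite lattice \<Rightarrow> 'n lattice" where
  "partial_dual_set I L = foldr partial_dual (sorted_list_of_set I) L"

text \<open>
  As the genus of the partial dual does not depend on the choice of the lattice in G, all members
  of the following union agree.
\<close>

definition partial_dual_genus :: "nat set \<Rightarrow> 'n::finite lattice set \<Rightarrow> 'n lattice set" where
  "partial_dual_genus I G = (\<Union>L\<in>G. genus_rel `` {partial_dual_set I L})"

end

theory Submission
  imports Defs
begin

text \<open>
  The dimension plays no role beyond being positive. Let L be integral and square free, with L
  tensored with the p-adic integers decomposed as A0 + A1, where A0 is unimodular of rank r0 and
  A1 is p times unimodular of rank r1. Then the partial dual of L at p is A0 + (1/p) A1 at p, for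
  the form multiplied by p (\<open>ext_pdual\<close>, \<open>jordan_partial_dual\<close>). Hence it has a Jordan decomposition
  of ranks (r1, r0) at p, and at the other primes, where p is a unit, nothing changes
  (\<open>partial_dual_jordan\<close>). Moreover, taking the partial dual twice gives (1/p) L with
  the form multiplied by p^2, which is isometric to L (\<open>partial_dual_twice\<close>). Two
  translations connect ranks with the other notions: r1 is positive if and only if p divides the
  determinant (\<open>prime_divisors_genus_det\<close>), and L is primitive if and only if r0 is
  positive for all p (\<open>primitive_iff_rank0\<close>).

  Partial duals respect genera, since at p the partial dual is determined by the p-adic lattice
  (\<open>genus_rel_partial_dual\<close>). They respect reflectivity: a reflection of L also
  preserves the partial dual, so a multiple of each root of L is a root of the partial dual, and
  the converse holds because the partial dual, taken twice, gives back L
  (\<open>reflective_partial_dual_iff\<close>). If M is in the genus of the partial dual of L,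
  then the partial dual of M is in the genus of L. So total reflectivity is inherited too
  (\<open>totally_reflective_partial_duals\<close>).

  Given a strongly square free genus, r0 is at least r1 and therefore positive at every p. Passing
  to the partial duals at a set I of primes dividing the determinant exchanges the ranks at primes
  where r1 is positive, so the result is primitive. Conversely, for a primitive square free genus,
  exchanging the ranks at the primes with r0 < r1 gives a strongly square free genus, whose
  determinant is divisible by these primes as r0 was positive, and taking the partial duals at the
  same primes again, in the opposite order, leads back.

  That the determinant, for positive definite integral lattices, is an invariant of the genus is
  shown without p-adic determinants:
  approximating a p-adic isometry by an integral matrix modulo p^k shows that the two determinants
  agree, up to a square factor, modulo p^k (\<open>gram_congruent\<close>). As this holds for all
  p and k, they have the same absolute value, and their signs agree because -1 is not a square
  modulo 3.
\<close>


section \<open>The p-adic absolute value\<close>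

lemma padic_abs_0 [simp]: "padic_abs p 0 = 0"
  by (simp add: padic_abs_def)

text \<open>
  The absolute value can be computed from any fraction, not only from the reduced one.
\<close>

lemma padic_abs_quotient:
  assumes p: "prime p" and "a \<noteq> 0" "b \<noteq> 0"
  shows "padic_abs p (of_int a / of_int b) =
    real p powi (int (multiplicity (int p) b) - int (multiplicity (int p) a))"
proof -
  let ?x = "of_int a / of_int b :: rat"
  obtain n d where nd: "quotient_of ?x = (n, d)" by fastforce
  have d: "d > 0" using quotient_of_denom_pos[OF nd] .
  have x: "?x = of_int n / of_int d" using quotient_of_div[OF nd] .
  have n: "n \<noteq> 0" using x assms(2,3) d by (auto simp: field_simps)
  have "of_int (a * d) = (of_int (n * b) :: rat)" using x assms(3) d by (simp add: field_simps)
  then have "a * d = n * b" by (simp only: of_int_eq_iff)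
  moreover have pp: "prime_elem (int p)" using p by auto
  ultimately have "multiplicity (int p) a + multiplicity (int p) d =
      multiplicity (int p) n + multiplicity (int p) b"
    using assms n d by (metis less_irrefl prime_elem_multiplicity_mult_distrib)
  then have "int (multiplicity (int p) d) - int (multiplicity (int p) n) =
      int (multiplicity (int p) b) - int (multiplicity (int p) a)" by linarith
  then show ?thesis using nd assms by (simp add: padic_abs_def)
qed

lemma padic_abs_nonneg: "padic_abs p x \<ge> 0"
  by (simp add: padic_abs_def)

lemma rat_common_denominator:
  fixes x y :: rat
  obtains a b d :: int where "d > 0" "x = of_int a / of_int d" "y = of_int b / of_int d"
proof -
  obtain a c where x: "quotient_of x = (a, c)" by fastforce
  obtain b e where y: "quotient_of y = (b, e)" by fastforce
  have "c > 0" "e > 0" using x y quotient_of_denom_pos by blast+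
  moreover have "x = of_int a / of_int c" "y = of_int b / of_int e"
    using x y quotient_of_div by blast+
  ultimately show ?thesis by (intro that[of "c * e" "a * e" "b * c"]) auto
qed

lemma rat_fraction:
  fixes x :: rat
  obtains a d :: int where "d > 0" "x = of_int a / of_int d"
  using rat_common_denominator by metis

lemma padic_abs_mult:
  assumes p: "prime p"
  shows "padic_abs p (x * y) = padic_abs p x * padic_abs p y"
proof (cases "x = 0 \<or> y = 0")
  case False
  obtain a c where x: "c > 0" "x = of_int a / of_int c" by (rule rat_fraction)
  obtain b d where y: "d > 0" "y = of_int b / of_int d" by (rule rat_fraction)
  have nz: "a \<noteq> 0" "b \<noteq> 0" "c \<noteq> 0" "d \<noteq> 0" using False x y by auto
  have pe: "prime_elem (int p)" and p0: "real p \<noteq> 0" using p by auto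
  have "x * y = of_int (a * b) / of_int (c * d)" using x y by simp
  then have "padic_abs p (x * y) = real p powi (int (multiplicity (int p) (c * d)) -
      int (multiplicity (int p) (a * b)))"
    using padic_abs_quotient[OF p, of "a * b" "c * d"] nz by simp
  also have "\<dots> = real p powi ((int (multiplicity (int p) c) - int (multiplicity (int p) a)) +
      (int (multiplicity (int p) d) - int (multiplicity (int p) b)))"
    using nz pe by (simp add: prime_elem_multiplicity_mult_distrib algebra_simps)
  also have "\<dots> = padic_abs p x * padic_abs p y"
    unfolding power_int_add[OF disjI1[OF p0]]
    using padic_abs_quotient[OF p, of a c] padic_abs_quotient[OF p, of b d] nz x y by simp
  finally show ?thesis .
qed auto

lemma padic_abs_uminus [simp]: "padic_abs p (- x) = padic_abs p x"
  unfolding padic_abs_def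
  by (cases "quotient_of x") (auto simp: rat_uminus_code intro!: arg_cong[where f = "(powi) _"] multiplicity_cong)

lemma padic_abs_add:
  assumes p: "prime p"
  shows "padic_abs p (x + y) \<le> max (padic_abs p x) (padic_abs p y)"
proof (cases "x = 0 \<or> y = 0 \<or> x + y = 0")
  case False
  obtain a b d where d: "d > 0" "x = of_int a / of_int d" "y = of_int b / of_int d"
    by (rule rat_common_denominator)
  have xy: "x + y = of_int (a + b) / of_int d" using d by (simp add: add_divide_distrib)
  have nz: "a \<noteq> 0" "b \<noteq> 0" "a + b \<noteq> 0" using False d xy by auto
  define m where "m = min (multiplicity (int p) a) (multiplicity (int p) b)"
  have "int p ^ m dvd a + b" by (intro dvd_add multiplicity_dvd') (auto simp: m_def)
  then have m: "m \<le> multiplicity (int p) (a + b)"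
    using nz p by (intro multiplicity_geI) (auto simp: prime_gt_Suc_0_nat)
  have p1: "1 \<le> real p" using p prime_ge_1_nat by auto
  have "padic_abs p (x + y) \<le> real p powi (int (multiplicity (int p) d) - int m)"
    unfolding xy using nz d m p1 by (subst padic_abs_quotient[OF p]) (auto intro: power_int_increasing)
  also have "\<dots> \<le> max (padic_abs p x) (padic_abs p y)"
    using padic_abs_quotient[OF p, of a d] padic_abs_quotient[OF p, of b d] nz d
    by (auto simp: m_def min_def)
  finally show ?thesis .
qed (auto simp: padic_abs_nonneg add_eq_0_iff)

lemma padic_abs_diff:
  "prime p \<Longrightarrow> padic_abs p (x - y) \<le> max (padic_abs p x) (padic_abs p y)"
  using padic_abs_add[of p x "- y"] by simp

lemma padic_abs_1 [simp]: "padic_abs p 1 = 1"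
  by (simp add: padic_abs_def)

lemma padic_abs_of_int_le:
  assumes "prime p" shows "padic_abs p (of_int a) \<le> 1"
proof -
  have p1: "1 \<le> real p" using assms prime_ge_1_nat by auto
  show ?thesis
    using p1 by (auto simp: padic_abs_def power_int_minus field_simps)
qed

lemma padic_abs_prime_power:
  assumes "prime p" shows "padic_abs p (of_nat p ^ k) = (1 / real p) ^ k"
proof -
  have "padic_abs p (of_nat p) = 1 / real p"
    using padic_abs_quotient[of p "int p" 1] assms by (simp add: power_int_minus field_simps)
  then show ?thesis by (induction k) (simp_all add: padic_abs_mult[OF assms])
qed

lemma padic_abs_le_1_iff:
  assumes p: "prime p"
  shows "padic_abs p x \<le> 1 \<longleftrightarrow> (\<exists>m::int. \<not> int p dvd m \<and> of_int m * x \<in> \<int>)"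
proof
  assume le: "padic_abs p x \<le> 1"
  obtain a d where x: "quotient_of x = (a, d)" by fastforce
  have d: "d > 0" using x quotient_of_denom_pos by blast
  have xad: "x = of_int a / of_int d" using x quotient_of_div by blast
  have "\<not> int p dvd d"
  proof
    assume pd: "int p dvd d"
    then have "\<not> int p dvd a"
      using quotient_of_coprime[OF x] p
      by (metis coprime_common_divisor not_prime_unit prime_nat_int_transfer)
    then have "multiplicity (int p) a = 0" by (simp add: not_dvd_imp_multiplicity_0)
    moreover have "multiplicity (int p) d > 0"
      using pd d p by (subst prime_multiplicity_gt_zero_iff) auto
    moreover have "a \<noteq> 0" using \<open>\<not> int p dvd a\<close> by auto
    ultimately have "padic_abs p x > 1"
      using padic_abs_quotient[OF p, of a d] d p prime_gt_1_nat[OF p] unfolding xad by simp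
    then show False using le by simp
  qed
  moreover have "of_int d * x \<in> \<int>" using xad d by simp
  ultimately show "\<exists>m::int. \<not> int p dvd m \<and> of_int m * x \<in> \<int>" by blast
next
  assume "\<exists>m::int. \<not> int p dvd m \<and> of_int m * x \<in> \<int>"
  then obtain m a :: int where m: "\<not> int p dvd m" "of_int m * x = of_int a" by (auto elim: Ints_cases)
  have m0: "m \<noteq> 0" using m by auto
  have "padic_abs p (of_int m) = 1"
    using padic_abs_quotient[OF p, of m 1] m0 m by (simp add: not_dvd_imp_multiplicity_0)
  then have "padic_abs p x = padic_abs p (of_int a)"
    using padic_abs_mult[OF p, of "of_int m" x] m by simp
  then show "padic_abs p x \<le> 1" using padic_abs_of_int_le[OF p] by simp
qed

lemma padic_abs_inverse_other:
  assumes p: "prime p" and q: "prime q" "q \<noteq> p"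
  shows "padic_abs p (1 / of_nat q) \<le> 1"
proof -
  have "\<not> p dvd q" using p q primes_dvd_imp_eq by blast
  then show ?thesis
    unfolding padic_abs_le_1_iff[OF p] using prime_gt_0_nat[OF q(1)] by (intro exI[of _ "int q"]) simp
qed

lemma bezout_prime_power:
  assumes p: "prime p" and m: "\<not> int p dvd m"
  obtains r s where "r * m + s * int p ^ k = 1"
proof -
  have "prime (int p)" using p by simp
  then have "coprime m (int p)" using m prime_imp_coprime[of "int p" m] by (simp add: coprime_commute)
  then have "coprime m (int p ^ k)" by simp
  then show ?thesis using that by (metis bezout_int coprime_imp_gcd_eq_1)
qed

text \<open>A rational number that is integral at p is congruent to an integer modulo p.\<close>

lemma padic_abs_approximate:
  assumes p: "prime p" and x: "padic_abs p x \<le> 1"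
  obtains a :: int where "padic_abs p (x - of_int a) \<le> 1 / real p"
proof -
  obtain m b :: int where m: "\<not> int p dvd m" "of_int m * x = of_int b"
    using x padic_abs_le_1_iff[OF p] by (auto elim: Ints_cases)
  \<comment> \<open>the integer is r b, where r is an inverse modulo p of the denominator m of x = b / m\<close>
  obtain r s where rs: "r * m + s * int p ^ 1 = 1" using bezout_prime_power[OF p m(1)] .
  have m0: "m \<noteq> 0" using m by auto
  have "of_int m * (x - of_int (r * b)) = of_int (b - m * r * b)" using m by (simp add: algebra_simps)
  also have "b - m * r * b = b * (1 - r * m)" by (simp add: algebra_simps)
  also have "1 - r * m = s * int p" using rs by simp
  finally have e: "of_int m * (x - of_int (r * b)) = of_nat p ^ 1 * of_int (b * s)" by simp
  have "padic_abs p (of_int m) = 1"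
    using padic_abs_quotient[OF p, of m 1] m0 m by (simp add: not_dvd_imp_multiplicity_0)
  then have "padic_abs p (x - of_int (r * b)) = 1 / real p * padic_abs p (of_int (b * s))"
    using arg_cong[OF e, of "padic_abs p"] padic_abs_prime_power[OF p, of 1]
    unfolding padic_abs_mult[OF p, of "of_int m"] padic_abs_mult[OF p, of "of_nat p ^ 1"] by simp
  also have "\<dots> \<le> 1 / real p" using padic_abs_of_int_le[OF p, of "b * s"]
    by (simp add: divide_right_mono del: of_int_mult)
  finally show ?thesis by (rule that)
qed

section \<open>The ring of p-adic numbers\<close>

text \<open>
  The Cauchy sequences of rational numbers for the p-adic absolute value, that is, the carrier of
  the ring of which the p-adic numbers are a quotient.
\<close>

definition cauchy_seqs :: "nat \<Rightarrow> (nat \<Rightarrow> rat) set" where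
  "cauchy_seqs p = {X. \<forall>e>0. \<exists>N. \<forall>m\<ge>N. \<forall>n\<ge>N. padic_abs p (X m - X n) < e}"

lemma padic_cauchy_simps [simp]:
  "carrier (padic_cauchy p) = cauchy_seqs p"
  "\<one>\<^bsub>padic_cauchy p\<^esub> = (\<lambda>_. 1)"
  "\<zero>\<^bsub>padic_cauchy p\<^esub> = (\<lambda>_. 0)"
  "X \<otimes>\<^bsub>padic_cauchy p\<^esub> Y = (\<lambda>n. X n * Y n)"
  "X \<oplus>\<^bsub>padic_cauchy p\<^esub> Y = (\<lambda>n. X n + Y n)"
  by (simp_all add: padic_cauchy_def cauchy_seqs_def)

lemma cauchy_seqs_const [simp]: "(\<lambda>_. c) \<in> cauchy_seqs p"
  by (simp add: cauchy_seqs_def)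

lemma cauchy_seqsE:
  assumes "X \<in> cauchy_seqs p" "e > 0"
  obtains N where "\<And>m n. m \<ge> N \<Longrightarrow> n \<ge> N \<Longrightarrow> padic_abs p (X m - X n) < e"
  using assms unfolding cauchy_seqs_def by blast

lemma cauchy_seqs_bounded:
  assumes p: "prime p" and "X \<in> cauchy_seqs p"
  obtains B where "B > 0" "\<And>n. padic_abs p (X n) \<le> B"
proof -
  obtain N where N: "\<And>m n. m \<ge> N \<Longrightarrow> n \<ge> N \<Longrightarrow> padic_abs p (X m - X n) < 1"
    using cauchy_seqsE[OF assms(2) zero_less_one] by blast
  define B where "B = Max (insert 1 ((\<lambda>n. padic_abs p (X n)) ` {..N}))"
  have "padic_abs p (X n) \<le> B" for n
  proof (cases "n \<le> N")
    case True then show ?thesis unfolding B_def by (intro Max_ge) auto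
  next
    case False
    then have "padic_abs p (X n - X N) \<le> 1" using N[of n N] by simp
    moreover have "1 \<le> B" "padic_abs p (X N) \<le> B" unfolding B_def by (intro Max_ge; simp)+
    ultimately show ?thesis using padic_abs_add[OF p, of "X n - X N" "X N"] by simp
  qed
  moreover have "B > 0" unfolding B_def by (subst Max_gr_iff) auto
  ultimately show ?thesis using that by blast
qed

lemma cauchy_seqs_add:
  assumes p: "prime p" and "X \<in> cauchy_seqs p" "Y \<in> cauchy_seqs p"
  shows "(\<lambda>n. X n + Y n) \<in> cauchy_seqs p"
  unfolding cauchy_seqs_def
proof (clarsimp)
  fix e :: real assume e: "e > 0"
  obtain N where N: "\<And>m n. m \<ge> N \<Longrightarrow> n \<ge> N \<Longrightarrow> padic_abs p (X m - X n) < e"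
    using assms(2) e unfolding cauchy_seqs_def by blast
  obtain M where M: "\<And>m n. m \<ge> M \<Longrightarrow> n \<ge> M \<Longrightarrow> padic_abs p (Y m - Y n) < e"
    using assms(3) e unfolding cauchy_seqs_def by blast
  have "padic_abs p (X m + Y m - (X n + Y n)) < e" if "m \<ge> max M N" "n \<ge> max M N" for m n
  proof -
    have eq: "X m + Y m - (X n + Y n) = (X m - X n) + (Y m - Y n)" by simp
    show ?thesis unfolding eq
      using padic_abs_add[OF p, of "X m - X n" "Y m - Y n"] N[of m n] M[of m n] that by auto
  qed
  then show "\<exists>N. \<forall>m\<ge>N. \<forall>n\<ge>N. padic_abs p (X m + Y m - (X n + Y n)) < e" by blast
qed

lemma cauchy_seqs_mult:
  assumes p: "prime p" and X: "X \<in> cauchy_seqs p" and Y: "Y \<in> cauchy_seqs p"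
  shows "(\<lambda>n. X n * Y n) \<in> cauchy_seqs p"
proof -
  obtain A where A: "A > 0" "\<And>n. padic_abs p (X n) \<le> A" using cauchy_seqs_bounded[OF p X] by blast
  obtain B where B: "B > 0" "\<And>n. padic_abs p (Y n) \<le> B" using cauchy_seqs_bounded[OF p Y] by blast
  show ?thesis
    unfolding cauchy_seqs_def
  proof (clarsimp)
    fix e :: real assume e: "e > 0"
    obtain N where N: "\<And>m n. m \<ge> N \<Longrightarrow> n \<ge> N \<Longrightarrow> padic_abs p (X m - X n) < e / B"
      using cauchy_seqsE[OF X, of "e / B"] e B(1) by auto
    obtain M where M: "\<And>m n. m \<ge> M \<Longrightarrow> n \<ge> M \<Longrightarrow> padic_abs p (Y m - Y n) < e / A"
      using cauchy_seqsE[OF Y, of "e / A"] e A(1) by auto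
    have "padic_abs p (X m * Y m - X n * Y n) < e" if mn: "m \<ge> max M N" "n \<ge> max M N" for m n
    proof -
      have eq: "X m * Y m - X n * Y n = (X m - X n) * Y m + X n * (Y m - Y n)"
        by (simp add: algebra_simps)
      have "padic_abs p (X m - X n) * padic_abs p (Y m) \<le> padic_abs p (X m - X n) * B"
        using B(2) by (intro mult_left_mono padic_abs_nonneg)
      also have "\<dots> < e" using N[of m n] mn B(1) by (simp add: field_simps)
      finally have 1: "padic_abs p ((X m - X n) * Y m) < e" by (simp add: padic_abs_mult[OF p])
      have "padic_abs p (X n) * padic_abs p (Y m - Y n) \<le> A * padic_abs p (Y m - Y n)"
        using A(2) by (intro mult_right_mono padic_abs_nonneg)
      also have "\<dots> < e" using M[of m n] mn A(1) by (simp add: field_simps)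
      finally have 2: "padic_abs p (X n * (Y m - Y n)) < e" by (simp add: padic_abs_mult[OF p])
      show ?thesis unfolding eq
        using 1 2 padic_abs_add[OF p, of "(X m - X n) * Y m" "X n * (Y m - Y n)"] by simp
    qed
    then show "\<exists>N. \<forall>m\<ge>N. \<forall>n\<ge>N. padic_abs p (X m * Y m - X n * Y n) < e" by blast
  qed
qed

lemma cauchy_seqs_uminus: "X \<in> cauchy_seqs p \<Longrightarrow> (\<lambda>n. - X n) \<in> cauchy_seqs p"
proof -
  have "padic_abs p (X n - X m) = padic_abs p (X m - X n)" for m n
    using padic_abs_uminus[of p "X m - X n"] by simp
  then show "X \<in> cauchy_seqs p \<Longrightarrow> ?thesis"
    unfolding cauchy_seqs_def by (simp add: uminus_add_conv_diff)
qed

lemma padic_null_iff: "X \<in> padic_null p \<longleftrightarrow> (\<forall>e>0. \<exists>N. \<forall>n\<ge>N. padic_abs p (X n) < e)"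
  unfolding padic_null_def by (simp add: LIMSEQ_iff padic_abs_nonneg)

lemma padic_null_add:
  assumes p: "prime p" and "X \<in> padic_null p" "Y \<in> padic_null p"
  shows "(\<lambda>n. X n + Y n) \<in> padic_null p"
  unfolding padic_null_iff
proof (intro allI impI)
  fix e :: real assume e: "e > 0"
  obtain N M where N: "\<forall>n\<ge>N. padic_abs p (X n) < e" and M: "\<forall>n\<ge>M. padic_abs p (Y n) < e"
    using assms e unfolding padic_null_iff by blast
  have "padic_abs p (X n + Y n) < e" if "n \<ge> max M N" for n
    using padic_abs_add[OF p, of "X n" "Y n"] N M that by (meson max.bounded_iff max_less_iff_conj le_less_trans)
  then show "\<exists>N. \<forall>n\<ge>N. padic_abs p (X n + Y n) < e" by blast
qed

lemma padic_null_uminus: "X \<in> padic_null p \<Longrightarrow> (\<lambda>n. - X n) \<in> padic_null p"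
  by (simp add: padic_null_def)

lemma padic_null_mult:
  assumes p: "prime p" and X: "X \<in> padic_null p" and Y: "Y \<in> cauchy_seqs p"
  shows "(\<lambda>n. X n * Y n) \<in> padic_null p"
  unfolding padic_null_iff
proof (intro allI impI)
  fix e :: real assume e: "e > 0"
  obtain B where B: "B > 0" "\<And>n. padic_abs p (Y n) \<le> B" using cauchy_seqs_bounded[OF p Y] by blast
  obtain N where N: "\<forall>n\<ge>N. padic_abs p (X n) < e / B"
    using X e B(1) unfolding padic_null_iff by (meson divide_pos_pos)
  have "padic_abs p (X n * Y n) < e" if "n \<ge> N" for n
  proof -
    have "padic_abs p (X n) * padic_abs p (Y n) \<le> padic_abs p (X n) * B"
      using B(2) by (intro mult_left_mono padic_abs_nonneg)
    also have "\<dots> < e" using N that B(1) by (simp add: field_simps)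
    finally show ?thesis by (simp add: padic_abs_mult[OF p])
  qed
  then show "\<exists>N. \<forall>n\<ge>N. padic_abs p (X n * Y n) < e" by blast
qed

lemma padic_null_imp_cauchy:
  assumes p: "prime p" and X: "X \<in> padic_null p" shows "X \<in> cauchy_seqs p"
  unfolding cauchy_seqs_def
proof (clarsimp)
  fix e :: real assume "e > 0"
  then obtain N where N: "\<forall>n\<ge>N. padic_abs p (X n) < e" using X unfolding padic_null_iff by blast
  have "padic_abs p (X m - X n) < e" if "m \<ge> N" "n \<ge> N" for m n
    using padic_abs_diff[OF p, of "X m" "X n"] N that by (meson max_less_iff_conj le_less_trans)
  then show "\<exists>N. \<forall>m\<ge>N. \<forall>n\<ge>N. padic_abs p (X m - X n) < e" by blast
qed

lemma cring_padic_cauchy: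
  assumes p: "prime p" shows "cring (padic_cauchy p)"
proof (rule cringI)
  show "abelian_group (padic_cauchy p)"
  proof (rule abelian_groupI)
    fix X assume "X \<in> carrier (padic_cauchy p)"
    then show "\<exists>Y\<in>carrier (padic_cauchy p). Y \<oplus>\<^bsub>padic_cauchy p\<^esub> X = \<zero>\<^bsub>padic_cauchy p\<^esub>"
      using cauchy_seqs_uminus[of X p] by (intro bexI[of _ "\<lambda>n. - X n"]) auto
  qed (use cauchy_seqs_add[OF p] in \<open>auto simp: algebra_simps\<close>)
  show "Group.comm_monoid (padic_cauchy p)"
    by (rule comm_monoidI) (use cauchy_seqs_mult[OF p] in \<open>auto simp: algebra_simps\<close>)
qed (auto simp: algebra_simps)

lemma padic_cauchy_minus:
  assumes p: "prime p" and "X \<in> cauchy_seqs p"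
  shows "\<ominus>\<^bsub>padic_cauchy p\<^esub> X = (\<lambda>n. - X n)"
proof -
  interpret cring "padic_cauchy p" by (rule cring_padic_cauchy[OF p])
  show ?thesis
    using assms cauchy_seqs_uminus[of X p] by (intro minus_equality) auto
qed

lemma ideal_padic_null:
  assumes p: "prime p" shows "ideal (padic_null p) (padic_cauchy p)"
proof -
  interpret cring "padic_cauchy p" by (rule cring_padic_cauchy[OF p])
  show ?thesis
  proof (rule idealI)
    show "subgroup (padic_null p) (add_monoid (padic_cauchy p))"
    proof (rule add.subgroupI)
      show "padic_null p \<subseteq> carrier (padic_cauchy p)" using padic_null_imp_cauchy[OF p] by auto
      show "padic_null p \<noteq> {}" using padic_null_iff[of "\<lambda>_. 0" p] by auto
    next
      fix X assume "X \<in> padic_null p"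
      then show "\<ominus>\<^bsub>padic_cauchy p\<^esub> X \<in> padic_null p"
        using padic_cauchy_minus[OF p padic_null_imp_cauchy[OF p]] padic_null_uminus by metis
    next
      fix X Y assume "X \<in> padic_null p" "Y \<in> padic_null p"
      then show "X \<oplus>\<^bsub>padic_cauchy p\<^esub> Y \<in> padic_null p"
        using padic_null_add[OF p] by simp
    qed
  next
    fix X Y assume XY: "X \<in> padic_null p" "Y \<in> carrier (padic_cauchy p)"
    show "Y \<otimes>\<^bsub>padic_cauchy p\<^esub> X \<in> padic_null p" "X \<otimes>\<^bsub>padic_cauchy p\<^esub> Y \<in> padic_null p"
      using padic_null_mult[OF p, of X Y] XY by (simp_all add: mult.commute)
  qed (rule ring_axioms)
qed

text \<open>The class of a Cauchy sequence in the field of p-adic numbers.\<close>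

definition padic_class :: "nat \<Rightarrow> (nat \<Rightarrow> rat) \<Rightarrow> (nat \<Rightarrow> rat) set" where
  "padic_class p X = padic_null p +>\<^bsub>padic_cauchy p\<^esub> X"

context
  fixes p :: nat
  assumes p: "prime p"
begin

interpretation C: cring "padic_cauchy p" by (rule cring_padic_cauchy[OF p])
interpretation N: ideal "padic_null p" "padic_cauchy p" by (rule ideal_padic_null[OF p])

lemma cring_padic_field: "cring (padic_field p)"
  unfolding padic_field_def using N.quotient_is_cring[OF C.cring_axioms] .

lemma padic_class_hom: "padic_class p \<in> ring_hom (padic_cauchy p) (padic_field p)"
  unfolding padic_field_def padic_class_def by (rule N.rcos_ring_hom)

lemma padic_class_closed: "X \<in> cauchy_seqs p \<Longrightarrow> padic_class p X \<in> carrier (padic_field p)"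
  using ring_hom_closed[OF padic_class_hom] by simp

lemma padic_class_add:
  "X \<in> cauchy_seqs p \<Longrightarrow> Y \<in> cauchy_seqs p \<Longrightarrow>
    padic_class p (\<lambda>n. X n + Y n) = padic_class p X \<oplus>\<^bsub>padic_field p\<^esub> padic_class p Y"
  using ring_hom_add[OF padic_class_hom, of X Y] by simp

lemma padic_class_mult:
  "X \<in> cauchy_seqs p \<Longrightarrow> Y \<in> cauchy_seqs p \<Longrightarrow>
    padic_class p (\<lambda>n. X n * Y n) = padic_class p X \<otimes>\<^bsub>padic_field p\<^esub> padic_class p Y"
  using ring_hom_mult[OF padic_class_hom, of X Y] by simp

lemma padic_class_one: "padic_class p (\<lambda>_. 1) = \<one>\<^bsub>padic_field p\<^esub>"
  using ring_hom_one[OF padic_class_hom] by simp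

lemma padic_class_iff:
  "Y \<in> padic_class p X \<longleftrightarrow> (\<exists>Z\<in>padic_null p. Y = (\<lambda>n. Z n + X n))"
  unfolding padic_class_def a_r_coset_def r_coset_def by auto

lemma padic_class_mem: "X \<in> padic_class p X"
  unfolding padic_class_iff using padic_null_iff[of "\<lambda>_. 0" p] by (intro bexI[of _ "\<lambda>_. 0"]) auto

lemma padic_field_elem:
  assumes "x \<in> carrier (padic_field p)" "X \<in> x"
  shows "X \<in> cauchy_seqs p" "x = padic_class p X"
proof -
  obtain Y where Y: "Y \<in> cauchy_seqs p" "x = padic_class p Y"
    using assms(1) unfolding padic_field_def FactRing_simps padic_class_def by auto
  obtain Z where Z: "Z \<in> padic_null p" "X = (\<lambda>n. Z n + Y n)" using assms(2) Y padic_class_iff by auto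
  show X: "X \<in> cauchy_seqs p" unfolding Z(2) by (intro cauchy_seqs_add[OF p] padic_null_imp_cauchy[OF p] Z Y)
  show "x = padic_class p X"
    using C.a_repr_independence[of X "padic_null p" Y] N.a_subgroup[unfolded additive_subgroup_def] assms(2) Y
    unfolding padic_class_def by simp
qed

lemma padic_field_nonempty:
  assumes "x \<in> carrier (padic_field p)" obtains X where "X \<in> x"
proof -
  obtain Y where Y: "x = padic_class p Y"
    using assms(1) unfolding padic_field_def FactRing_simps padic_class_def by auto
  then show ?thesis using that padic_class_mem by blast
qed

lemma padic_of_rat_eq: "padic_of_rat p q = padic_class p (\<lambda>_. q)"
  by (simp add: padic_of_rat_def padic_class_def)

lemma padic_ints_iff:
  "x \<in> padic_ints p \<longleftrightarrow> (\<exists>X\<in>cauchy_seqs p. x = padic_class p X \<and> (\<forall>n. padic_abs p (X n) \<le> 1))"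
proof
  assume "x \<in> padic_ints p"
  then show "\<exists>X\<in>cauchy_seqs p. x = padic_class p X \<and> (\<forall>n. padic_abs p (X n) \<le> 1)"
    unfolding padic_ints_def using padic_field_elem by blast
next
  assume "\<exists>X\<in>cauchy_seqs p. x = padic_class p X \<and> (\<forall>n. padic_abs p (X n) \<le> 1)"
  then show "x \<in> padic_ints p" 
    unfolding padic_ints_def using padic_class_closed padic_class_mem by blast
qed

lemma padic_of_rat_mem_ints: "padic_of_rat p q \<in> padic_ints p \<longleftrightarrow> padic_abs p q \<le> 1"
proof
  assume "padic_abs p q \<le> 1"
  then show "padic_of_rat p q \<in> padic_ints p"
    unfolding padic_ints_iff padic_of_rat_eq by (intro bexI[of _ "\<lambda>_. q"]) auto
next
  assume "padic_of_rat p q \<in> padic_ints p"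
  then obtain X where X: "X \<in> padic_of_rat p q" "\<And>n. padic_abs p (X n) \<le> 1"
    unfolding padic_ints_def by auto
  then obtain Z where Z: "Z \<in> padic_null p" "X = (\<lambda>n. Z n + q)"
    unfolding padic_of_rat_eq padic_class_iff by auto
  obtain n where n: "padic_abs p (Z n) < 1" using Z(1) unfolding padic_null_iff by (meson order_refl zero_less_one)
  have "q = X n - Z n" using Z by simp
  then show "padic_abs p q \<le> 1" using padic_abs_diff[OF p, of "X n" "Z n"] n X(2)[of n] by simp
qed

lemma padic_ints_add:
  assumes "x \<in> padic_ints p" "y \<in> padic_ints p" shows "x \<oplus>\<^bsub>padic_field p\<^esub> y \<in> padic_ints p"
proof -
  obtain X where X: "X \<in> cauchy_seqs p" "x = padic_class p X" "\<forall>n. padic_abs p (X n) \<le> 1"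
    using assms(1) unfolding padic_ints_iff by auto
  obtain Y where Y: "Y \<in> cauchy_seqs p" "y = padic_class p Y" "\<forall>n. padic_abs p (Y n) \<le> 1"
    using assms(2) unfolding padic_ints_iff by auto
  have "padic_abs p (X n + Y n) \<le> 1" for n
    using padic_abs_add[OF p, of "X n" "Y n"] X(3) Y(3) by (meson max.bounded_iff order_trans)
  then show ?thesis
    unfolding padic_ints_iff using padic_class_add[OF X(1) Y(1)] cauchy_seqs_add[OF p X(1) Y(1)] X(2) Y(2)
    by (intro bexI[of _ "\<lambda>n. X n + Y n"]) auto
qed

lemma padic_ints_mult:
  assumes "x \<in> padic_ints p" "y \<in> padic_ints p" shows "x \<otimes>\<^bsub>padic_field p\<^esub> y \<in> padic_ints p"
proof -
  obtain X where X: "X \<in> cauchy_seqs p" "x = padic_class p X" "\<forall>n. padic_abs p (X n) \<le> 1"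
    using assms(1) unfolding padic_ints_iff by auto
  obtain Y where Y: "Y \<in> cauchy_seqs p" "y = padic_class p Y" "\<forall>n. padic_abs p (Y n) \<le> 1"
    using assms(2) unfolding padic_ints_iff by auto
  have "padic_abs p (X n * Y n) \<le> 1" for n
    using X(3) Y(3) by (simp add: padic_abs_mult[OF p] mult_le_one padic_abs_nonneg)
  then show ?thesis
    unfolding padic_ints_iff using padic_class_mult[OF X(1) Y(1)] cauchy_seqs_mult[OF p X(1) Y(1)] X(2) Y(2)
    by (intro bexI[of _ "\<lambda>n. X n * Y n"]) auto
qed

text \<open>
  A Cauchy sequence is bounded, so every p-adic number becomes integral after multiplication with
  a power of p.
\<close>

lemma padic_bounded_denominator:
  assumes "x \<in> carrier (padic_field p)"
  obtains k where "padic_of_rat p (of_nat p ^ k) \<otimes>\<^bsub>padic_field p\<^esub> x \<in> padic_ints p"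
proof -
  obtain X where "X \<in> x" using padic_field_nonempty assms by blast
  then have X: "X \<in> cauchy_seqs p" "x = padic_class p X" using padic_field_elem assms by blast+
  obtain B where B: "B > 0" "\<And>n. padic_abs p (X n) \<le> B" using cauchy_seqs_bounded[OF p X(1)] by blast
  obtain k where k: "(1 / real p) ^ k < 1 / B"
    using real_arch_pow_inv[of "1 / B" "1 / real p"] B(1) prime_gt_1_nat[OF p] by auto
  have "padic_abs p (of_nat p ^ k * X n) \<le> 1" for n
  proof -
    have "(1 / real p) ^ k * padic_abs p (X n) \<le> (1 / B) * B"
      using k B by (intro mult_mono) (auto simp: padic_abs_nonneg)
    then show ?thesis using B(1) by (simp add: padic_abs_mult[OF p] padic_abs_prime_power[OF p])
  qed
  then have "padic_of_rat p (of_nat p ^ k) \<otimes>\<^bsub>padic_field p\<^esub> x \<in> padic_ints p"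
    unfolding padic_ints_iff padic_of_rat_eq X(2)
    using padic_class_mult[OF cauchy_seqs_const X(1)] cauchy_seqs_mult[OF p cauchy_seqs_const X(1)]
    by (intro bexI[of _ "\<lambda>n. of_nat p ^ k * X n"]) auto
  then show ?thesis by (rule that)
qed

lemma padic_ints_approximate:
  assumes "x \<in> padic_ints p"
  obtains a :: int and y where "y \<in> padic_ints p"
    "x = padic_of_rat p (of_int a) \<oplus>\<^bsub>padic_field p\<^esub> padic_of_rat p (of_nat p) \<otimes>\<^bsub>padic_field p\<^esub> y"
proof -
  obtain X where X: "X \<in> cauchy_seqs p" "x = padic_class p X" "\<forall>n. padic_abs p (X n) \<le> 1"
    using assms unfolding padic_ints_iff by auto
  have p0: "real p > 0" "(of_nat p :: rat) \<noteq> 0" using prime_gt_0_nat[OF p] by auto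
  obtain N where N: "\<And>m n. m \<ge> N \<Longrightarrow> n \<ge> N \<Longrightarrow> padic_abs p (X m - X n) < 1 / real p"
    using cauchy_seqsE[OF X(1), of "1 / real p"] p0(1) by auto
  obtain a where a: "padic_abs p (X N - of_int a) \<le> 1 / real p"
    using padic_abs_approximate[OF p] X(3) by blast
  \<comment> \<open>from N on, X is congruent to a modulo p; the earlier terms are split off as a null sequence\<close>
  define Z where "Z n = (if n < N then X n - of_int a else 0)" for n
  define Y where "Y n = 1 / of_nat p * (X n + (- of_int a)) + - (1 / of_nat p * Z n)" for n
  have Z: "Z \<in> padic_null p" unfolding padic_null_iff Z_def
    by (auto intro!: exI[of _ N])
  then have Zc: "Z \<in> cauchy_seqs p" by (rule padic_null_imp_cauchy[OF p])
  have Y: "Y \<in> cauchy_seqs p"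
    unfolding Y_def
    by (intro cauchy_seqs_add[OF p] cauchy_seqs_mult[OF p] cauchy_seqs_const cauchy_seqs_uminus X Zc)
  have Yle: "padic_abs p (Y n) \<le> 1" for n
  proof (cases "n < N")
    case False
    have "padic_abs p (X n - of_int a) \<le> 1 / real p"
      using padic_abs_add[OF p, of "X n - X N" "X N - of_int a"] a N[of n N] False by simp
    moreover have "of_nat p * Y n = X n - of_int a" using False p0 by (simp add: Y_def Z_def)
    ultimately have "padic_abs p (of_nat p * Y n) \<le> 1 / real p" by simp
    moreover have "padic_abs p (of_nat p) = 1 / real p" using padic_abs_prime_power[OF p, of 1] by simp
    ultimately show ?thesis using p0 by (simp add: padic_abs_mult[OF p] field_simps)
  qed (simp add: Y_def Z_def)
  have XY: "X = (\<lambda>n. Z n + (of_int a + of_nat p * Y n))"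
    using p0 by (auto simp: Y_def field_simps)
  then have "X \<in> padic_class p (\<lambda>n. of_int a + of_nat p * Y n)"
    unfolding padic_class_iff using Z by blast
  moreover have "(\<lambda>n. of_int a + of_nat p * Y n) \<in> cauchy_seqs p"
    by (intro cauchy_seqs_add[OF p] cauchy_seqs_mult[OF p] cauchy_seqs_const Y)
  ultimately have "x = padic_class p (\<lambda>n. of_int a + of_nat p * Y n)"
    using padic_field_elem(2)[OF padic_class_closed] X(2) by metis
  also have "\<dots> = padic_of_rat p (of_int a) \<oplus>\<^bsub>padic_field p\<^esub>
      padic_of_rat p (of_nat p) \<otimes>\<^bsub>padic_field p\<^esub> padic_class p Y"
    unfolding padic_of_rat_eq
    by (simp add: padic_class_add padic_class_mult cauchy_seqs_mult[OF p] Y)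
  finally show ?thesis using that[of "padic_class p Y" a] Y Yle unfolding padic_ints_iff by blast
qed

end


section \<open>Rational lattices\<close>

subsection \<open>Symmetric bilinear forms\<close>

context
  fixes b :: "rat ^ 'n::finite \<Rightarrow> rat ^ 'n \<Rightarrow> rat"
  assumes b: "symmetric_bilinear b"
begin

lemma sb_sym: "b x y = b y x"
  using b by (simp add: symmetric_bilinear_def)

lemma sb_add_right: "b x (y + z) = b x y + b x z"
  using b by (simp add: symmetric_bilinear_def Vector_Spaces.linear_iff)

lemma sb_scale_right: "b x (q *s y) = q * b x y"
  using b by (simp add: symmetric_bilinear_def Vector_Spaces.linear_iff)

lemma sb_add_left: "b (x + y) z = b x z + b y z"
  using sb_sym sb_add_right by metis

lemma sb_scale_left: "b (q *s x) y = q * b x y"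
  using sb_sym sb_scale_right by metis

lemma sb_zero [simp]: "b 0 x = 0" "b x 0 = 0"
  using sb_scale_left[of 0 x x] sb_scale_right[of x 0 x] by simp_all

lemma sb_diff_right: "b x (y - z) = b x y - b x z"
  using sb_add_right[of x y "- z"] sb_scale_right[of x "- 1" z] by simp

lemma sb_sum_right: "b x (\<Sum>i\<in>A. f i) = (\<Sum>i\<in>A. b x (f i))"
  by (induction A rule: infinite_finite_induct) (simp_all add: sb_add_right)

lemma sb_sum_left: "b (\<Sum>i\<in>A. f i) x = (\<Sum>i\<in>A. b (f i) x)"
  by (induction A rule: infinite_finite_induct) (simp_all add: sb_add_left)

lemma symmetric_bilinear_scale: "symmetric_bilinear (\<lambda>x y. q * b x y)"
  using b
  by (auto simp: symmetric_bilinear_def Vector_Spaces.linear_iff distrib_left)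

end

subsection \<open>Bases\<close>

lemma det_nonzero_iff_rows_independent:
  fixes e :: "'n::finite \<Rightarrow> 'a::field ^ 'n"
  shows "det (\<chi> i. e i) \<noteq> 0 \<longleftrightarrow> (\<forall>c. (\<Sum>i\<in>UNIV. c i *s e i) = 0 \<longrightarrow> (\<forall>i. c i = 0))"
  unfolding invertible_det_nz[symmetric] invertible_right_inverse matrix_right_invertible_independent_rows
  by (simp add: row_def)

lemma expand_in_basis:
  fixes e :: "'n::finite \<Rightarrow> 'a::field ^ 'n"
  assumes "det (\<chi> i. e i) \<noteq> 0"
  obtains q where "x = (\<Sum>i\<in>UNIV. q i *s e i)"
proof -
  obtain B where B: "B ** (\<chi> i. e i) = mat 1"
    using assms unfolding invertible_det_nz[symmetric] invertible_left_inverse by blast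
  have "x = (x v* B) v* (\<chi> i. e i)" by (simp add: vector_matrix_mul_assoc B)
  also have "\<dots> = (\<Sum>i\<in>UNIV. (x v* B) $ i *s e i)"
    by (simp add: vec_eq_iff vector_matrix_mult_def[of _ "\<chi> i. e i"] mult.commute)
  finally show ?thesis by (rule that)
qed

lemma basis_family_iff:
  fixes e :: "'n::finite \<Rightarrow> rat ^ 'n"
  shows "inj e \<and> vec.independent (range e) \<longleftrightarrow> det (\<chi> i. e i) \<noteq> 0"
proof
  assume e: "inj e \<and> vec.independent (range e)"
  show "det (\<chi> i. e i) \<noteq> 0"
    unfolding det_nonzero_iff_rows_independent
  proof (intro allI impI)
    fix c i assume "(\<Sum>i\<in>UNIV. c i *s e i) = 0"
    moreover have "(\<Sum>v\<in>range e. c (inv_into UNIV e v) *s v) = (\<Sum>i\<in>UNIV. c i *s e i)"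
      using e by (subst sum.reindex) auto
    ultimately have "c (inv_into UNIV e (e i)) = 0"
      using e by (intro vec.independentD[of "range e" "range e" "\<lambda>v. c (inv_into UNIV e v)"]) auto
    then show "c i = 0" using e by simp
  qed
next
  assume d: "det (\<chi> i. e i) \<noteq> 0"
  have "inj e"
  proof (rule injI, rule ccontr)
    fix i j assume ij: "e i = e j" "i \<noteq> j"
    have "det (\<chi> i. e i) = 0"
      by (rule det_identical_rows[of i j]) (use ij in \<open>auto simp: row_def\<close>)
    then show False using d by simp
  qed
  moreover have "rows (\<chi> i. e i) = range e" by (auto simp: rows_def row_def)
  ultimately show "inj e \<and> vec.independent (range e)" using det_dependent_rows[of "\<chi> i. e i"] d by metis
qed

text \<open>
  Bases are handled through the determinant of the matrix whose rows are the given vectors.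
\<close>

lemma is_int_basis_iff:
  "is_int_basis e L \<longleftrightarrow> det (\<chi> i. e i) \<noteq> 0 \<and>
     L = {\<Sum>i\<in>UNIV. of_int (c i) *s e i | c :: 'n::finite \<Rightarrow> int. True}"
  unfolding is_int_basis_def basis_family_iff[symmetric] by blast

lemma basis_coords_unique:
  fixes e :: "'n::finite \<Rightarrow> rat ^ 'n"
  assumes "det (\<chi> i. e i) \<noteq> 0" "(\<Sum>i\<in>UNIV. c i *s e i) = (\<Sum>i\<in>UNIV. d i *s e i)"
  shows "c = d"
proof
  fix i
  have "(\<Sum>i\<in>UNIV. (c i - d i) *s e i) = 0"
    using assms(2) by (simp add: vec.scale_left_diff_distrib sum_subtractf)
  then show "c i = d i" using assms(1) unfolding det_nonzero_iff_rows_independent by fastforce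
qed

lemma int_basis_coords:
  fixes e :: "'n::finite \<Rightarrow> rat ^ 'n"
  assumes "is_int_basis e L" shows "(\<Sum>i\<in>UNIV. q i *s e i) \<in> L \<longleftrightarrow> (\<forall>i. q i \<in> \<int>)"
proof
  assume "(\<Sum>i\<in>UNIV. q i *s e i) \<in> L"
  then obtain c where "(\<Sum>i\<in>UNIV. q i *s e i) = (\<Sum>i\<in>UNIV. of_int (c i) *s e i)"
    using assms unfolding is_int_basis_iff by blast
  then have "q = (\<lambda>i. of_int (c i))"
    using assms unfolding is_int_basis_iff by (intro basis_coords_unique) auto
  then show "\<forall>i. q i \<in> \<int>" by auto
next
  assume "\<forall>i. q i \<in> \<int>"
  then have "q i = of_int \<lfloor>q i\<rfloor>" for i by (metis Ints_cases floor_of_int)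
  then have "(\<Sum>i\<in>UNIV. q i *s e i) = (\<Sum>i\<in>UNIV. of_int \<lfloor>q i\<rfloor> *s e i)" by metis
  moreover have "L = {\<Sum>i\<in>UNIV. of_int (c i) *s e i | c. True}" using assms is_int_basis_iff by blast
  ultimately show "(\<Sum>i\<in>UNIV. q i *s e i) \<in> L" by auto
qed

lemma int_basis_mem: 
  fixes e :: "'n::finite \<Rightarrow> rat ^ 'n"
  assumes "is_int_basis e L" shows "e i \<in> L"
proof -
  have "e i = (\<Sum>j\<in>UNIV. (if j = i then 1 else 0) *s e j)"
    by (simp add: if_distrib[of "\<lambda>c. c *s _"] sum.delta cong: if_cong)
  then show ?thesis using int_basis_coords[OF assms, of "\<lambda>j. if j = i then 1 else 0"] by auto
qed

subsection \<open>Lattices of full rank\<close>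

lemma full_rank_lattice_closed:
  assumes "full_rank_lattice L"
  shows full_rank_zero: "0 \<in> L"
    and full_rank_add: "x \<in> L \<Longrightarrow> y \<in> L \<Longrightarrow> x + y \<in> L"
    and full_rank_scale: "q \<in> \<int> \<Longrightarrow> x \<in> L \<Longrightarrow> q *s x \<in> L"
proof -
  obtain e where e: "is_int_basis e L" using assms unfolding full_rank_lattice_def by blast
  then have d: "det (\<chi> i. e i) \<noteq> 0" by (simp add: is_int_basis_iff)
  show "0 \<in> L" using int_basis_coords[OF e, of "\<lambda>_. 0"] by simp
  {
    assume xy: "x \<in> L" "y \<in> L"
    obtain q where q: "x = (\<Sum>i\<in>UNIV. q i *s e i)" using expand_in_basis[OF d] .
    obtain r where r: "y = (\<Sum>i\<in>UNIV. r i *s e i)" using expand_in_basis[OF d] .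
    have "x + y = (\<Sum>i\<in>UNIV. (q i + r i) *s e i)"
      unfolding q r by (simp add: vec.scale_left_distrib sum.distrib)
    then show "x + y \<in> L"
      using int_basis_coords[OF e, of q] int_basis_coords[OF e, of r]
        int_basis_coords[OF e, of "\<lambda>i. q i + r i"] q r xy by simp
  }
  assume qx: "q \<in> \<int>" "x \<in> L"
  obtain r where r: "x = (\<Sum>i\<in>UNIV. r i *s e i)" using expand_in_basis[OF d] .
  have "q *s x = (\<Sum>i\<in>UNIV. (q * r i) *s e i)" unfolding r by (simp add: vec.scale_sum_right)
  then show "q *s x \<in> L"
    using int_basis_coords[OF e, of r] int_basis_coords[OF e, of "\<lambda>i. q * r i"] qx r by simp
qed

lemma full_rank_sum: "full_rank_lattice L \<Longrightarrow> (\<And>i. i \<in> A \<Longrightarrow> f i \<in> L) \<Longrightarrow> (\<Sum>i\<in>A. f i) \<in> L"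
  by (induction A rule: infinite_finite_induct) (auto simp: full_rank_zero full_rank_add)

lemma common_denominator:
  fixes q :: "'n::finite \<Rightarrow> rat"
  obtains m :: nat where "m > 0" "\<And>i. of_nat m * q i \<in> \<int>"
proof -
  define d where "d i = nat (snd (quotient_of (q i)))" for i
  have d: "d i > 0" "of_nat (d i) * q i \<in> \<int>" for i
  proof -
    obtain a c where ac: "quotient_of (q i) = (a, c)" by fastforce
    have c: "c > 0" "q i = of_int a / of_int c"
      using ac quotient_of_denom_pos quotient_of_div by blast+
    have "d i = nat c" by (simp add: d_def ac)
    then show "d i > 0" "of_nat (d i) * q i \<in> \<int>" using c by simp_all
  qed
  have "of_nat (\<Prod>i\<in>UNIV. d i) * q i \<in> \<int>" for i
  proof -
    have "of_nat (\<Prod>i\<in>UNIV. d i) * q i = of_nat (\<Prod>i\<in>UNIV - {i}. d i) * (of_nat (d i) * q i)"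
      by (subst prod.remove[of UNIV i]) (simp_all add: mult_ac)
    then show ?thesis using d(2)[of i] by (metis Ints_mult Ints_of_nat)
  qed
  moreover have "(\<Prod>i\<in>UNIV. d i) > 0" using d(1) by (simp add: prod_pos)
  ultimately show ?thesis using that by blast
qed

lemma full_rank_multiple:
  assumes "full_rank_lattice L"
  obtains m :: nat where "m > 0" "of_nat m *s v \<in> L"
proof -
  obtain e where e: "is_int_basis e L" using assms unfolding full_rank_lattice_def by blast
  then have d: "det (\<chi> i. e i) \<noteq> 0" by (simp add: is_int_basis_iff)
  obtain q where q: "v = (\<Sum>i\<in>UNIV. q i *s e i)" using expand_in_basis[OF d] .
  obtain m :: nat where m: "m > 0" "\<And>i. of_nat m * q i \<in> \<int>" using common_denominator[of q] by blast
  have "of_nat m *s v = (\<Sum>i\<in>UNIV. (of_nat m * q i) *s e i)" unfolding q by (simp add: vec.scale_sum_right)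
  then show ?thesis using that[OF m(1)] int_basis_coords[OF e, of "\<lambda>i. of_nat m * q i"] m by simp
qed

lemma full_rank_span: "full_rank_lattice L \<Longrightarrow> vec.span L = UNIV"
proof -
  assume L: "full_rank_lattice L"
  have "v \<in> vec.span L" for v
  proof -
    obtain m :: nat where m: "m > 0" "of_nat m *s v \<in> L" using full_rank_multiple[OF L] by blast
    then have "(1 / of_nat m) *s (of_nat m *s v) \<in> vec.span L"
      by (intro vec.span_scale vec.span_base)
    then show ?thesis using m(1) by simp
  qed
  then show ?thesis by auto
qed

lemma det_int_matrix: "det (\<chi> i j. rat_of_int (t i j)) = of_int (det (\<chi> i j. t i j))"
  by (simp add: det_def)

lemma det_family_transform:
  fixes e f :: "'n::finite \<Rightarrow> 'a::field ^ 'n"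
  assumes "\<And>i. f i = (\<Sum>j\<in>UNIV. t i j *s e j)"
  shows "det (\<chi> i. f i) = det (\<chi> i j. t i j) * det (\<chi> i. e i)"
proof -
  have "(\<chi> i. f i) = (\<chi> i j. t i j) ** (\<chi> i. e i)"
    by (simp add: vec_eq_iff matrix_matrix_mult_def assms)
  then show ?thesis by (simp add: det_mul)
qed

lemma span_UNIV_basis:
  fixes X :: "(rat ^ 'n::finite) set"
  assumes "vec.span X = UNIV"
  obtains f :: "'n \<Rightarrow> rat ^ 'n" where "\<And>i. f i \<in> X" "det (\<chi> i. f i) \<noteq> 0"
proof -
  obtain B where B: "B \<subseteq> X" "vec.independent B" "X \<subseteq> vec.span B"
    using vec.maximal_independent_subset[of X] by blast
  have sp: "vec.span B = UNIV" using B(3) assms vec.span_mono[OF B(3)] by (metis top.extremum_uniqueI vec.span_span)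
  have "finite B" using B(2) vec.independent_bound_general by blast
  have "card B = vec.dim (UNIV :: (rat ^ 'n) set)"
    using vec.dim_eq_card[OF _ B(2), of UNIV] sp by simp
  then have "card B = CARD('n)" by (simp add: vec.dim_UNIV vec.dimension_def card_cart_basis)
  then obtain f where f: "bij_betw f (UNIV :: 'n set) B"
    using \<open>finite B\<close> finite_same_card_bij[of "UNIV :: 'n set" B] by auto
  have "inj f" "range f = B" using f by (auto simp: bij_betw_def)
  then have "det (\<chi> i. f i) \<noteq> 0" using B(2) basis_family_iff[of f] by simp
  then show ?thesis using that[of f] \<open>range f = B\<close> B(1) by blast
qed

text \<open>
  A subgroup of a lattice that spans the rational space is itself a lattice of full rank.
  Determinants of families of vectors in the subgroup are integral multiples of the determinant of
  a basis of the lattice. A family whose determinant is nonzero and of minimal absolute value is a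
  basis of the subgroup, as reducing a non-integral coordinate q of some vector modulo 1, and
  exchanging that vector for the corresponding member of the family, would multiply the
  determinant by the fractional part of q.
\<close>

lemma full_rank_sublattice:
  fixes X :: "(rat ^ 'n::finite) set"
  assumes L: "full_rank_lattice L" and X: "X \<subseteq> L" "vec.span X = UNIV"
    and X0: "0 \<in> X" and Xadd: "\<And>x y. x \<in> X \<Longrightarrow> y \<in> X \<Longrightarrow> x + y \<in> X"
    and Xint: "\<And>x a. x \<in> X \<Longrightarrow> of_int a *s x \<in> X"
  shows "full_rank_lattice X"
proof -
  obtain e where e: "is_int_basis e L" using L unfolding full_rank_lattice_def by blast
  then have d: "det (\<chi> i. e i) \<noteq> 0" by (simp add: is_int_basis_iff)
  have int: "\<exists>k::nat. \<bar>det (\<chi> i. f i)\<bar> = of_nat k * \<bar>det (\<chi> i. e i)\<bar>" if "\<And>i. f i \<in> L" for f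
  proof -
    have "\<exists>c. f i = (\<Sum>j\<in>UNIV. of_int (c j) *s e j)" for i
      using that[of i] e unfolding is_int_basis_iff by blast
    then obtain t where t: "\<And>i. f i = (\<Sum>j\<in>UNIV. of_int (t i j) *s e j)" by metis
    have "\<bar>det (\<chi> i. f i)\<bar> = of_nat (nat \<bar>det (\<chi> i j. t i j)\<bar>) * \<bar>det (\<chi> i. e i)\<bar>"
      using det_family_transform[OF t] by (simp add: det_int_matrix abs_mult)
    then show ?thesis by blast
  qed
  define P where "P k \<longleftrightarrow> k > 0 \<and>
    (\<exists>f. (\<forall>i. f i \<in> X) \<and> \<bar>det (\<chi> i. f i)\<bar> = of_nat k * \<bar>det (\<chi> i. e i)\<bar>)" for k :: nat
  obtain f0 where f0: "\<And>i. f0 i \<in> X" "det (\<chi> i. f0 i) \<noteq> 0" using span_UNIV_basis[OF X(2)] by blast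
  then obtain k0 where k0: "\<bar>det (\<chi> i. f0 i)\<bar> = of_nat k0 * \<bar>det (\<chi> i. e i)\<bar>"
    using int[of f0] X(1) by blast
  then have "k0 > 0" using f0(2) by (cases k0) auto
  then have "P k0" unfolding P_def using f0(1) k0 by blast
  then have "\<exists>k. P k" by blast
  then have LP: "P (LEAST k. P k)" by (rule LeastI_ex)
  define k where "k = (LEAST k. P k)"
  obtain f where f: "\<And>i. f i \<in> X" "\<bar>det (\<chi> i. f i)\<bar> = of_nat k * \<bar>det (\<chi> i. e i)\<bar>" and k: "k > 0"
  proof -
    have "P k" using LP by (simp only: k_def)
    then show ?thesis using that unfolding P_def by fast
  qed
  have df: "det (\<chi> i. f i) \<noteq> 0" using f(2) k d by auto
  have Xsum: "(\<Sum>i\<in>A. of_int (c i) *s f i) \<in> X" for c and A :: "'n set"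
    by (induction A rule: infinite_finite_induct) (auto simp: X0 Xadd Xint f)
  have "x \<in> {\<Sum>i\<in>UNIV. of_int (c i) *s f i | c. True}" if x: "x \<in> X" for x
  proof -
    obtain q where q: "x = (\<Sum>i\<in>UNIV. q i *s f i)" using expand_in_basis[OF df] .
    have qi: "of_int \<lfloor>q i\<rfloor> = q i" for i
    proof (rule ccontr)
      assume ne: "of_int \<lfloor>q i\<rfloor> \<noteq> q i"
      define q' where "q' = q(i := q i - of_int \<lfloor>q i\<rfloor>)"
      define y where "y = x + of_int (- \<lfloor>q i\<rfloor>) *s f i"
      define g where "g j = (if j = i then y else f j)" for j
      have "y \<in> X" unfolding y_def by (intro Xadd Xint x f(1))
      then have g: "g j \<in> X" for j unfolding g_def using f(1) by auto
      have "y = (\<Sum>j\<in>UNIV. (q j + (if j = i then - of_int \<lfloor>q i\<rfloor> else 0)) *s f j)"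
        unfolding y_def q
        by (simp add: vec.scale_left_distrib sum.distrib if_distrib[of "\<lambda>c. c *s _"] sum.delta cong: if_cong)
      also have "\<dots> = (\<Sum>j\<in>UNIV. q' j *s f j)" unfolding q'_def by (intro sum.cong) auto
      finally have "(\<chi> j. g j) = (\<chi> j. if j = i then \<Sum>j\<in>UNIV. (\<chi> j. q' j) $ j *s row j (\<chi> i. f i) else row j (\<chi> i. f i))"
        by (simp add: g_def row_def vec_eq_iff)
      then have "det (\<chi> j. g j) = q' i * det (\<chi> i. f i)"
        using cramer_lemma_transpose[of i "\<chi> j. q' j" "\<chi> i. f i"] by simp
      then have eq: "\<bar>det (\<chi> j. g j)\<bar> = \<bar>q' i\<bar> * (of_nat k * \<bar>det (\<chi> i. e i)\<bar>)"
        by (simp add: abs_mult f(2))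
      have q': "0 < q' i" "q' i < 1"
        using ne of_int_floor_le[of "q i"] floor_correct[of "q i"] unfolding q'_def
        by (simp_all only: fun_upd_same less_le) linarith+
      obtain l where l: "\<bar>det (\<chi> j. g j)\<bar> = of_nat l * \<bar>det (\<chi> i. e i)\<bar>"
        using int[of g] g X(1) by blast
      have "of_nat l = q' i * of_nat k" using eq l q' d by simp
      then have "of_nat l < (of_nat k :: rat)" "of_nat l > (0::rat)" using q' k by simp_all
      then have "l < k" "l > 0" by simp_all
      moreover have "P l" unfolding P_def using g l \<open>l > 0\<close> by blast
      ultimately show False unfolding k_def using not_less_Least by blast
    qed
    show ?thesis unfolding q by (intro CollectI exI[of _ "\<lambda>i. \<lfloor>q i\<rfloor>"]) (simp only: qi simp_thms)
  qed
  then have "is_int_basis f X" unfolding is_int_basis_iff using df Xsum[of _ UNIV] by blast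
  then show ?thesis unfolding full_rank_lattice_def by blast
qed

lemma full_rank_scaled:
  assumes "full_rank_lattice L" "c \<noteq> 0" shows "full_rank_lattice ((\<lambda>x. c *s x) ` L)"
proof -
  obtain e where e: "is_int_basis e L" using assms unfolding full_rank_lattice_def by blast
  have "det (\<chi> i. c *s e i) \<noteq> 0"
    using e assms(2) unfolding is_int_basis_iff by (simp add: det_rows_mul[of "\<lambda>_. c"])
  moreover have "(\<lambda>x. c *s x) ` L = {\<Sum>i\<in>UNIV. of_int (k i) *s (c *s e i) | k. True}"
  proof -
    have eq: "c *s (\<Sum>i\<in>UNIV. of_int (k i) *s e i) = (\<Sum>i\<in>UNIV. of_int (k i) *s (c *s e i))" for k
      by (simp add: vec.scale_sum_right mult.commute)
    have L: "L = (\<lambda>k. \<Sum>i\<in>UNIV. of_int (k i) *s e i) ` UNIV" using e unfolding is_int_basis_iff by auto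
    show ?thesis unfolding L image_image eq by (simp only: simp_thms full_SetCompr_eq)
  qed
  ultimately have "is_int_basis (\<lambda>i. c *s e i) ((\<lambda>x. c *s x) ` L)" unfolding is_int_basis_iff by simp
  then show ?thesis unfolding full_rank_lattice_def by blast
qed


subsection \<open>Gram determinants\<close>

text \<open>The Gram matrix of a family of vectors.\<close>

definition gram :: "(rat ^ 'n \<Rightarrow> rat ^ 'n \<Rightarrow> rat) \<Rightarrow> ('n \<Rightarrow> rat ^ 'n) \<Rightarrow> rat ^ 'n ^ 'n" where
  "gram b e = (\<chi> i j. b (e i) (e j))"

lemma det_gram_transform:
  fixes e f :: "'n::finite \<Rightarrow> rat ^ 'n"
  assumes b: "symmetric_bilinear b" and f: "\<And>i. f i = (\<Sum>j\<in>UNIV. t i j *s e j)"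
  shows "det (gram b f) = (det (\<chi> i j. t i j))\<^sup>2 * det (gram b e)"
proof -
  let ?T = "\<chi> i j. t i j"
  have "b (f i) (f j) = (\<Sum>l\<in>UNIV. (\<Sum>k\<in>UNIV. t i k * b (e k) (e l)) * t j l)" for i j
  proof -
    have "b (f i) (f j) = (\<Sum>l\<in>UNIV. t j l * b (f i) (e l))"
      unfolding f[of j] by (simp add: sb_sum_right[OF b] sb_scale_right[OF b])
    also have "\<dots> = (\<Sum>l\<in>UNIV. (\<Sum>k\<in>UNIV. t i k * b (e k) (e l)) * t j l)"
      unfolding f[of i] by (simp add: sb_sum_left[OF b] sb_scale_left[OF b] mult.commute)
    finally show ?thesis .
  qed
  then have "gram b f = ?T ** gram b e ** transpose ?T"
    by (simp add: gram_def vec_eq_iff matrix_matrix_mult_def transpose_def)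
  then show ?thesis by (simp add: det_mul det_transpose power2_eq_square)
qed

lemma det_gram_nonzero:
  fixes L :: "(rat ^ 'n::finite) set"
  assumes "is_lattice (L, b)" "positive_definite (L, b)" and e: "is_int_basis e L"
  shows "det (gram b e) \<noteq> 0"
proof
  assume "det (gram b e) = 0"
  then have "det (\<chi> i. gram b e $ i) = 0" by (simp add: vec_lambda_eta)
  then obtain c i where c: "(\<Sum>i\<in>UNIV. c i *s gram b e $ i) = 0" "c i \<noteq> 0"
    using det_nonzero_iff_rows_independent[of "\<lambda>i. gram b e $ i"] by blast
  have b: "symmetric_bilinear b" and L: "full_rank_lattice L"
    using assms(1) by (simp_all add: is_lattice_def)
  define v where "v = (\<Sum>i\<in>UNIV. c i *s e i)"
  have "b v (e j) = 0" for j
  proof -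
    have "b v (e j) = (\<Sum>i\<in>UNIV. c i *s gram b e $ i) $ j"
      unfolding v_def by (simp add: sb_sum_left[OF b] sb_scale_left[OF b] gram_def)
    then show ?thesis by (simp add: c(1))
  qed
  then have "b v v = 0"
    using sb_sum_right[OF b, of v "\<lambda>i. c i *s e i" UNIV] by (simp add: v_def[symmetric] sb_scale_right[OF b])
  moreover have "v \<noteq> 0"
    using e c(2) unfolding is_int_basis_iff v_def det_nonzero_iff_rows_independent by blast
  moreover obtain m :: nat where m: "m > 0" "of_nat m *s v \<in> L" using full_rank_multiple[OF L] by blast
  ultimately show False
    using assms(2) by (auto simp: positive_definite_def sb_scale_left[OF b] sb_scale_right[OF b])
qed

subsection \<open>Determinants modulo an integer\<close>

lemma dvd_prod_diff:
  fixes f g :: "'a \<Rightarrow> 'b::comm_ring_1"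
  assumes "\<And>i. i \<in> A \<Longrightarrow> m dvd f i - g i"
  shows "m dvd prod f A - prod g A"
  using assms
proof (induction A rule: infinite_finite_induct)
  case (insert x A)
  have "f x * prod f A - g x * prod g A = (f x - g x) * prod f A + g x * (prod f A - prod g A)"
    by (simp add: algebra_simps)
  then show ?case using insert by (auto intro!: dvd_add)
qed auto

lemma dvd_det_diff:
  fixes A B :: "'a::comm_ring_1 ^ 'n ^ 'n"
  assumes "\<And>i j. m dvd A $ i $ j - B $ i $ j"
  shows "m dvd det A - det B"
  unfolding det_def sum_subtractf[symmetric] right_diff_distrib[symmetric]
  by (intro dvd_sum dvd_mult dvd_prod_diff assms)

text \<open>
  An integral matrix is singular modulo a prime if and only if it has a nonzero kernel vector
  modulo the prime.
\<close>

lemma prime_dvd_det_iff: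
  fixes A :: "int ^ 'n ^ 'n"
  assumes p: "prime (p :: int)"
  shows "p dvd det A \<longleftrightarrow> (\<exists>x. (\<exists>i. \<not> p dvd x $ i) \<and> (\<forall>i. p dvd (A *v x) $ i))"
proof
  assume "\<exists>x. (\<exists>i. \<not> p dvd x $ i) \<and> (\<forall>i. p dvd (A *v x) $ i)"
  then obtain x k where x: "\<not> p dvd x $ k" "\<And>i. p dvd (A *v x) $ i" by blast
  let ?Q = "\<lambda>A::int ^ 'n ^ 'n. \<chi> i j. rat_of_int (A $ i $ j)"
  \<comment> \<open>by the rule of Cramer, replacing column k by A x, which vanishes modulo p, multiplies the determinant by coordinate k of x\<close>
  define B where "B = (\<chi> i j. if j = k then (A *v x) $ i else A $ i $ j)"
  define Z where "Z = (\<chi> i j. if j = k then 0 else A $ i $ j)"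
  have "(\<chi> i j. if j = k then (?Q A *v (\<chi> i. rat_of_int (x $ i))) $ i else ?Q A $ i $ j) = ?Q B"
    by (simp add: vec_eq_iff B_def matrix_vector_mult_def)
  then have "det (?Q B) = of_int (x $ k) * det (?Q A)"
    using cramer_lemma[of k "?Q A" "\<chi> i. rat_of_int (x $ i)"] by simp
  then have "of_int (det B) = rat_of_int (x $ k * det A)"
    by (simp add: det_int_matrix[of "\<lambda>i j. A $ i $ j"] det_int_matrix[of "\<lambda>i j. B $ i $ j"] vec_lambda_eta)
  then have "det B = x $ k * det A" by (simp only: of_int_eq_iff)
  moreover have "p dvd det B - det Z"
    by (rule dvd_det_diff) (use x(2) in \<open>simp add: B_def Z_def\<close>)
  moreover have "det Z = 0"
  proof -
    have "det (transpose Z) = 0"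
      by (rule det_zero_row(1)[of k]) (simp add: row_def transpose_def Z_def vec_eq_iff)
    then show ?thesis by (simp add: det_transpose)
  qed
  ultimately show "p dvd det A" using p x(1) by (simp add: prime_dvd_mult_iff)
next
  assume pd: "p dvd det A"
  have p0: "p > 1" using p prime_gt_1_int by blast
  show "\<exists>x. (\<exists>i. \<not> p dvd x $ i) \<and> (\<forall>i. p dvd (A *v x) $ i)"
  proof (rule ccontr)
    assume "\<not> ?thesis"
    then have ker: "p dvd x $ i" if "\<And>j. p dvd (A *v x) $ j" for x i using that by blast
    \<comment> \<open>without a kernel vector, the matrix is injective, hence surjective, on the finite set of vectors modulo p\<close>
    define F where "F = {x :: int ^ 'n. \<forall>i. x $ i \<in> {0..<p}}"
    define \<phi> where "\<phi> x = (\<chi> i. (A *v x) $ i mod p)" for x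
    have "F \<subseteq> vec_lambda ` (UNIV \<rightarrow>\<^sub>E {0..<p})"
    proof
      fix x assume "x \<in> F"
      then have "vec_nth x \<in> UNIV \<rightarrow>\<^sub>E {0..<p}" by (auto simp: F_def)
      then show "x \<in> vec_lambda ` (UNIV \<rightarrow>\<^sub>E {0..<p})" by (intro image_eqI[of _ _ "vec_nth x"]) (simp add: vec_nth_inverse)
    qed
    then have fin: "finite F" by (rule finite_subset) (intro finite_imageI finite_PiE, auto)
    have "inj_on \<phi> F"
    proof (rule inj_onI)
      fix x y assume xy: "x \<in> F" "y \<in> F" "\<phi> x = \<phi> y"
      have "p dvd (A *v (x - y)) $ i" for i
      proof -
        have "(A *v x) $ i mod p = (A *v y) $ i mod p" using xy(3) by (simp add: \<phi>_def vec_eq_iff)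
        then show ?thesis by (simp add: matrix_vector_mult_diff_distrib mod_eq_dvd_iff)
      qed
      then have "p dvd (x - y) $ i" for i by (rule ker)
      then have "x $ i mod p = y $ i mod p" for i by (simp add: mod_eq_dvd_iff)
      then show "x = y" using xy(1,2) by (simp add: F_def vec_eq_iff)
    qed
    moreover have "\<phi> ` F \<subseteq> F" using p0 by (auto simp: F_def \<phi>_def)
    ultimately have surj: "\<phi> ` F = F" using fin by (simp add: endo_inj_surj)
    have "\<exists>x. \<phi> x = axis j 1" for j
    proof -
      have "axis j 1 \<in> F" using p0 by (simp add: F_def axis_def)
      then show ?thesis using surj by (metis imageE)
    qed
    then obtain X where X: "\<And>j. \<phi> (X j) = axis j 1" by metis
    define M where "M = (\<chi> i j. X j $ i)"
    have "p dvd det (A ** M) - det (mat 1 :: int ^ 'n ^ 'n)"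
    proof (rule dvd_det_diff)
      fix i j
      have "(A ** M) $ i $ j = (A *v X j) $ i"
        by (simp add: matrix_matrix_mult_def matrix_vector_mult_def M_def)
      moreover have "(A *v X j) $ i mod p = (if i = j then 1 else 0) mod p"
        using X[of j] p0 by (simp add: \<phi>_def vec_eq_iff axis_def)
      ultimately show "p dvd (A ** M) $ i $ j - mat 1 $ i $ j"
        by (simp add: mat_def mod_eq_dvd_iff)
    qed
    then have "p dvd det A * det M - 1" by (simp add: det_mul)
    moreover have "p dvd det A * det M" using pd by simp
    ultimately have "p dvd 1" using dvd_diff_right_iff by blast
    then show False using p0 by simp
  qed
qed

text \<open>
  The Gram matrix as an integer matrix. The floor function has no effect if the family lies in an
  integral lattice, and the definition is used only in this case.
\<close>

definition int_gram :: "(rat ^ 'n \<Rightarrow> rat ^ 'n \<Rightarrow> rat) \<Rightarrow> ('n \<Rightarrow> rat ^ 'n) \<Rightarrow> int ^ 'n ^ 'n" where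
  "int_gram b e = (\<chi> i j. \<lfloor>b (e i) (e j)\<rfloor>)"

lemma int_gram_nth:
  assumes "integral_lattice (L, b)" "e i \<in> L" "e j \<in> L"
  shows "of_int (int_gram b e $ i $ j) = b (e i) (e j)"
proof -
  have "b (e i) (e j) \<in> \<int>" using assms by (simp add: integral_lattice_def)
  then show ?thesis by (auto simp: int_gram_def elim: Ints_cases)
qed

lemma det_int_gram:
  assumes "integral_lattice (L, b)" "\<And>i. e i \<in> L"
  shows "of_int (det (int_gram b e)) = det (gram b e)"
proof -
  have "gram b e = (\<chi> i j. rat_of_int (int_gram b e $ i $ j))"
    unfolding gram_def by (simp add: int_gram_nth[OF assms(1) assms(2) assms(2)])
  then show ?thesis by (simp add: det_int_matrix vec_lambda_eta)
qed

text \<open>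
  A prime p divides the determinant of an integral lattice if and only if the lattice contains a
  vector outside p times the lattice that is orthogonal to the lattice modulo p.
\<close>

lemma prime_dvd_gram_iff:
  assumes p: "prime (p :: nat)" and L: "is_lattice (L, b)" "integral_lattice (L, b)"
    and e: "is_int_basis e L"
  shows "int p dvd det (int_gram b e) \<longleftrightarrow>
    (\<exists>x\<in>L. (1 / of_nat p) *s x \<notin> L \<and> (\<forall>y\<in>L. b y x / of_nat p \<in> \<int>))"
proof -
  have b: "symmetric_bilinear b" using L(1) by (simp add: is_lattice_def)
  have eL: "e i \<in> L" for i by (rule int_basis_mem[OF e])
  have p0: "p > 0" using p prime_gt_0_nat by blast
  have div: "of_int k / of_nat p \<in> (\<int> :: rat set) \<longleftrightarrow> int p dvd k" for k
  proof
    assume "of_int k / of_nat p \<in> (\<int> :: rat set)"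
    then obtain m where "of_int k / of_nat p = (of_int m :: rat)" by (auto elim: Ints_cases)
    then have "of_int k = (of_int (int p * m) :: rat)" using p0 by (simp add: field_simps)
    then show "int p dvd k" unfolding of_int_eq_iff by simp
  qed (use p0 in \<open>auto elim!: dvdE\<close>)
  have key: "(\<forall>i. int p dvd (int_gram b e *v x) $ i) \<longleftrightarrow>
      (\<forall>y\<in>L. b y (\<Sum>i\<in>UNIV. of_int (x $ i) *s e i) / of_nat p \<in> \<int>)"
    "(\<forall>i. int p dvd x $ i) \<longleftrightarrow> (1 / of_nat p) *s (\<Sum>i\<in>UNIV. of_int (x $ i) *s e i) \<in> L" for x
  proof -
    define v where "v = (\<Sum>i\<in>UNIV. of_int (x $ i) *s e i)"
    have bv: "b (e i) v = of_int ((int_gram b e *v x) $ i)" for i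
      unfolding v_def
      by (simp add: sb_sum_right[OF b] sb_scale_right[OF b] matrix_vector_mult_def
          int_gram_nth[OF L(2) eL eL] mult.commute)
    have "(\<forall>i. int p dvd (int_gram b e *v x) $ i) \<longleftrightarrow> (\<forall>i. b (e i) v / of_nat p \<in> \<int>)"
      by (simp add: bv div)
    also have "\<dots> \<longleftrightarrow> (\<forall>y\<in>L. b y v / of_nat p \<in> \<int>)"
    proof
      assume *: "\<forall>i. b (e i) v / of_nat p \<in> \<int>"
      show "\<forall>y\<in>L. b y v / of_nat p \<in> \<int>"
      proof
        fix y assume "y \<in> L"
        then obtain c where "y = (\<Sum>i\<in>UNIV. of_int (c i) *s e i)"
          using e unfolding is_int_basis_iff by blast
        then have "b y v / of_nat p = (\<Sum>i\<in>UNIV. of_int (c i) * (b (e i) v / of_nat p))"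
          by (simp add: sb_sum_left[OF b] sb_scale_left[OF b] sum_divide_distrib)
        also have "\<dots> \<in> \<int>" using * by (intro Ints_sum Ints_mult) auto
        finally show "b y v / of_nat p \<in> \<int>" .
      qed
    qed (use eL in blast)
    finally show "(\<forall>i. int p dvd (int_gram b e *v x) $ i) \<longleftrightarrow>
      (\<forall>y\<in>L. b y (\<Sum>i\<in>UNIV. of_int (x $ i) *s e i) / of_nat p \<in> \<int>)" unfolding v_def .
    have "(1 / of_nat p) *s v = (\<Sum>i\<in>UNIV. (of_int (x $ i) / of_nat p) *s e i)"
      unfolding v_def by (simp add: vec.scale_sum_right)
    then show "(\<forall>i. int p dvd x $ i) \<longleftrightarrow> (1 / of_nat p) *s (\<Sum>i\<in>UNIV. of_int (x $ i) *s e i) \<in> L"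
      using int_basis_coords[OF e, of "\<lambda>i. of_int (x $ i) / of_nat p"] by (simp add: div v_def)
  qed
  have "int p dvd det (int_gram b e) \<longleftrightarrow> (\<exists>x. \<not> (\<forall>i. int p dvd x $ i) \<and>
      (\<forall>i. int p dvd (int_gram b e *v x) $ i))"
    using prime_dvd_det_iff[of "int p" "int_gram b e"] p by simp
  also have "\<dots> \<longleftrightarrow> (\<exists>x. (1 / of_nat p) *s (\<Sum>i\<in>UNIV. of_int (x $ i) *s e i) \<notin> L \<and>
      (\<forall>y\<in>L. b y (\<Sum>i\<in>UNIV. of_int (x $ i) *s e i) / of_nat p \<in> \<int>))"
    unfolding key ..
  also have "\<dots> \<longleftrightarrow> (\<exists>x\<in>L. (1 / of_nat p) *s x \<notin> L \<and> (\<forall>y\<in>L. b y x / of_nat p \<in> \<int>))"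
  proof -
    have Leq: "L = (\<lambda>x. \<Sum>i\<in>UNIV. of_int (x $ i) *s e i) ` UNIV" (is "_ = ?r")
    proof
      show "L \<subseteq> ?r"
      proof
        fix v assume "v \<in> L"
        then obtain c where "v = (\<Sum>i\<in>UNIV. of_int (c i) *s e i)" using e unfolding is_int_basis_iff by blast
        then show "v \<in> ?r" by (intro image_eqI[of _ _ "\<chi> i. c i"]) auto
      qed
      show "?r \<subseteq> L" using e unfolding is_int_basis_iff by blast
    qed
    show ?thesis by (subst (2) Leq) simp
  qed
  finally show ?thesis .
qed


section \<open>Partial duals and reflections of rational lattices\<close>

lemma is_lattice_rescale: "is_lattice (L, b) \<Longrightarrow> is_lattice (L, \<lambda>x y. q * b x y)"
  by (simp add: is_lattice_def symmetric_bilinear_scale)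

text \<open>
  The partial dual at q, described without the division by q. This is the set underlying
  \<open>partial_dual q (L, b)\<close> for positive q. The form of the partial dual is the given
  form multiplied by q.
\<close>

definition pdual :: "nat \<Rightarrow> (rat ^ 'n::finite) set \<Rightarrow> (rat ^ 'n \<Rightarrow> rat ^ 'n \<Rightarrow> rat) \<Rightarrow> (rat ^ 'n) set" where
  "pdual q L b = {v. of_nat q *s v \<in> L \<and> (\<forall>x\<in>L. b x v \<in> \<int>)}"

lemma partial_dual_eq:
  "q > 0 \<Longrightarrow> partial_dual q (L, b) = (pdual q L b, \<lambda>x y. of_nat q * b x y)"
proof -
  assume q: "q > 0"
  have "(\<exists>x\<in>L. v = (1 / of_nat q) *s x) \<longleftrightarrow> of_nat q *s v \<in> L" for v
  proof
    assume "of_nat q *s v \<in> L"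
    then show "\<exists>x\<in>L. v = (1 / of_nat q) *s x" using q by (intro bexI[of _ "of_nat q *s v"]) auto
  qed (use q in auto)
  then show ?thesis by (auto simp: partial_dual_def rescale_def dual_def pdual_def)
qed

context
  fixes L :: "(rat ^ 'n::finite) set" and b :: "rat ^ 'n \<Rightarrow> rat ^ 'n \<Rightarrow> rat"
  assumes lat: "is_lattice (L, b)" and int: "integral_lattice (L, b)"
begin

lemma lat_full: "full_rank_lattice L" and lat_form: "symmetric_bilinear b"
  using lat by (simp_all add: is_lattice_def)

lemma subset_pdual: "L \<subseteq> pdual q L b"
  using int full_rank_scale[OF lat_full, of "of_nat q"]
  by (auto simp: pdual_def integral_lattice_def)

lemma full_rank_pdual:
  assumes q: "q > 0" shows "full_rank_lattice (pdual q L b)"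
proof (rule full_rank_sublattice)
  show "full_rank_lattice ((\<lambda>x. (1 / of_nat q) *s x) ` L)"
    by (rule full_rank_scaled[OF lat_full]) (use q in simp)
  show "pdual q L b \<subseteq> (\<lambda>x. (1 / of_nat q) *s x) ` L"
  proof
    fix v assume "v \<in> pdual q L b"
    then show "v \<in> (\<lambda>x. (1 / of_nat q) *s x) ` L"
      using q by (intro image_eqI[of _ _ "of_nat q *s v"]) (auto simp: pdual_def)
  qed
  show "vec.span (pdual q L b) = UNIV"
    using full_rank_span[OF lat_full] vec.span_mono[OF subset_pdual[of q]] by auto
  show "0 \<in> pdual q L b" using full_rank_zero[OF lat_full] subset_pdual by blast
next
  fix x y assume "x \<in> pdual q L b" "y \<in> pdual q L b"
  then show "x + y \<in> pdual q L b"
    using full_rank_add[OF lat_full] by (auto simp: pdual_def vec.scale_right_distrib sb_add_right[OF lat_form])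
next
  fix x a assume x: "x \<in> pdual q L b"
  then have "of_nat q *s (of_int a *s x) \<in> L"
    using full_rank_scale[OF lat_full, of "of_int a" "of_nat q *s x"]
    by (simp add: pdual_def mult.commute)
  then show "of_int a *s x \<in> pdual q L b"
    using x by (auto simp: pdual_def sb_scale_right[OF lat_form])
qed

lemma is_lattice_partial_dual: "q > 0 \<Longrightarrow> is_lattice (partial_dual q (L, b))"
  using full_rank_pdual symmetric_bilinear_scale[OF lat_form] by (simp add: partial_dual_eq is_lattice_def)

lemma integral_partial_dual:
  assumes "q > 0" shows "integral_lattice (partial_dual q (L, b))"
proof -
  have "of_nat q * b x y \<in> \<int>" if "x \<in> pdual q L b" "y \<in> pdual q L b" for x y
  proof -
    have "b (of_nat q *s x) y \<in> \<int>" using that by (simp add: pdual_def)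
    then show ?thesis by (simp add: sb_scale_left[OF lat_form])
  qed
  then show ?thesis using assms by (simp add: partial_dual_eq integral_lattice_def)
qed

lemma pdual_pdual_supset:
  assumes "q > 0"
  shows "(\<lambda>x. (1 / of_nat q) *s x) ` L \<subseteq> pdual q (pdual q L b) (\<lambda>x y. of_nat q * b x y)"
proof clarify
  fix u assume u: "u \<in> L"
  have "of_nat q * b x ((1 / of_nat q) *s u) \<in> \<int>" if "x \<in> pdual q L b" for x
    using that u assms sb_sym[OF lat_form, of x u] by (simp add: sb_scale_right[OF lat_form] pdual_def)
  then show "(1 / of_nat q) *s u \<in> pdual q (pdual q L b) (\<lambda>x y. of_nat q * b x y)"
    using u assms subset_pdual by (auto simp: pdual_def[of q "pdual q L b"])
qed

end

lemma positive_definite_space: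
  assumes "is_lattice (L, b)" "positive_definite (L, b)" "v \<noteq> 0"
  shows "b v v > 0"
proof -
  obtain m :: nat where m: "m > 0" "of_nat m *s v \<in> L"
    using full_rank_multiple assms(1) unfolding is_lattice_def by blast
  have b: "symmetric_bilinear b" using assms(1) by (simp add: is_lattice_def)
  have "of_nat m *s v \<noteq> 0" using m(1) assms(3) by simp
  then have "b (of_nat m *s v) (of_nat m *s v) > 0"
    using assms(2) m(2) by (simp add: positive_definite_def)
  then have "of_nat m * of_nat m * b v v > 0"
    by (simp add: sb_scale_left[OF b] sb_scale_right[OF b] mult.assoc)
  then show ?thesis using m(1) by (simp add: zero_less_mult_iff)
qed

lemma reflection_scaled:
  assumes b: "symmetric_bilinear b" and "c \<noteq> 0" "t \<noteq> 0"
  shows "reflection (\<lambda>x y. c * b x y) (t *s v) = reflection b v"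
  using assms(2,3) by (auto simp: reflection_def sb_scale_left[OF b] sb_scale_right[OF b] fun_eq_iff)

text \<open>
  Every nonzero vector of the rational space has a primitive multiple in a given lattice.
\<close>

lemma primitive_multiple:
  assumes D: "full_rank_lattice D" and "v \<noteq> 0"
  obtains t where "t \<noteq> 0" "t *s v \<in> D" "\<And>m::int. m > 1 \<Longrightarrow> (1 / of_int m) *s (t *s v) \<notin> D"
proof -
  obtain k :: nat where k: "k > 0" "of_nat k *s v \<in> D" using full_rank_multiple[OF D] by blast
  obtain e where e: "is_int_basis e D" using D unfolding full_rank_lattice_def by blast
  then obtain c where c: "of_nat k *s v = (\<Sum>i\<in>UNIV. of_int (c i) *s e i)"
    using k(2) unfolding is_int_basis_iff by blast
  have "of_nat k *s v \<noteq> 0" using k assms(2) by simp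
  then obtain i where i: "c i \<noteq> 0" unfolding c by (metis (mono_tags, lifting) of_int_0 sum.neutral vec.scale_zero_left)
  \<comment> \<open>take out the largest l that divides the multiple k v in D; it is bounded by a nonzero coordinate of k v\<close>
  define P where "P l \<longleftrightarrow> l > 0 \<and> (1 / of_nat l) *s (of_nat k *s v) \<in> D" for l :: nat
  have bound: "l \<le> nat \<bar>c i\<bar>" if "P l" for l
  proof -
    have "(1 / of_nat l) *s (of_nat k *s v) = (\<Sum>i\<in>UNIV. (of_int (c i) / of_nat l) *s e i)"
      unfolding c by (simp add: vec.scale_sum_right)
    then have "of_int (c i) / of_nat l \<in> (\<int> :: rat set)"
      using that int_basis_coords[OF e, of "\<lambda>i. of_int (c i) / of_nat l"] unfolding P_def by simp
    then obtain m where m: "of_int (c i) / of_nat l = (of_int m :: rat)" by (auto elim: Ints_cases)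
    have l: "l > 0" using that by (simp add: P_def)
    then have "of_int (c i) = (of_int (int l * m) :: rat)" using m by (simp add: field_simps)
    then have "c i = int l * m" unfolding of_int_eq_iff .
    then have "int l dvd c i" by simp
    then have "int l \<le> \<bar>c i\<bar>" using i dvd_imp_le_int[of "c i" "int l"] by simp
    then show ?thesis by simp
  qed
  have P1: "P 1" using k by (simp add: P_def)
  define l where "l = (GREATEST l. P l)"
  have Pl: "P l" unfolding l_def by (rule GreatestI_nat[of P, OF P1]) (use bound in auto)
  have max: "l' \<le> l" if "P l'" for l' unfolding l_def by (rule Greatest_le_nat[of P, OF that]) (use bound in auto)
  have l0: "l > 0" using Pl by (simp add: P_def)
  show ?thesis
  proof (rule that[of "of_nat k / of_nat l"])
    show "of_nat k / of_nat l \<noteq> (0 :: rat)" using k l0 by simp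
    show "(of_nat k / of_nat l) *s v \<in> D" using Pl by (simp add: P_def)
  next
    fix m :: int assume m: "m > 1"
    show "(1 / of_int m) *s ((of_nat k / of_nat l) *s v) \<notin> D"
    proof
      assume a: "(1 / of_int m) *s ((of_nat k / of_nat l) *s v) \<in> D"
      have "(1 / of_nat (nat m * l)) *s (of_nat k *s v) = (1 / of_int m) *s ((of_nat k / of_nat l) *s v)"
        using m by simp
      then have "P (nat m * l)" unfolding P_def using a m l0 by simp
      then have "nat m * l \<le> l" by (rule max)
      then show False using m l0 by simp
    qed
  qed
qed

lemma int_span_subset:
  assumes "full_rank_lattice L" "X \<subseteq> L" shows "int_span X \<subseteq> L"
  using assms by (auto simp: int_span_def intro!: full_rank_sum full_rank_scale)

lemma subset_int_span: "X \<subseteq> int_span X"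
proof
  fix x assume "x \<in> X"
  then show "x \<in> int_span X" unfolding int_span_def
    by (intro CollectI exI[of _ "{x}"] exI[of _ "\<lambda>_. 1"]) simp
qed

lemma full_rank_int_span_iff:
  assumes L: "full_rank_lattice L" and X: "X \<subseteq> L"
  shows "full_rank_lattice (int_span X) \<longleftrightarrow> vec.span X = UNIV"
proof
  assume "full_rank_lattice (int_span X)"
  then have "UNIV = vec.span (int_span X)" by (simp add: full_rank_span)
  also have "\<dots> \<subseteq> vec.span X"
    by (rule vec.span_minimal)
      (auto simp: int_span_def intro!: vec.span_sum vec.span_scale intro: vec.span_base)
  finally show "vec.span X = UNIV" by auto
next
  assume sp: "vec.span X = UNIV"
  show "full_rank_lattice (int_span X)"
  proof (rule full_rank_sublattice[OF L int_span_subset[OF L X]])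
    show "vec.span (int_span X) = UNIV" using vec.span_mono[OF subset_int_span[of X]] sp by auto
    show "0 \<in> int_span X" unfolding int_span_def by (intro CollectI exI[of _ "{}"]) simp
  next
    fix x y assume "x \<in> int_span X" "y \<in> int_span X"
    then obtain F c G d where x: "finite F" "F \<subseteq> X" "x = (\<Sum>v\<in>F. of_int (c v) *s v)"
      and y: "finite G" "G \<subseteq> X" "y = (\<Sum>v\<in>G. of_int (d v) *s v)"
      unfolding int_span_def by blast
    have "x = (\<Sum>v\<in>F \<union> G. of_int (if v \<in> F then c v else 0) *s v)"
      unfolding x(3) using x(1) y(1) by (intro sum.mono_neutral_cong_left) auto
    moreover have "y = (\<Sum>v\<in>F \<union> G. of_int (if v \<in> G then d v else 0) *s v)"
      unfolding y(3) using x(1) y(1) by (intro sum.mono_neutral_cong_left) auto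
    ultimately have "x + y = (\<Sum>v\<in>F \<union> G. of_int ((if v \<in> F then c v else 0) + (if v \<in> G then d v else 0)) *s v)"
      by (simp only: sum.distrib[symmetric] vec.scale_left_distrib[symmetric] of_int_add)
    then show "x + y \<in> int_span X"
      unfolding int_span_def using x(1,2) y(1,2)
      by (intro CollectI exI[of _ "F \<union> G"]
          exI[of _ "\<lambda>v. (if v \<in> F then c v else 0) + (if v \<in> G then d v else 0)"]) simp
  next
    fix x a assume "x \<in> int_span X"
    then obtain F c where x: "finite F" "F \<subseteq> X" "x = (\<Sum>v\<in>F. of_int (c v) *s v)"
      unfolding int_span_def by blast
    then have "of_int a *s x = (\<Sum>v\<in>F. of_int (a * c v) *s v)" by (simp add: vec.scale_sum_right)
    then show "of_int a *s x \<in> int_span X" unfolding int_span_def using x(1,2)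
      by (intro CollectI exI[of _ F] exI[of _ "\<lambda>v. a * c v"]) simp
  qed
qed

text \<open>
  The roots generate a sublattice of the same rank if and only if they span the rational space, so
  the existence of an integral basis need not be considered in arguments about reflectivity.
\<close>

lemma reflective_iff:
  assumes "is_lattice (L, b)"
  shows "reflective (L, b) \<longleftrightarrow>
    positive_definite (L, b) \<and> integral_lattice (L, b) \<and> vec.span (roots (L, b)) = UNIV"
proof -
  have "roots (L, b) \<subseteq> L" by (auto simp: roots_def)
  then show ?thesis
    using assms full_rank_int_span_iff[of L "roots (L, b)"] by (simp add: reflective_def is_lattice_def)
qed

text \<open>
  A lattice stable under the reflections in the roots of a reflective lattice on the same space is
  reflective, for a rescaled form, because a suitable multiple of each root is a root of it.
\<close>

lemma reflective_transfer:
  assumes L: "is_lattice (L, b)" "reflective (L, b)"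
    and D: "is_lattice (D, \<lambda>x y. c * b x y)" "integral_lattice (D, \<lambda>x y. c * b x y)" and c: "c > 0"
    and stable: "\<And>v x. v \<in> roots (L, b) \<Longrightarrow> x \<in> D \<Longrightarrow> reflection b v x \<in> D"
  shows "reflective (D, \<lambda>x y. c * b x y)"
proof -
  have b: "symmetric_bilinear b" using L(1) by (simp add: is_lattice_def)
  have pd: "positive_definite (L, b)" and span: "vec.span (roots (L, b)) = UNIV"
    using L(2) reflective_iff[OF L(1)] by auto
  have "v \<in> vec.span (roots (D, \<lambda>x y. c * b x y))" if v: "v \<in> roots (L, b)" for v
  proof -
    have v0: "v \<noteq> 0" using v by (simp add: roots_def)
    obtain t where t: "t \<noteq> 0" "t *s v \<in> D" "\<And>m::int. m > 1 \<Longrightarrow> (1 / of_int m) *s (t *s v) \<notin> D"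
      using primitive_multiple[of D v] D(1) v0 unfolding is_lattice_def by blast
    have bv: "b v v > 0" using positive_definite_space[OF L(1) pd v0] .
    have inv: "reflection b v (reflection b v x) = x" for x
    proof -
      have "b (reflection b v x) v = b v (reflection b v x)" by (rule sb_sym[OF b])
      also have "\<dots> = b v x - 2 * b x v"
        using bv by (simp add: reflection_def sb_diff_right[OF b] sb_scale_right[OF b])
      also have "\<dots> = - b x v" using sb_sym[OF b, of v x] by simp
      finally have eq: "b (reflection b v x) v = - b x v" .
      show ?thesis unfolding reflection_def[of b v "reflection b v x"] eq
        by (simp add: reflection_def)
    qed
    have "reflection b v ` D = D"
    proof
      show "reflection b v ` D \<subseteq> D" using stable[OF v] by blast
      show "D \<subseteq> reflection b v ` D"
      proof
        fix x assume "x \<in> D"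
        then show "x \<in> reflection b v ` D"
          using stable[OF v, of x] inv[of x] by (intro image_eqI[of _ _ "reflection b v x"]) auto
      qed
    qed
    then have "t *s v \<in> roots (D, \<lambda>x y. c * b x y)"
      using t v0 c bv
      by (auto simp: roots_def reflection_scaled[OF b, of c t v] sb_scale_left[OF b] sb_scale_right[OF b])
    then have "(1 / t) *s (t *s v) \<in> vec.span (roots (D, \<lambda>x y. c * b x y))"
      by (intro vec.span_scale vec.span_base)
    then show ?thesis using t(1) by simp
  qed
  then have "UNIV \<subseteq> vec.span (roots (D, \<lambda>x y. c * b x y))"
    unfolding span[symmetric] by (intro vec.span_minimal) auto
  moreover have "positive_definite (D, \<lambda>x y. c * b x y)"
    using positive_definite_space[OF L(1) pd] c by (simp add: positive_definite_def)
  ultimately show ?thesis using D reflective_iff[OF D(1)] by auto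
qed

lemma reflective_partial_dual:
  assumes L: "is_lattice (L, b)" "reflective (L, b)" and q: "q > 0"
  shows "reflective (partial_dual q (L, b))"
proof -
  have b: "symmetric_bilinear b" and int: "integral_lattice (L, b)"
    using L by (auto simp: is_lattice_def reflective_def)
  have "reflection b v x \<in> pdual q L b" if v: "v \<in> roots (L, b)" and x: "x \<in> pdual q L b" for v x
  proof -
    have rL: "reflection b v y \<in> L" if "y \<in> L" for y
      using v that by (auto simp: roots_def)
    have "of_nat q *s reflection b v x = reflection b v (of_nat q *s x)"
      by (simp add: reflection_def vec.scale_right_diff_distrib sb_scale_left[OF b] mult_ac)
    moreover have "b y (reflection b v x) = b (reflection b v y) x" for y
    proof -
      have "b (reflection b v y) x = b x (reflection b v y)" by (rule sb_sym[OF b])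
      then show ?thesis
        by (simp add: reflection_def sb_diff_right[OF b] sb_scale_right[OF b] sb_sym[OF b, of x])
    qed
    ultimately show ?thesis using rL x by (simp add: pdual_def)
  qed
  then show ?thesis
    using reflective_transfer[OF L, of "pdual q L b" "of_nat q"] q
      is_lattice_partial_dual[OF L(1) int q] integral_partial_dual[OF L(1) int q]
    by (simp add: partial_dual_eq)
qed

lemma reflective_scaled:
  assumes L: "is_lattice (L, b)" "reflective (L, b)" and c: "c \<noteq> 0"
  shows "reflective ((\<lambda>x. c *s x) ` L, \<lambda>x y. (1 / c)\<^sup>2 * b x y)"
proof (rule reflective_transfer[OF L])
  have b: "symmetric_bilinear b" and int: "integral_lattice (L, b)"
    using L by (auto simp: is_lattice_def reflective_def)
  show "is_lattice ((\<lambda>x. c *s x) ` L, \<lambda>x y. (1 / c)\<^sup>2 * b x y)"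
    using L(1) full_rank_scaled[of L c] c symmetric_bilinear_scale[OF b] by (simp add: is_lattice_def)
  show "integral_lattice ((\<lambda>x. c *s x) ` L, \<lambda>x y. (1 / c)\<^sup>2 * b x y)"
    using int c by (simp add: integral_lattice_def sb_scale_left[OF b] sb_scale_right[OF b] power2_eq_square)
  show "(1 / c)\<^sup>2 > 0" using c by simp
  fix v x assume v: "v \<in> roots (L, b)" and "x \<in> (\<lambda>x. c *s x) ` L"
  then obtain y where y: "y \<in> L" "x = c *s y" by blast
  have "reflection b v x = c *s reflection b v y"
    unfolding y(2) by (simp add: reflection_def vec.scale_right_diff_distrib sb_scale_left[OF b] mult_ac)
  moreover have "reflection b v y \<in> L" using v y(1) by (auto simp: roots_def)
  ultimately show "reflection b v x \<in> (\<lambda>x. c *s x) ` L" by blast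
qed


section \<open>Extension of scalars\<close>

text \<open>
  The base change of lattices is treated uniformly for the p-adic numbers and the real numbers: K
  is a commutative ring, S is a subring, given by its closure properties, and h is a homomorphism
  from the rationals to K that maps integers to S. Inverses in K are needed for images of rational
  numbers only, so K need not be a field.
\<close>

locale scalar_extension = cring K for K :: "'k ring" (structure) +
  fixes S :: "'k set" and h :: "rat \<Rightarrow> 'k"
  assumes S_sub: "S \<subseteq> carrier K"
    and S_add [simp, intro]: "\<And>a b. a \<in> S \<Longrightarrow> b \<in> S \<Longrightarrow> a \<oplus> b \<in> S"
    and S_mult [simp, intro]: "\<And>a b. a \<in> S \<Longrightarrow> b \<in> S \<Longrightarrow> a \<otimes> b \<in> S"
    and h_closed [simp, intro]: "\<And>q. h q \<in> carrier K"
    and h_add: "\<And>q r. h (q + r) = h q \<oplus> h r"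
    and h_mult: "\<And>q r. h (q * r) = h q \<otimes> h r"
    and h_one: "h 1 = \<one>"
    and h_int [simp, intro]: "\<And>a. h (of_int a) \<in> S"
begin

lemma S_carrier [simp, intro]: "a \<in> S \<Longrightarrow> a \<in> carrier K"
  using S_sub by blast

lemma h_zero: "h 0 = \<zero>"
  using h_add[of 0 0] by (metis add.r_cancel_one' add_0 h_closed)

lemma S_zero [simp, intro]: "\<zero> \<in> S" using h_int[of 0] by (simp add: h_zero)
lemma S_one [simp, intro]: "\<one> \<in> S" using h_int[of 1] by (simp add: h_one)

lemma h_nat [simp, intro]: "h (of_nat m) \<in> S"
  using h_int[of "int m"] by simp

lemma h_Ints: "q \<in> \<int> \<Longrightarrow> h q \<in> S" by (auto elim: Ints_cases)

lemma h_sum: "finite A \<Longrightarrow> h (\<Sum>i\<in>A. f i) = (\<Oplus>i\<in>A. h (f i))"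
  by (induction A rule: finite_induct) (auto simp: h_zero h_add)

text \<open>
  The vectors with coordinates in K, with their operations; other functions from the index type
  are junk.
\<close>

definition vecs :: "('n \<Rightarrow> 'k) set" where "vecs = {x. \<forall>i. x i \<in> carrier K}"

definition vzero :: "'n \<Rightarrow> 'k" where "vzero = (\<lambda>i. \<zero>)"

definition vadd :: "('n \<Rightarrow> 'k) \<Rightarrow> ('n \<Rightarrow> 'k) \<Rightarrow> 'n \<Rightarrow> 'k" (infixl "\<boxplus>" 65) where
  "x \<boxplus> y = (\<lambda>i. x i \<oplus> y i)"

definition vsmult :: "'k \<Rightarrow> ('n \<Rightarrow> 'k) \<Rightarrow> 'n \<Rightarrow> 'k" (infixr "\<cdot>" 75) where
  "c \<cdot> x = (\<lambda>i. c \<otimes> x i)"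

text \<open>The embedding of the rational space.\<close>

definition emb :: "rat ^ 'n \<Rightarrow> 'n \<Rightarrow> 'k" where "emb v = (\<lambda>i. h (v $ i))"

lemmas vdefs = vecs_def vzero_def vadd_def vsmult_def

lemma vzero_vecs [simp, intro]: "vzero \<in> vecs" by (simp add: vdefs)
lemma vadd_vecs [simp, intro]: "x \<in> vecs \<Longrightarrow> y \<in> vecs \<Longrightarrow> x \<boxplus> y \<in> vecs" by (simp add: vdefs)
lemma vsmult_vecs [simp, intro]: "c \<in> carrier K \<Longrightarrow> x \<in> vecs \<Longrightarrow> c \<cdot> x \<in> vecs" by (simp add: vdefs)
lemma emb_vecs [simp, intro]: "emb v \<in> vecs" by (simp add: vdefs emb_def)

lemma vadd_assoc: "x \<in> vecs \<Longrightarrow> y \<in> vecs \<Longrightarrow> z \<in> vecs \<Longrightarrow> x \<boxplus> y \<boxplus> z = x \<boxplus> (y \<boxplus> z)"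
  by (rule ext) (simp add: vdefs a_assoc)
lemma vadd_comm: "x \<in> vecs \<Longrightarrow> y \<in> vecs \<Longrightarrow> x \<boxplus> y = y \<boxplus> x"
  by (rule ext) (simp add: vdefs a_comm)
lemma vadd_vzero [simp]: "x \<in> vecs \<Longrightarrow> vzero \<boxplus> x = x" "x \<in> vecs \<Longrightarrow> x \<boxplus> vzero = x"
  by (rule ext, simp add: vdefs)+
lemma vsmult_vadd: "c \<in> carrier K \<Longrightarrow> x \<in> vecs \<Longrightarrow> y \<in> vecs \<Longrightarrow> c \<cdot> (x \<boxplus> y) = c \<cdot> x \<boxplus> c \<cdot> y"
  by (rule ext) (simp add: vdefs r_distr)
lemma vsmult_add: "c \<in> carrier K \<Longrightarrow> d \<in> carrier K \<Longrightarrow> x \<in> vecs \<Longrightarrow> (c \<oplus> d) \<cdot> x = c \<cdot> x \<boxplus> d \<cdot> x"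
  by (rule ext) (simp add: vdefs l_distr)
lemma vsmult_vsmult: "c \<in> carrier K \<Longrightarrow> d \<in> carrier K \<Longrightarrow> x \<in> vecs \<Longrightarrow> c \<cdot> d \<cdot> x = (c \<otimes> d) \<cdot> x"
  by (rule ext) (simp add: vdefs m_assoc)
lemma vsmult_comm: "c \<in> carrier K \<Longrightarrow> d \<in> carrier K \<Longrightarrow> x \<in> vecs \<Longrightarrow> c \<cdot> d \<cdot> x = d \<cdot> c \<cdot> x"
  by (simp add: vsmult_vsmult m_comm)
lemma vsmult_one [simp]: "x \<in> vecs \<Longrightarrow> \<one> \<cdot> x = x"
  by (rule ext) (simp add: vdefs)
lemma vsmult_zero [simp]: "x \<in> vecs \<Longrightarrow> \<zero> \<cdot> x = vzero" "c \<in> carrier K \<Longrightarrow> c \<cdot> vzero = vzero"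
  by (rule ext, simp add: vdefs)+
lemma vadd_neg: "x \<in> vecs \<Longrightarrow> x \<boxplus> h (- 1) \<cdot> x = vzero"
  using vsmult_add[of \<one> "h (-1)" x] h_add[of 1 "- 1", symmetric] by (simp add: h_one h_zero)
lemma h_cancel:
  assumes "q \<noteq> 0" "x \<in> vecs"
  shows "h (1 / q) \<cdot> h q \<cdot> x = x" "h q \<cdot> h (1 / q) \<cdot> x = x"
  using assms h_mult[of "1 / q" q, symmetric] h_mult[of q "1 / q", symmetric] by (simp_all add: vsmult_vsmult h_one)

lemma emb_add: "emb (v + w) = emb v \<boxplus> emb w"
  by (rule ext) (simp add: emb_def vadd_def h_add)
lemma emb_scale: "emb (q *s v) = h q \<cdot> emb v"
  by (rule ext) (simp add: emb_def vsmult_def h_mult)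
lemma emb_0: "emb 0 = vzero"
  by (rule ext) (simp add: emb_def vzero_def h_zero)

subsection \<open>Submodules and spans\<close>

text \<open>
  Submodules of the space of vectors, with scalars in T, which is S or the carrier of K.
\<close>

definition submod :: "'k set \<Rightarrow> ('n \<Rightarrow> 'k) set \<Rightarrow> bool" where
  "submod T A \<longleftrightarrow> A \<subseteq> vecs \<and> vzero \<in> A \<and> (\<forall>x\<in>A. \<forall>y\<in>A. x \<boxplus> y \<in> A) \<and> (\<forall>c\<in>T. \<forall>x\<in>A. c \<cdot> x \<in> A)"

lemma submodD:
  assumes "submod T A"
  shows "x \<in> A \<Longrightarrow> x \<in> vecs" "vzero \<in> A" "x \<in> A \<Longrightarrow> y \<in> A \<Longrightarrow> x \<boxplus> y \<in> A"
    "c \<in> T \<Longrightarrow> x \<in> A \<Longrightarrow> c \<cdot> x \<in> A"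
  using assms unfolding submod_def by auto

lemma lin_span_zero: "vzero \<in> lin_span K T X"
  unfolding vzero_def by (rule lin_span.zero)

lemma lin_span_step:
  "c \<in> T \<Longrightarrow> v \<in> X \<Longrightarrow> x \<in> lin_span K T X \<Longrightarrow> c \<cdot> v \<boxplus> x \<in> lin_span K T X"
  unfolding vadd_def vsmult_def by (rule lin_span.step)

lemma lin_span_induct [consumes 1, case_names zero step]:
  assumes "x \<in> lin_span K T X" "P vzero"
    "\<And>c v x. c \<in> T \<Longrightarrow> v \<in> X \<Longrightarrow> x \<in> lin_span K T X \<Longrightarrow> P x \<Longrightarrow> P (c \<cdot> v \<boxplus> x)"
  shows "P x"
  using assms(1)
  by (induction rule: lin_span.induct)
    (use assms(2,3) in \<open>auto simp: vzero_def vadd_def vsmult_def\<close>)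

lemma lin_span_least: "submod T A \<Longrightarrow> X \<subseteq> A \<Longrightarrow> lin_span K T X \<subseteq> A"
proof
  fix x assume "submod T A" "X \<subseteq> A" "x \<in> lin_span K T X"
  from this(3,1,2) show "x \<in> A"
    by (induction rule: lin_span_induct) (auto intro: submodD)
qed

lemma lin_span_vecs: "X \<subseteq> vecs \<Longrightarrow> T \<subseteq> carrier K \<Longrightarrow> lin_span K T X \<subseteq> vecs"
  by (rule lin_span_least) (auto simp: submod_def)

lemma submod_lin_span:
  assumes X: "X \<subseteq> vecs" and T: "T \<subseteq> carrier K" "\<And>a b. a \<in> T \<Longrightarrow> b \<in> T \<Longrightarrow> a \<otimes> b \<in> T"
  shows "submod T (lin_span K T X)"
proof -
  note V = lin_span_vecs[OF X T(1)]
  have "x \<boxplus> y \<in> lin_span K T X" if "x \<in> lin_span K T X" "y \<in> lin_span K T X" for x y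
    using that(1)
  proof (induction rule: lin_span_induct)
    case zero then show ?case using that V by auto
  next
    case (step c v x)
    have "c \<cdot> v \<boxplus> x \<boxplus> y = c \<cdot> v \<boxplus> (x \<boxplus> y)"
      using step that V X T by (intro vadd_assoc) auto
    then show ?case using lin_span_step[OF step(1,2) step.IH] by simp
  qed
  moreover have "c \<cdot> x \<in> lin_span K T X" if "x \<in> lin_span K T X" "c \<in> T" for x c
    using that(1)
  proof (induction rule: lin_span_induct)
    case zero
    have "c \<in> carrier K" using that(2) T(1) by blast
    then show ?case using lin_span_zero by simp
  next
    case (step d v x)
    have "c \<cdot> (d \<cdot> v \<boxplus> x) = (c \<otimes> d) \<cdot> v \<boxplus> c \<cdot> x"
      using step that V X T by (subst vsmult_vadd) (auto simp: vsmult_vsmult subset_iff)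
    then show ?case using lin_span_step[OF T(2)[OF that(2) step(1)] step(2) step.IH] by simp
  qed
  ultimately show ?thesis using V lin_span_zero unfolding submod_def by blast
qed

lemma lin_span_base: "X \<subseteq> vecs \<Longrightarrow> \<one> \<in> T \<Longrightarrow> x \<in> X \<Longrightarrow> x \<in> lin_span K T X"
  using lin_span_step[of \<one> T x X vzero] lin_span_zero[of T X] by (simp add: subset_iff)

lemma lin_span_mono: "X \<subseteq> Y \<Longrightarrow> lin_span K T X \<subseteq> lin_span K T Y"
proof
  fix x assume "X \<subseteq> Y" "x \<in> lin_span K T X"
  from this(2,1) show "x \<in> lin_span K T Y"
    by (induction rule: lin_span_induct) (auto intro: lin_span_zero lin_span_step)
qed

lemma lin_span_image:
  assumes "\<And>x y. x \<in> A \<Longrightarrow> y \<in> A \<Longrightarrow> f (x \<boxplus> y) = f x \<boxplus> f y"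
    and "\<And>c x. c \<in> T \<Longrightarrow> x \<in> A \<Longrightarrow> f (c \<cdot> x) = c \<cdot> f x" and "f vzero = vzero"
    and "submod T A" and "X \<subseteq> A"
  shows "lin_span K T (f ` X) = f ` lin_span K T X"
proof
  have A: "lin_span K T X \<subseteq> A" using assms by (intro lin_span_least)
  show "lin_span K T (f ` X) \<subseteq> f ` lin_span K T X"
  proof
    fix y assume "y \<in> lin_span K T (f ` X)"
    then show "y \<in> f ` lin_span K T X"
    proof (induction rule: lin_span_induct)
      case zero show ?case using assms(3) lin_span_zero by (metis image_eqI)
    next
      case (step c v y)
      then obtain w x where "v = f w" "w \<in> X" "y = f x" "x \<in> lin_span K T X" by auto
      then have "c \<cdot> v \<boxplus> y = f (c \<cdot> w \<boxplus> x)"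
        using assms(1,2,5) A submodD(4)[OF assms(4)] step(1) by (metis subsetD)
      then show ?case using lin_span_step[OF step(1) \<open>w \<in> X\<close> \<open>x \<in> lin_span K T X\<close>] by blast
    qed
  qed
  show "f ` lin_span K T X \<subseteq> lin_span K T (f ` X)"
  proof clarify
    fix x assume "x \<in> lin_span K T X"
    then show "f x \<in> lin_span K T (f ` X)"
    proof (induction rule: lin_span_induct)
      case zero show ?case using assms(3) lin_span_zero by metis
    next
      case (step c v x)
      have "f (c \<cdot> v \<boxplus> x) = c \<cdot> f v \<boxplus> f x"
        using assms(1,2,5) A submodD(4)[OF assms(4)] step by (metis subsetD)
      then show ?case using lin_span_step[OF step(1) _ step.IH] step(2) by auto
    qed
  qed
qed

text \<open>The base change of a lattice to S, that is, the S-span of its image.\<close>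

definition ext_of :: "(rat ^ 'n) set \<Rightarrow> ('n \<Rightarrow> 'k) set" where "ext_of L = lin_span K S (emb ` L)"

lemma base_change_eq: "base_change K S h (L, b) = ext_of L"
  by (simp add: base_change_def ext_of_def emb_def[abs_def])

lemma submod_ext: "submod S (ext_of L)"
  unfolding ext_of_def by (rule submod_lin_span) auto

lemmas ext_add = submodD(3)[OF submod_ext]
  and ext_smult = submodD(4)[OF submod_ext]
  and ext_zero [simp, intro] = submodD(2)[OF submod_ext]
  and ext_vecs [simp, intro] = submodD(1)[OF submod_ext]

lemma ext_base: "v \<in> L \<Longrightarrow> emb v \<in> ext_of L"
  unfolding ext_of_def by (rule lin_span_base) auto

lemma ext_least: "submod S A \<Longrightarrow> (\<And>v. v \<in> L \<Longrightarrow> emb v \<in> A) \<Longrightarrow> ext_of L \<subseteq> A"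
  unfolding ext_of_def by (rule lin_span_least) auto

lemma ext_induct [consumes 1, case_names zero step]:
  assumes "x \<in> ext_of L" "P vzero"
    "\<And>c v x. c \<in> S \<Longrightarrow> v \<in> L \<Longrightarrow> x \<in> ext_of L \<Longrightarrow> P x \<Longrightarrow> P (c \<cdot> emb v \<boxplus> x)"
  shows "P x"
  using assms(1) unfolding ext_of_def
  by (induction rule: lin_span_induct) (use assms in \<open>auto simp: ext_of_def\<close>)

subsection \<open>The extended form\<close>

text \<open>Double sums, as they occur in the extended form.\<close>

definition dsum :: "('n \<Rightarrow> 'n \<Rightarrow> 'k) \<Rightarrow> 'k" where
  "dsum f = (\<Oplus>i\<in>UNIV. \<Oplus>j\<in>UNIV. f i j)"

lemma dsum_closed: "(\<And>i j. f i j \<in> carrier K) \<Longrightarrow> dsum f \<in> carrier K"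
  unfolding dsum_def by (intro finsum_closed Pi_I)

lemma dsum_add:
  assumes f: "\<And>i j. f i j \<in> carrier K" and g: "\<And>i j. g i j \<in> carrier K"
  shows "dsum (\<lambda>i j. f i j \<oplus> g i j) = dsum f \<oplus> dsum g"
proof -
  have "(\<Oplus>j\<in>UNIV. f i j \<oplus> g i j) = (\<Oplus>j\<in>UNIV. f i j) \<oplus> (\<Oplus>j\<in>UNIV. g i j)" for i
    using f g by (intro finsum_addf) auto
  then show ?thesis
    unfolding dsum_def using f g by (simp only:) (intro finsum_addf Pi_I finsum_closed, auto)
qed

lemma dsum_mult:
  fixes f :: "'n \<Rightarrow> 'n \<Rightarrow> 'k"
  assumes f: "\<And>i j. f i j \<in> carrier K" and c: "c \<in> carrier K"
  shows "dsum (\<lambda>i j. c \<otimes> f i j) = c \<otimes> dsum f"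
proof (cases "finite (UNIV :: 'n set)")
  case True
  have "(\<Oplus>j\<in>UNIV. c \<otimes> f i j) = c \<otimes> (\<Oplus>j\<in>UNIV. f i j)" for i
    using finsum_rdistr[OF True c, of "f i"] f by auto
  moreover have "c \<otimes> (\<Oplus>i\<in>UNIV. \<Oplus>j\<in>UNIV. f i j) = (\<Oplus>i\<in>UNIV. c \<otimes> (\<Oplus>j\<in>UNIV. f i j))"
    using f c True by (intro finsum_rdistr) (auto intro!: finsum_closed)
  ultimately show ?thesis by (simp add: dsum_def)
qed (use c in \<open>simp add: dsum_def finsum_infinite\<close>)

text \<open>The extension of a form on the rational space to the vectors over K.\<close>

definition frm :: "(rat ^ 'n \<Rightarrow> rat ^ 'n \<Rightarrow> rat) \<Rightarrow> ('n::finite \<Rightarrow> 'k) \<Rightarrow> ('n \<Rightarrow> 'k) \<Rightarrow> 'k" where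
  "frm b x y = dsum (\<lambda>i j. x i \<otimes> y j \<otimes> h (b (axis i 1) (axis j 1)))"

lemma base_change_form_eq: "base_change_form K h (L, b) = frm b"
  by (intro HOL.ext) (simp add: base_change_form_def frm_def dsum_def)

lemma vecs_nth [simp]: "x \<in> vecs \<Longrightarrow> x i \<in> carrier K" by (simp add: vecs_def)

lemma frm_closed [simp, intro]: "x \<in> vecs \<Longrightarrow> y \<in> vecs \<Longrightarrow> frm b x y \<in> carrier K"
  unfolding frm_def by (intro dsum_closed) auto

lemma frm_add_left:
  assumes "x \<in> vecs" "y \<in> vecs" "z \<in> vecs"
  shows "frm b (x \<boxplus> y) z = frm b x z \<oplus> frm b y z"
  unfolding frm_def using assms
  by (subst dsum_add[symmetric]) (auto simp: vadd_def l_distr)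

lemma frm_add_right:
  assumes "x \<in> vecs" "y \<in> vecs" "z \<in> vecs"
  shows "frm b z (x \<boxplus> y) = frm b z x \<oplus> frm b z y"
  unfolding frm_def using assms
  by (subst dsum_add[symmetric]) (auto simp: vadd_def l_distr r_distr)

lemma frm_smult_left:
  assumes "x \<in> vecs" "z \<in> vecs" "c \<in> carrier K"
  shows "frm b (c \<cdot> x) z = c \<otimes> frm b x z"
  unfolding frm_def using assms
  by (subst dsum_mult[symmetric]) (auto simp: vsmult_def m_assoc)

lemma frm_smult_right:
  assumes "x \<in> vecs" "z \<in> vecs" "c \<in> carrier K"
  shows "frm b z (c \<cdot> x) = c \<otimes> frm b z x"
  unfolding frm_def using assms
  by (subst dsum_mult[symmetric]) (auto simp: vsmult_def m_assoc m_lcomm)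

lemma frm_zero [simp]: "x \<in> vecs \<Longrightarrow> frm b vzero x = \<zero>" "x \<in> vecs \<Longrightarrow> frm b x vzero = \<zero>"
  using frm_smult_left[of vzero x \<zero> b] frm_smult_right[of vzero x \<zero> b] by simp_all

lemma frm_scaled:
  assumes "x \<in> vecs" "y \<in> vecs"
  shows "frm (\<lambda>v w. q * b v w) x y = h q \<otimes> frm b x y"
  unfolding frm_def using assms
  by (subst dsum_mult[symmetric]) (auto simp: h_mult m_lcomm)


lemma finsum_swap:
  assumes "finite A" "finite B" "\<And>i j. f i j \<in> carrier K"
  shows "(\<Oplus>i\<in>A. \<Oplus>j\<in>B. f i j) = (\<Oplus>j\<in>B. \<Oplus>i\<in>A. f i j)"
  using assms(1)
proof (induction A rule: finite_induct)
  case empty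
  then show ?case using finsum_zero by simp
next
  case (insert a A)
  have "(\<Oplus>i\<in>insert a A. \<Oplus>j\<in>B. f i j) = (\<Oplus>j\<in>B. f a j) \<oplus> (\<Oplus>j\<in>B. \<Oplus>i\<in>A. f i j)"
    using insert assms(3) by (subst finsum_insert) auto
  also have "\<dots> = (\<Oplus>j\<in>B. f a j \<oplus> (\<Oplus>i\<in>A. f i j))"
    using assms(3) by (intro finsum_addf[symmetric]) auto
  also have "\<dots> = (\<Oplus>j\<in>B. \<Oplus>i\<in>insert a A. f i j)"
    using insert assms(3) by (intro finsum_cong') (auto simp: finsum_insert)
  finally show ?case .
qed

lemma frm_sym:
  assumes b: "symmetric_bilinear b" and "x \<in> vecs" "y \<in> vecs"
  shows "frm b x y = frm b y x"
proof -
  have "frm b x y = dsum (\<lambda>j i. x i \<otimes> y j \<otimes> h (b (axis i 1) (axis j 1)))"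
    unfolding frm_def dsum_def using assms by (intro finsum_swap) auto
  also have "\<dots> = frm b y x"
  proof -
    have "x i \<otimes> y j \<otimes> h (b (axis i 1) (axis j 1)) = y j \<otimes> x i \<otimes> h (b (axis j 1) (axis i 1))" for i j
      using assms sb_sym[OF b, of "axis i 1" "axis j 1"] by (simp add: m_comm)
    then show ?thesis unfolding frm_def by simp
  qed
  finally show ?thesis .
qed

lemma frm_emb:
  assumes b: "symmetric_bilinear b"
  shows "frm b (emb v) (emb w) = h (b v w)"
proof -
  have "b v w = b (\<Sum>i\<in>UNIV. v $ i *s axis i 1) (\<Sum>j\<in>UNIV. w $ j *s axis j 1)"
    by (simp add: basis_expansion)
  also have "\<dots> = (\<Sum>i\<in>UNIV. v $ i * b (axis i 1) (\<Sum>j\<in>UNIV. w $ j *s axis j 1))"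
    unfolding sb_sum_left[OF b] sb_scale_left[OF b] ..
  also have "\<dots> = (\<Sum>i\<in>UNIV. v $ i * (\<Sum>j\<in>UNIV. w $ j * b (axis i 1) (axis j 1)))"
    unfolding sb_sum_right[OF b] sb_scale_right[OF b] ..
  also have "\<dots> = (\<Sum>i\<in>UNIV. \<Sum>j\<in>UNIV. v $ i * w $ j * b (axis i 1) (axis j 1))"
    by (simp add: sum_distrib_left mult.assoc)
  finally show ?thesis
    by (simp add: frm_def dsum_def emb_def h_sum h_mult)
qed

text \<open>
  Statements about values of the form on a base change can be checked on the lattice. The set T
  stands for an S-submodule of K such as S itself.
\<close>

lemma frm_ext_mem:
  assumes b: "symmetric_bilinear b"
    and T: "T \<subseteq> carrier K" "\<zero> \<in> T" "\<And>s t. s \<in> T \<Longrightarrow> t \<in> T \<Longrightarrow> s \<oplus> t \<in> T"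
      "\<And>c t. c \<in> S \<Longrightarrow> t \<in> T \<Longrightarrow> c \<otimes> t \<in> T"
    and LM: "\<And>v w. v \<in> L \<Longrightarrow> w \<in> M \<Longrightarrow> h (b v w) \<in> T"
    and xy: "x \<in> ext_of L" "y \<in> ext_of M"
  shows "frm b x y \<in> T"
  using xy(1)
proof (induction rule: ext_induct)
  case zero
  then show ?case using ext_vecs[OF xy(2)] T by simp
next
  case (step c v x)
  have "frm b (emb v) y \<in> T" using xy(2)
  proof (induction rule: ext_induct)
    case zero
    then show ?case using T by simp
  next
    case (step d w z)
    then have "frm b (emb v) (d \<cdot> emb w \<boxplus> z) = d \<otimes> h (b v w) \<oplus> frm b (emb v) z"
      by (simp add: frm_add_right frm_smult_right frm_emb[OF b])
    then show ?case using step T LM \<open>v \<in> L\<close> by simp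
  qed
  moreover have "frm b (c \<cdot> emb v \<boxplus> x) y = c \<otimes> frm b (emb v) y \<oplus> frm b x y"
    using step ext_vecs[OF xy(2)] by (simp add: frm_add_left frm_smult_left)
  ultimately show ?case using step T by simp
qed

lemma frm_ext_integral:
  assumes "symmetric_bilinear b" "integral_lattice (L, b)" "x \<in> ext_of L" "y \<in> ext_of L"
  shows "frm b x y \<in> S"
  by (rule frm_ext_mem[OF assms(1) _ _ _ _ _ assms(3,4)])
    (use assms(2) in \<open>auto simp: integral_lattice_def intro: h_Ints\<close>)

subsection \<open>Isometries\<close>

text \<open>
  Isometries between the base changes of two lattices, in terms of the operations above.
\<close>

definition isometry :: "(rat ^ 'n::finite) set \<Rightarrow> (rat ^ 'n \<Rightarrow> rat ^ 'n \<Rightarrow> rat) \<Rightarrow> (rat ^ 'n) set \<Rightarrow>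
    (rat ^ 'n \<Rightarrow> rat ^ 'n \<Rightarrow> rat) \<Rightarrow> (('n \<Rightarrow> 'k) \<Rightarrow> 'n \<Rightarrow> 'k) \<Rightarrow> bool" where
  "isometry L b M b' f \<longleftrightarrow> bij_betw f (ext_of L) (ext_of M) \<and>
     (\<forall>x\<in>ext_of L. \<forall>y\<in>ext_of L. f (x \<boxplus> y) = f x \<boxplus> f y) \<and>
     (\<forall>c\<in>S. \<forall>x\<in>ext_of L. f (c \<cdot> x) = c \<cdot> f x) \<and>
     (\<forall>x\<in>ext_of L. \<forall>y\<in>ext_of L. frm b' (f x) (f y) = frm b x y)"

lemma isometric_over_iff: "isometric_over K S h (L, b) (M, b') \<longleftrightarrow> (\<exists>f. isometry L b M b' f)"
  unfolding isometric_over_def isometry_def base_change_eq base_change_form_eq vadd_def vsmult_def ..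

lemma isometryD:
  assumes "isometry L b M b' f"
  shows "bij_betw f (ext_of L) (ext_of M)" "inj_on f (ext_of L)" "f ` ext_of L = ext_of M"
    "x \<in> ext_of L \<Longrightarrow> y \<in> ext_of L \<Longrightarrow> f (x \<boxplus> y) = f x \<boxplus> f y"
    "c \<in> S \<Longrightarrow> x \<in> ext_of L \<Longrightarrow> f (c \<cdot> x) = c \<cdot> f x"
    "x \<in> ext_of L \<Longrightarrow> y \<in> ext_of L \<Longrightarrow> frm b' (f x) (f y) = frm b x y"
    "x \<in> ext_of L \<Longrightarrow> f x \<in> ext_of M"
  using assms by (auto simp: isometry_def bij_betw_def)

lemma isometry_zero: assumes "isometry L b M b' f" shows "f vzero = vzero"
proof -
  have "f (\<zero> \<cdot> vzero) = \<zero> \<cdot> f vzero" by (rule isometryD(5)[OF assms]) auto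
  moreover have "f vzero \<in> vecs" using isometryD(7)[OF assms, of vzero] by blast
  ultimately show ?thesis by simp
qed

lemma isometry_inverse:
  assumes f: "isometry L b M b' f" shows "isometry M b' L b (inv_into (ext_of L) f)"
proof -
  let ?g = "inv_into (ext_of L) f"
  have g: "?g y \<in> ext_of L" "f (?g y) = y" if "y \<in> ext_of M" for y
    using that isometryD(3)[OF f] by (metis inv_into_into, metis f_inv_into_f)
  have eq: "?g y = x" if "x \<in> ext_of L" "f x = y" for x y
    using that isometryD(2)[OF f] by auto
  show ?thesis
    unfolding isometry_def
  proof (intro conjI ballI)
    show "bij_betw ?g (ext_of M) (ext_of L)" by (rule bij_betw_inv_into[OF isometryD(1)[OF f]])
  next
    fix x y assume xy: "x \<in> ext_of M" "y \<in> ext_of M"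
    show "?g (x \<boxplus> y) = ?g x \<boxplus> ?g y"
      using xy g isometryD(4)[OF f, of "?g x" "?g y"] by (intro eq ext_add) auto
    show "frm b (?g x) (?g y) = frm b' x y"
      using isometryD(6)[OF f, of "?g x" "?g y"] g xy by simp
  next
    fix c x assume xy: "c \<in> S" "x \<in> ext_of M"
    show "?g (c \<cdot> x) = c \<cdot> ?g x"
      using xy g isometryD(5)[OF f, of c "?g x"] by (intro eq ext_smult) auto
  qed
qed

lemma isometry_compose:
  assumes f: "isometry L b M b' f" and g: "isometry M b' N b'' g" shows "isometry L b N b'' (g \<circ> f)"
  unfolding isometry_def using isometryD[OF f] isometryD[OF g] bij_betw_trans by auto

lemma isometry_id: "isometry L b L b id"
  by (simp add: isometry_def)

lemma isometric_over_refl: "isometric_over K S h (L, b) (L, b)"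
  using isometry_id isometric_over_iff by blast

lemma isometric_over_sym:
  "isometric_over K S h (L, b) (M, b') \<Longrightarrow> isometric_over K S h (M, b') (L, b)"
  using isometry_inverse isometric_over_iff by blast

lemma isometric_over_trans:
  "isometric_over K S h (L, b) (M, b') \<Longrightarrow> isometric_over K S h (M, b') (N, b'') \<Longrightarrow>
    isometric_over K S h (L, b) (N, b'')"
  unfolding isometric_over_iff using isometry_compose by fast

lemma ext_scaled:
  "ext_of ((\<lambda>x. c *s x) ` L) = (\<lambda>x. h c \<cdot> x) ` ext_of L"
proof -
  have "emb ` (\<lambda>x. c *s x) ` L = (\<lambda>x. h c \<cdot> x) ` emb ` L"
    by (simp add: image_image emb_scale)
  then show ?thesis
    unfolding ext_of_def
    by (simp, intro lin_span_image[where A = vecs])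
      (auto simp: vsmult_vadd vsmult_comm submod_def)
qed

text \<open>
  Scaling a lattice by c, with the form divided by the square of c, is an isometry.
\<close>

lemma isometric_over_scaled:
  assumes c: "c \<noteq> 0"
  shows "isometric_over K S h ((\<lambda>x. c *s x) ` L, \<lambda>x y. (1 / c)\<^sup>2 * b x y) (L, b)"
proof -
  have "isometry ((\<lambda>x. c *s x) ` L) (\<lambda>x y. (1 / c)\<^sup>2 * b x y) L b (\<lambda>x. h (1 / c) \<cdot> x)"
    unfolding isometry_def
  proof (intro conjI ballI)
    show "bij_betw (\<lambda>x. h (1 / c) \<cdot> x) (ext_of ((\<lambda>x. c *s x) ` L)) (ext_of L)"
      unfolding ext_scaled
      by (rule bij_betw_byWitness[where f' = "\<lambda>x. h c \<cdot> x"]) (use c in \<open>auto simp: h_cancel\<close>)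
  next
    fix x y assume "x \<in> ext_of ((\<lambda>x. c *s x) ` L)" "y \<in> ext_of ((\<lambda>x. c *s x) ` L)"
    then have xy: "x \<in> vecs" "y \<in> vecs" by auto
    show "frm b (h (1 / c) \<cdot> x) (h (1 / c) \<cdot> y) = frm (\<lambda>x y. (1 / c)\<^sup>2 * b x y) x y"
      unfolding frm_scaled[OF xy] power2_eq_square h_mult
      using xy by (simp add: frm_smult_left frm_smult_right m_assoc)
  qed (auto simp: vsmult_vadd vsmult_comm)
  then show ?thesis using isometric_over_iff by blast
qed

text \<open>If q is a unit of S, the partial dual at q has the same base change.\<close>

lemma ext_pdual_unit:
  assumes L: "is_lattice (L, b)" "integral_lattice (L, b)" and q: "q > 0" "h (1 / of_nat q) \<in> S"
  shows "ext_of (pdual q L b) = ext_of L"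
proof
  show "ext_of L \<subseteq> ext_of (pdual q L b)"
    unfolding ext_of_def using subset_pdual[OF L, of q] by (intro lin_span_mono image_mono)
  show "ext_of (pdual q L b) \<subseteq> ext_of L"
  proof (rule ext_least[OF submod_ext])
    fix v assume "v \<in> pdual q L b"
    then have "emb (of_nat q *s v) \<in> ext_of L" by (intro ext_base) (simp add: pdual_def)
    then have "h (1 / of_nat q) \<cdot> h (of_nat q) \<cdot> emb v \<in> ext_of L"
      using q(2) by (simp add: emb_scale ext_smult)
    then show "emb v \<in> ext_of L" using q(1) by (simp add: h_cancel)
  qed
qed

lemma isometric_partial_dual_unit:
  assumes "is_lattice (L, b)" "integral_lattice (L, b)" "is_lattice (M, b')" "integral_lattice (M, b')"
    and q: "q > 0" "h (1 / of_nat q) \<in> S" and iso: "isometric_over K S h (L, b) (M, b')"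
  shows "isometric_over K S h (partial_dual q (L, b)) (partial_dual q (M, b'))"
proof -
  obtain f where f: "isometry L b M b' f" using iso isometric_over_iff by blast
  have "isometry (pdual q L b) (\<lambda>x y. of_nat q * b x y) (pdual q M b') (\<lambda>x y. of_nat q * b' x y) f"
    unfolding isometry_def ext_pdual_unit[OF assms(1,2) q] ext_pdual_unit[OF assms(3,4) q]
    using isometryD[OF f] frm_scaled[OF ext_vecs[of _ M] ext_vecs[of _ M]] frm_scaled[OF ext_vecs[of _ L] ext_vecs[of _ L]]
    by auto
  then show ?thesis unfolding partial_dual_eq[OF q(1)] isometric_over_iff by blast
qed

end


section \<open>Lattices over the p-adic integers\<close>

text \<open>
  The properties of the p-adic numbers that are used below: S is the ring of p-adic integers,
  whose rational members are the numbers integral at p, members of K have denominators that are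
  powers of p, and p-adic integers are congruent modulo p to integers.
\<close>

locale padic_scalars = scalar_extension K S h
  for K :: "'k ring" (structure) and S :: "'k set" and h :: "rat \<Rightarrow> 'k" +
  fixes p :: nat
  assumes p: "prime p"
    and h_mem_iff: "\<And>q. h q \<in> S \<longleftrightarrow> padic_abs p q \<le> 1"
    and bounded_denominator: "\<And>c. c \<in> carrier K \<Longrightarrow> \<exists>k. h (of_nat p ^ k) \<otimes> c \<in> S"
    and residue: "\<And>c. c \<in> S \<Longrightarrow> \<exists>a::int. \<exists>d\<in>S. c = h (of_int a) \<oplus> h (of_nat p) \<otimes> d"
begin

abbreviation P :: 'k where "P \<equiv> h (of_nat p)"
abbreviation Pinv :: 'k where "Pinv \<equiv> h (1 / of_nat p)"

lemma vadd_swap: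
  assumes "x \<in> vecs" "y \<in> vecs" "z \<in> vecs" "w \<in> vecs"
  shows "(x \<boxplus> y) \<boxplus> (z \<boxplus> w) = (x \<boxplus> z) \<boxplus> (y \<boxplus> w)"
proof -
  have "x \<boxplus> y \<boxplus> (z \<boxplus> w) = x \<boxplus> (y \<boxplus> z \<boxplus> w)" using assms by (simp add: vadd_assoc)
  also have "y \<boxplus> z = z \<boxplus> y" using assms by (simp only: vadd_comm)
  also have "x \<boxplus> (z \<boxplus> y \<boxplus> w) = x \<boxplus> z \<boxplus> (y \<boxplus> w)" using assms by (simp add: vadd_assoc)
  finally show ?thesis .
qed

lemma p_pos: "p > 0" "(of_nat p :: rat) \<noteq> 0"
  using p prime_gt_0_nat by auto

lemma P_Pinv [simp]: "P \<otimes> Pinv = \<one>" "Pinv \<otimes> P = \<one>"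
  using p_pos h_mult[of "of_nat p" "1 / of_nat p"] h_mult[of "1 / of_nat p" "of_nat p"]
  by (simp_all add: h_one)

lemma P_cancel [simp]: "x \<in> vecs \<Longrightarrow> P \<cdot> Pinv \<cdot> x = x" "x \<in> vecs \<Longrightarrow> Pinv \<cdot> P \<cdot> x = x"
  using h_cancel[OF p_pos(2)] by blast+

lemma P_cancel_scalar [simp]:
  "c \<in> carrier K \<Longrightarrow> P \<otimes> (Pinv \<otimes> c) = c" "c \<in> carrier K \<Longrightarrow> Pinv \<otimes> (P \<otimes> c) = c"
  by (simp_all add: m_assoc[symmetric])

lemma Pinv_nonmem: "Pinv \<notin> S"
proof -
  have "padic_abs p (1 / of_nat p) * padic_abs p (of_nat p) = 1"
    using p_pos(2) padic_abs_mult[OF p, of "1 / of_nat p" "of_nat p"] by simp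
  moreover have "padic_abs p (of_nat p) = 1 / real p" using padic_abs_prime_power[OF p, of 1] by simp
  ultimately have "padic_abs p (1 / of_nat p) = real p" using p_pos by simp
  then show ?thesis using prime_gt_1_nat[OF p] by (simp add: h_mem_iff)
qed

lemma bezout_multiple:
  assumes L: "full_rank_lattice L" and "\<not> int p dvd m" "of_int m *s v \<in> L" "of_nat (p ^ k) *s v \<in> L"
  shows "v \<in> L"
proof -
  obtain r s where rs: "r * m + s * int p ^ k = 1" using bezout_prime_power[OF p assms(2)] .
  have "of_int r *s (of_int m *s v) + of_int s *s (of_nat (p ^ k) *s v) = of_int (r * m + s * int p ^ k) *s v"
    by (simp add: vec.scale_left_distrib)
  also have "\<dots> = v" unfolding rs by simp
  finally show ?thesis
    using full_rank_add[OF L full_rank_scale[OF L _ assms(3)] full_rank_scale[OF L _ assms(4)]]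
    by (metis Ints_of_int)
qed

text \<open>
  A rational vector that lies in the base change of L lies in the localization of L at p. The
  coordinates of the vector are its values under the form for which a basis of L is orthonormal;
  this form is integral on L, so these values are p-adic integers.
\<close>

lemma rational_point:
  assumes L: "full_rank_lattice L" and v: "emb v \<in> ext_of L"
  obtains m :: int where "\<not> int p dvd m" "of_int m *s v \<in> L"
proof -
  obtain e where e: "is_int_basis e L" using L unfolding full_rank_lattice_def by blast
  let ?E = "\<chi> i. e i"
  have d: "det ?E \<noteq> 0" using e by (simp add: is_int_basis_iff)
  then obtain B where B: "?E ** B = mat 1"
    unfolding invertible_det_nz[symmetric] invertible_right_inverse by blast
  \<comment> \<open>the form for which the basis is orthonormal, as multiplication with B gives the coordinates\<close>
  define b where "b x y = (\<Sum>i\<in>UNIV. (x v* B) $ i * (y v* B) $ i)" for x y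
  have b: "symmetric_bilinear b"
  proof -
    have "(x + y) v* B = x v* B + y v* B" "(q *s x) v* B = q *s (x v* B)" for x y q
      by (simp_all add: vector_matrix_mult_def vec_eq_iff distrib_left sum.distrib sum_distrib_left mult_ac)
    moreover have "Vector_Spaces.linear (*s) (*) (b x) \<longleftrightarrow>
        (\<forall>y z. b x (y + z) = b x y + b x z) \<and> (\<forall>c y. b x (c *s y) = c * b x y)" for x
      by (auto simp: Vector_Spaces.linear_iff
          intro: vec.vector_space_axioms vector_space_over_itself.vector_space_axioms)
    ultimately show ?thesis
      unfolding symmetric_bilinear_def
      by (auto simp: b_def mult.commute distrib_left distrib_right sum.distrib sum_distrib_left mult_ac)
  qed
  have coords: "(\<Sum>i\<in>UNIV. q i *s e i) v* B = (\<chi> i. q i)" for q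
  proof -
    have "(\<Sum>i\<in>UNIV. q i *s e i) = (\<chi> i. q i) v* ?E"
      by (simp add: vec_eq_iff vector_matrix_mult_def mult.commute)
    then show ?thesis by (simp add: vector_matrix_mul_assoc B)
  qed
  have be: "b (\<Sum>i\<in>UNIV. q i *s e i) (e j) = q j" for q j
  proof -
    have "e j = (\<Sum>i\<in>UNIV. (if i = j then 1 else 0) *s e i)"
      by (simp add: if_distrib[of "\<lambda>c. c *s _"] sum.delta cong: if_cong)
    then have "e j v* B = (\<chi> i. if i = j then 1 else 0)" by (metis coords)
    then show ?thesis by (simp add: b_def coords if_distrib sum.delta cong: if_cong)
  qed
  have "integral_lattice (L, b)"
  proof -
    have "b x y \<in> \<int>" if xy: "x \<in> L" "y \<in> L" for x y
    proof -
      obtain c d where "x = (\<Sum>i\<in>UNIV. of_int (c i) *s e i)" "y = (\<Sum>i\<in>UNIV. of_int (d i) *s e i)"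
        using xy e unfolding is_int_basis_iff by blast
      then show ?thesis by (auto simp: b_def coords intro!: Ints_sum)
    qed
    then show ?thesis by (simp add: integral_lattice_def)
  qed
  note int = frm_ext_integral[OF b this v ext_base[OF int_basis_mem[OF e]]]
  obtain q where q: "v = (\<Sum>i\<in>UNIV. q i *s e i)" using expand_in_basis[OF d] .
  have "padic_abs p (q i) \<le> 1" for i
    using int[of i] unfolding frm_emb[OF b] h_mem_iff q be .
  then have "\<exists>m::int. \<not> int p dvd m \<and> of_int m * q i \<in> \<int>" for i by (simp add: padic_abs_le_1_iff[OF p])
  then obtain m where m: "\<And>i. \<not> int p dvd m i" "\<And>i. of_int (m i) * q i \<in> \<int>" by metis
  have "\<not> int p dvd (\<Prod>i\<in>UNIV. m i)" using m(1) p by (simp add: prime_dvd_prod_iff)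
  moreover have "of_int (\<Prod>i\<in>UNIV. m i) *s v \<in> L"
  proof -
    have "of_int (\<Prod>i\<in>UNIV. m i) * q i \<in> \<int>" for i
    proof -
      have "(\<Prod>i\<in>UNIV. m i) = (\<Prod>i\<in>UNIV - {i}. m i) * m i" by (subst prod.remove[of UNIV i]) simp_all
      then have "of_int (\<Prod>i\<in>UNIV. m i) * q i = of_int (\<Prod>i\<in>UNIV - {i}. m i) * (of_int (m i) * q i)"
        by (simp only: of_int_mult mult.assoc)
      then show ?thesis using m(2)[of i] by (metis Ints_mult Ints_of_int)
    qed
    moreover have "of_int (\<Prod>i\<in>UNIV. m i) *s v = (\<Sum>i\<in>UNIV. (of_int (\<Prod>i\<in>UNIV. m i) * q i) *s e i)"
      unfolding q by (simp only: vec.scale_sum_right vec.scale_scale)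
    ultimately show ?thesis using int_basis_coords[OF e] by metis
  qed
  ultimately show ?thesis by (rule that)
qed

lemma rational_point_mem:
  assumes "full_rank_lattice L" "emb v \<in> ext_of L" "of_nat (p ^ k) *s v \<in> L" shows "v \<in> L"
  using rational_point[OF assms(1,2)] bezout_multiple[OF assms(1) _ _ assms(3)] by metis

lemma integer_div_mem:
  assumes "x \<in> \<int>" "h (x / of_nat p ^ k) \<in> S" shows "x / of_nat p ^ k \<in> \<int>"
proof -
  obtain m :: int where m: "\<not> int p dvd m" "of_int m * (x / of_nat p ^ k) \<in> \<int>"
    using assms(2) unfolding h_mem_iff padic_abs_le_1_iff[OF p] by blast
  obtain r s where rs: "r * m + s * int p ^ k = 1" using bezout_prime_power[OF p m(1)] .
  have "x / of_nat p ^ k = of_int (r * m + s * int p ^ k) * (x / of_nat p ^ k)" unfolding rs by simp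
  also have "\<dots> = of_int r * (of_int m * (x / of_nat p ^ k)) + of_int s * x"
    using p_pos by (simp add: field_simps)
  finally show ?thesis using m(2) assms(1) by (metis Ints_add Ints_mult Ints_of_int)
qed

lemma approximate_vector:
  assumes L: "full_rank_lattice L" and x: "x \<in> ext_of L"
  obtains v z where "v \<in> L" "z \<in> ext_of L" "x = emb v \<boxplus> P \<cdot> z"
proof -
  have "\<exists>v\<in>L. \<exists>z\<in>ext_of L. x = emb v \<boxplus> P \<cdot> z" using x
  proof (induction rule: ext_induct)
    case zero
    then show ?case using full_rank_zero[OF L] by (intro bexI[of _ 0] bexI[of _ vzero]) (auto simp: emb_0)
  next
    case (step c v x)
    obtain w z where w: "w \<in> L" "z \<in> ext_of L" "x = emb w \<boxplus> P \<cdot> z" using step.IH by blast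
    obtain a :: int and d where a: "d \<in> S" "c = h (of_int a) \<oplus> P \<otimes> d" using residue[OF step(1)] by blast
    have zv: "z \<in> vecs" using w(2) by blast
    have "c \<cdot> emb v \<boxplus> x = (h (of_int a) \<cdot> emb v \<boxplus> P \<cdot> d \<cdot> emb v) \<boxplus> (emb w \<boxplus> P \<cdot> z)"
      unfolding w(3) a(2) using a(1) by (simp add: vsmult_add vsmult_vsmult)
    also have "\<dots> = (h (of_int a) \<cdot> emb v \<boxplus> emb w) \<boxplus> (P \<cdot> d \<cdot> emb v \<boxplus> P \<cdot> z)"
      using a(1) zv by (intro vadd_swap) auto
    also have "\<dots> = emb (of_int a *s v + w) \<boxplus> P \<cdot> (d \<cdot> emb v \<boxplus> z)"
      unfolding emb_add emb_scale using a(1) zv by (simp add: vsmult_vadd)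
    finally have "c \<cdot> emb v \<boxplus> x = emb (of_int a *s v + w) \<boxplus> P \<cdot> (d \<cdot> emb v \<boxplus> z)" .
    moreover have "of_int a *s v + w \<in> L" using full_rank_add[OF L full_rank_scale[OF L _ step(2)] w(1)] by simp
    moreover have "d \<cdot> emb v \<boxplus> z \<in> ext_of L" using a(1) step(2) w(2) by (simp add: ext_add ext_smult ext_base)
    ultimately show ?case by blast
  qed
  then show ?thesis using that by blast
qed

lemma approximate_vector_power:
  assumes L: "full_rank_lattice L" and x: "x \<in> ext_of L"
  obtains v z where "v \<in> L" "z \<in> ext_of L" "x = emb v \<boxplus> h (of_nat p ^ k) \<cdot> z"
proof -
  have "\<exists>v\<in>L. \<exists>z\<in>ext_of L. x = emb v \<boxplus> h (of_nat p ^ k) \<cdot> z"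
  proof (induction k)
    case 0
    then show ?case using full_rank_zero[OF L] x by (intro bexI[of _ 0] bexI[of _ x]) (auto simp: emb_0 h_one)
  next
    case (Suc k)
    then obtain v z where v: "v \<in> L" "z \<in> ext_of L" "x = emb v \<boxplus> h (of_nat p ^ k) \<cdot> z" by blast
    obtain w y where w: "w \<in> L" "y \<in> ext_of L" "z = emb w \<boxplus> P \<cdot> y" using approximate_vector[OF L v(2)] by blast
    have yv: "y \<in> vecs" using w(2) by blast
    have "x = emb (v + of_nat p ^ k *s w) \<boxplus> h (of_nat p ^ Suc k) \<cdot> y"
      unfolding v(3) w(3) emb_add emb_scale using yv
      by (simp add: vsmult_vadd vsmult_vsmult vadd_assoc h_mult m_comm)
    moreover have "v + of_nat p ^ k *s w \<in> L"
      using full_rank_add[OF L v(1) full_rank_scale[OF L _ w(1), of "of_nat p ^ k"]] by simp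
    ultimately show ?case using w(2) by blast
  qed
  then show ?thesis using that by blast
qed

lemma span_denominator:
  assumes A: "submod S A" and w: "w \<in> lin_span K (carrier K) A"
  obtains k where "h (of_nat p ^ k) \<cdot> w \<in> A"
proof -
  have Av: "A \<subseteq> vecs" using A by (simp add: submod_def)
  have V: "lin_span K (carrier K) A \<subseteq> vecs" by (rule lin_span_vecs[OF Av]) simp
  have pk: "h (of_nat p ^ k) \<in> S" for k using h_nat[of "p ^ k"] by simp
  have "\<exists>k. h (of_nat p ^ k) \<cdot> w \<in> A" using w
  proof (induction rule: lin_span_induct)
    case zero
    then show ?case using submodD(2)[OF A] by (intro exI[of _ 0]) auto
  next
    case (step c v x)
    obtain k where k: "h (of_nat p ^ k) \<otimes> c \<in> S" using bounded_denominator[OF step(1)] by blast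
    obtain l where l: "h (of_nat p ^ l) \<cdot> x \<in> A" using step.IH by blast
    have v: "v \<in> vecs" "x \<in> vecs" using step Av V by auto
    have "h (of_nat p ^ (k + l)) \<cdot> (c \<cdot> v \<boxplus> x) =
        h (of_nat p ^ l) \<cdot> (h (of_nat p ^ k) \<otimes> c) \<cdot> v \<boxplus> h (of_nat p ^ k) \<cdot> h (of_nat p ^ l) \<cdot> x"
      using v step(1) by (simp add: power_add h_mult vsmult_vadd vsmult_vsmult m_ac)
    also have "\<dots> \<in> A"
      by (rule submodD(3)[OF A submodD(4)[OF A pk submodD(4)[OF A k step(2)]] submodD(4)[OF A pk l]])
    finally show ?case by blast
  qed
  then show ?thesis using that by blast
qed

subsection \<open>The partial dual at p\<close>

text \<open>
  The base change of the partial dual at p is the partial dual of the base change. This is where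
  the approximation modulo p of p-adic by rational vectors enters.
\<close>

lemma ext_pdual:
  assumes L: "is_lattice (L, b)" "integral_lattice (L, b)"
  shows "ext_of (pdual p L b) = {x \<in> vecs. P \<cdot> x \<in> ext_of L \<and> (\<forall>y\<in>ext_of L. frm b y x \<in> S)}" (is "_ = ?D")
proof
  have b: "symmetric_bilinear b" and F: "full_rank_lattice L" using L by (simp_all add: is_lattice_def)
  have sub: "submod S ?D"
    unfolding submod_def
    by (auto simp: vsmult_vadd ext_add ext_smult frm_add_right frm_smult_right
        vsmult_comm[OF h_closed S_carrier])
  show "ext_of (pdual p L b) \<subseteq> ?D"
  proof (rule ext_least[OF sub])
    fix v assume v: "v \<in> pdual p L b"
    have "emb (of_nat p *s v) \<in> ext_of L" using v by (intro ext_base) (simp add: pdual_def)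
    moreover have "frm b y (emb v) \<in> S" if "y \<in> ext_of L" for y
    proof (rule frm_ext_mem[OF b _ _ _ _ _ that])
      show "emb v \<in> ext_of {v}" by (rule ext_base) simp
    qed (use v in \<open>auto simp: pdual_def intro: h_Ints\<close>)
    ultimately show "emb v \<in> ?D" by (simp add: emb_scale)
  qed
  show "?D \<subseteq> ext_of (pdual p L b)"
  proof clarify
    fix x assume x: "x \<in> vecs" "P \<cdot> x \<in> ext_of L" "\<forall>y\<in>ext_of L. frm b y x \<in> S"
    obtain v z where v: "v \<in> L" "z \<in> ext_of L" "P \<cdot> x = emb v \<boxplus> P \<cdot> z" using approximate_vector[OF F x(2)] .
    have zv: "z \<in> vecs" using v(2) by blast
    have "x = Pinv \<cdot> (P \<cdot> x)" using x(1) by simp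
    also have "\<dots> = emb ((1 / of_nat p) *s v) \<boxplus> z" unfolding v(3) emb_scale using zv by (simp add: vsmult_vadd)
    finally have xeq: "x = emb ((1 / of_nat p) *s v) \<boxplus> z" .
    have "b y ((1 / of_nat p) *s v) \<in> \<int>" if y: "y \<in> L" for y
    proof -
      have "frm b (emb y) x \<in> S" using x(3) ext_base[OF y] by blast
      moreover have "frm b (emb y) z \<in> S" by (rule frm_ext_integral[OF b L(2) ext_base[OF y] v(2)])
      moreover have "frm b (emb y) (emb ((1 / of_nat p) *s v)) = frm b (emb y) x \<oplus> h (- 1) \<otimes> frm b (emb y) z"
      proof -
        have "emb ((1 / of_nat p) *s v) = x \<boxplus> h (- 1) \<cdot> z"
          unfolding xeq using zv by (simp add: vadd_assoc vadd_neg)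
        then show ?thesis using x(1) zv by (simp add: frm_add_right frm_smult_right)
      qed
      moreover have "h (- 1) \<in> S" using h_int[of "- 1"] by simp
      ultimately have "h (b y ((1 / of_nat p) *s v)) \<in> S" by (simp add: frm_emb[OF b])
      then have "h (b y v / of_nat p ^ 1) \<in> S" by (simp add: sb_scale_right[OF b])
      moreover have "b y v \<in> \<int>" using L(2) y v(1) by (simp add: integral_lattice_def)
      ultimately have "b y v / of_nat p ^ 1 \<in> \<int>" by (intro integer_div_mem)
      then show ?thesis by (simp add: sb_scale_right[OF b])
    qed
    then have "(1 / of_nat p) *s v \<in> pdual p L b" using v(1) p_pos by (simp add: pdual_def)
    then have "emb ((1 / of_nat p) *s v) \<in> ext_of (pdual p L b)" by (rule ext_base)
    moreover have "z \<in> ext_of (pdual p L b)"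
      using v(2) lin_span_mono[OF image_mono[OF subset_pdual[OF L, of p]]] unfolding ext_of_def by blast
    ultimately show "x \<in> ext_of (pdual p L b)" unfolding xeq by (rule ext_add)
  qed
qed

text \<open>
  An isometry f extends to the partial duals by homogeneity. The value at x is computed through p
  x, as f is defined on the base change of L only.
\<close>

lemma isometry_pdual:
  assumes L: "is_lattice (L, b)" "integral_lattice (L, b)" and M: "is_lattice (M, b')" "integral_lattice (M, b')"
    and f: "isometry L b M b' f"
  shows "isometry (pdual p L b) (\<lambda>x y. of_nat p * b x y) (pdual p M b') (\<lambda>x y. of_nat p * b' x y)
    (\<lambda>x. Pinv \<cdot> f (P \<cdot> x))"
proof -
  have fv: "f y \<in> vecs" if "y \<in> ext_of L" for y using isometryD(7)[OF f that] by blast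
  have map: "Pinv \<cdot> f (P \<cdot> x) \<in> ext_of (pdual p M b')"
    if L: "is_lattice (L, b)" "integral_lattice (L, b)" and M: "is_lattice (M, b')" "integral_lattice (M, b')"
      and f: "isometry L b M b' f" and x: "x \<in> ext_of (pdual p L b)" for L b M b' f x
  proof -
    have x: "x \<in> vecs" "P \<cdot> x \<in> ext_of L" "\<And>y. y \<in> ext_of L \<Longrightarrow> frm b y x \<in> S" using x unfolding ext_pdual[OF L] by auto
    have fx: "f (P \<cdot> x) \<in> ext_of M" using isometryD(7)[OF f] x by blast
    then have fxv: "f (P \<cdot> x) \<in> vecs" by blast
    have "frm b' y (Pinv \<cdot> f (P \<cdot> x)) \<in> S" if y: "y \<in> ext_of M" for y
    proof -
      obtain u where u: "u \<in> ext_of L" "y = f u" using y isometryD(3)[OF f] by blast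
      have uv: "u \<in> vecs" "f u \<in> vecs" using u(1) isometryD(7)[OF f u(1)] by blast+
      have "frm b' y (Pinv \<cdot> f (P \<cdot> x)) = Pinv \<otimes> frm b u (P \<cdot> x)"
        using isometryD(6)[OF f u(1) x(2)] uv fxv by (simp add: u(2) frm_smult_right)
      also have "\<dots> = frm b u x" using uv x(1) by (simp add: frm_smult_right)
      finally show ?thesis using x(3)[OF u(1)] by simp
    qed
    then show ?thesis unfolding ext_pdual[OF M] using fx fxv by simp
  qed
  show ?thesis
    unfolding isometry_def
  proof (intro conjI ballI)
    let ?f' = "inv_into (ext_of L) f"
    note f' = isometry_inverse[OF f]
    have inv: "?f' (f y) = y" if "y \<in> ext_of L" for y using that isometryD(2)[OF f] by simp
    have inv': "f (?f' y) = y" if "y \<in> ext_of M" for y using that isometryD(3)[OF f] by (metis f_inv_into_f)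
    show "bij_betw (\<lambda>x. Pinv \<cdot> f (P \<cdot> x)) (ext_of (pdual p L b)) (ext_of (pdual p M b'))"
    proof (rule bij_betw_byWitness[where f' = "\<lambda>x. Pinv \<cdot> ?f' (P \<cdot> x)"])
      show "\<forall>x\<in>ext_of (pdual p L b). Pinv \<cdot> ?f' (P \<cdot> (Pinv \<cdot> f (P \<cdot> x))) = x"
        using inv fv by (auto simp: ext_pdual[OF L])
      show "\<forall>x\<in>ext_of (pdual p M b'). Pinv \<cdot> f (P \<cdot> (Pinv \<cdot> ?f' (P \<cdot> x))) = x"
        using inv' ext_vecs[OF isometryD(7)[OF f']] by (auto simp: ext_pdual[OF M])
      show "(\<lambda>x. Pinv \<cdot> f (P \<cdot> x)) ` ext_of (pdual p L b) \<subseteq> ext_of (pdual p M b')" using map[OF L M f] by blast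
      show "(\<lambda>x. Pinv \<cdot> ?f' (P \<cdot> x)) ` ext_of (pdual p M b') \<subseteq> ext_of (pdual p L b)" using map[OF M L f'] by blast
    qed
  next
    fix x y assume "x \<in> ext_of (pdual p L b)" "y \<in> ext_of (pdual p L b)"
    then have xy: "x \<in> vecs" "P \<cdot> x \<in> ext_of L" "y \<in> vecs" "P \<cdot> y \<in> ext_of L" unfolding ext_pdual[OF L] by auto
    show "Pinv \<cdot> f (P \<cdot> (x \<boxplus> y)) = Pinv \<cdot> f (P \<cdot> x) \<boxplus> Pinv \<cdot> f (P \<cdot> y)"
      using xy fv by (simp add: vsmult_vadd isometryD(4)[OF f])
    have "frm b' (f (P \<cdot> x)) (f (P \<cdot> y)) = P \<otimes> (P \<otimes> frm b x y)"
      using xy by (simp add: isometryD(6)[OF f] frm_smult_left frm_smult_right)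
    then show "frm (\<lambda>x y. of_nat p * b' x y) (Pinv \<cdot> f (P \<cdot> x)) (Pinv \<cdot> f (P \<cdot> y)) =
        frm (\<lambda>x y. of_nat p * b x y) x y"
      using xy fv by (simp add: frm_scaled frm_smult_left frm_smult_right)
  next
    fix c x assume "c \<in> S" "x \<in> ext_of (pdual p L b)"
    then have x: "c \<in> S" "x \<in> vecs" "P \<cdot> x \<in> ext_of L" unfolding ext_pdual[OF L] by auto
    have "f (P \<cdot> c \<cdot> x) = c \<cdot> f (P \<cdot> x)" using isometryD(5)[OF f x(1,3)] x by (simp add: vsmult_comm)
    then show "Pinv \<cdot> f (P \<cdot> c \<cdot> x) = c \<cdot> Pinv \<cdot> f (P \<cdot> x)"
      using x fv by (simp add: vsmult_comm)
  qed
qed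

lemma isometric_partial_dual_prime:
  assumes "is_lattice (L, b)" "integral_lattice (L, b)" "is_lattice (M, b')" "integral_lattice (M, b')"
    and "isometric_over K S h (L, b) (M, b')"
  shows "isometric_over K S h (partial_dual p (L, b)) (partial_dual p (M, b'))"
  using assms(5) isometry_pdual[OF assms(1-4)] unfolding partial_dual_eq[OF p_pos(1)] isometric_over_iff by blast

end


context padic_scalars
begin

subsection \<open>Free and unimodular modules\<close>

text \<open>The linear combination of the vectors in B with coefficients c.\<close>

definition lin_comb :: "(('n \<Rightarrow> 'k) \<Rightarrow> 'k) \<Rightarrow> ('n \<Rightarrow> 'k) set \<Rightarrow> 'n \<Rightarrow> 'k" where
  "lin_comb c B = (\<lambda>i. \<Oplus>v\<in>B. c v \<otimes> v i)"

lemma lin_comb_empty: "lin_comb c {} = vzero"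
  by (simp add: lin_comb_def vzero_def)

lemma lin_comb_insert:
  assumes "finite B" "v \<notin> B" "insert v B \<subseteq> vecs" "\<And>w. w \<in> insert v B \<Longrightarrow> c w \<in> carrier K"
  shows "lin_comb c (insert v B) = c v \<cdot> v \<boxplus> lin_comb c B"
  unfolding lin_comb_def vadd_def vsmult_def
  by (intro HOL.ext finsum_insert) (use assms in auto)

lemma lin_comb_cong:
  assumes "B \<subseteq> vecs" "\<And>w. w \<in> B \<Longrightarrow> c w = d w" "\<And>w. w \<in> B \<Longrightarrow> d w \<in> carrier K"
  shows "lin_comb c B = lin_comb d B"
  unfolding lin_comb_def by (intro HOL.ext finsum_cong') (use assms in auto)

lemma lin_comb_add:
  assumes "B \<subseteq> vecs" "\<And>w. w \<in> B \<Longrightarrow> c w \<in> carrier K" "\<And>w. w \<in> B \<Longrightarrow> d w \<in> carrier K"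
  shows "lin_comb (\<lambda>w. c w \<oplus> d w) B = lin_comb c B \<boxplus> lin_comb d B"
proof
  fix i
  have "(\<Oplus>v\<in>B. (c v \<oplus> d v) \<otimes> v i) = (\<Oplus>v\<in>B. c v \<otimes> v i \<oplus> d v \<otimes> v i)"
    by (intro finsum_cong') (use assms in \<open>auto simp: l_distr subset_iff\<close>)
  also have "\<dots> = (\<Oplus>v\<in>B. c v \<otimes> v i) \<oplus> (\<Oplus>v\<in>B. d v \<otimes> v i)"
    by (intro finsum_addf) (use assms in auto)
  finally show "lin_comb (\<lambda>w. c w \<oplus> d w) B i = (lin_comb c B \<boxplus> lin_comb d B) i" by (simp add: lin_comb_def vadd_def)
qed

lemma lin_comb_smult:
  assumes "finite B" "B \<subseteq> vecs" "\<And>w. w \<in> B \<Longrightarrow> c w \<in> carrier K" "a \<in> carrier K"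
  shows "lin_comb (\<lambda>w. a \<otimes> c w) B = a \<cdot> lin_comb c B"
proof
  fix i
  have "(\<Oplus>v\<in>B. a \<otimes> c v \<otimes> v i) = (\<Oplus>v\<in>B. a \<otimes> (c v \<otimes> v i))"
    by (intro finsum_cong') (use assms in \<open>auto simp: m_assoc subset_iff\<close>)
  also have "\<dots> = a \<otimes> (\<Oplus>v\<in>B. c v \<otimes> v i)"
    by (intro finsum_rdistr[symmetric]) (use assms in auto)
  finally show "lin_comb (\<lambda>w. a \<otimes> c w) B i = (a \<cdot> lin_comb c B) i" by (simp add: lin_comb_def vsmult_def)
qed

lemma lin_comb_delta:
  assumes "finite B" "B \<subseteq> vecs" "v \<in> B" "a \<in> carrier K"
  shows "lin_comb (\<lambda>w. if w = v then a else \<zero>) B = a \<cdot> v"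
proof -
  have B: "B = insert v (B - {v})" using assms(3) by blast
  have "lin_comb (\<lambda>w. if w = v then a else \<zero>) B = a \<cdot> v \<boxplus> lin_comb (\<lambda>w. if w = v then a else \<zero>) (B - {v})"
    by (subst B, subst lin_comb_insert) (use assms in auto)
  also have "lin_comb (\<lambda>w. if w = v then a else \<zero>) (B - {v}) = lin_comb (\<lambda>w. \<zero>) (B - {v})"
    by (rule lin_comb_cong) (use assms in auto)
  also have "\<dots> = vzero"
    unfolding lin_comb_def vzero_def by (intro HOL.ext add.finprod_one_eqI) (use assms in auto)
  finally show ?thesis using assms by auto
qed

lemma lin_span_lin_comb:
  assumes "finite B" "B \<subseteq> vecs" "x \<in> lin_span K S B"
  obtains c where "\<And>w. w \<in> B \<Longrightarrow> c w \<in> S" "x = lin_comb c B"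
proof -
  have "\<exists>c. (\<forall>w\<in>B. c w \<in> S) \<and> x = lin_comb c B" using assms(3)
  proof (induction rule: lin_span_induct)
    case zero
    have "lin_comb (\<lambda>w. \<zero>) B = vzero"
      unfolding lin_comb_def vzero_def by (intro HOL.ext add.finprod_one_eqI) (use assms(2) in auto)
    then show ?case by (intro exI[of _ "\<lambda>_. \<zero>"]) auto
  next
    case (step a v x)
    obtain c where c: "\<forall>w\<in>B. c w \<in> S" "x = lin_comb c B" using step.IH by blast
    have "lin_comb (\<lambda>w. (if w = v then a else \<zero>) \<oplus> c w) B = a \<cdot> v \<boxplus> x"
      using lin_comb_add[of B "\<lambda>w. if w = v then a else \<zero>" c] lin_comb_delta[of B v a] assms c step by auto
    then show ?case using c(1) step(1) by (intro exI[of _ "\<lambda>w. (if w = v then a else \<zero>) \<oplus> c w"]) auto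
  qed
  then show ?thesis using that by blast
qed

lemma is_free_basis_iff:
  "is_free_basis K S B A \<longleftrightarrow> finite B \<and> B \<subseteq> A \<and> lin_span K S B = A \<and>
    (\<forall>c. (\<forall>v\<in>B. c v \<in> S) \<and> lin_comb c B = vzero \<longrightarrow> (\<forall>v\<in>B. c v = \<zero>))"
  unfolding is_free_basis_def lin_comb_def vzero_def fun_eq_iff ..

lemma free_basis_submod:
  assumes "is_free_basis K S B A" "A \<subseteq> vecs" shows "submod S A"
proof -
  have "B \<subseteq> vecs" "A = lin_span K S B" using assms unfolding is_free_basis_iff by auto
  then show ?thesis using submod_lin_span[of B S] by auto
qed

lemma free_basis_not_divisible:
  assumes B: "is_free_basis K S B A" and A: "A \<subseteq> vecs" and v: "v \<in> B"
  shows "Pinv \<cdot> v \<notin> A"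
proof
  assume "Pinv \<cdot> v \<in> A"
  have fin: "finite B" and Bv: "B \<subseteq> vecs" and sp: "lin_span K S B = A"
    using B A unfolding is_free_basis_iff by auto
  obtain c where c: "\<And>w. w \<in> B \<Longrightarrow> c w \<in> S" "Pinv \<cdot> v = lin_comb c B"
    using lin_span_lin_comb[OF fin Bv] \<open>Pinv \<cdot> v \<in> A\<close> sp by metis
  define d where "d w = P \<otimes> c w \<oplus> (if w = v then h (- 1) else \<zero>)" for w
  have vv: "v \<in> vecs" by (rule subsetD[OF Bv v])
  have m1: "h (- 1) \<in> S" using h_int[of "- 1"] by simp
  have "lin_comb d B = P \<cdot> lin_comb c B \<boxplus> h (- 1) \<cdot> v"
    unfolding d_def using fin Bv c(1) v
    by (subst lin_comb_add) (auto simp: lin_comb_smult lin_comb_delta)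
  also have "\<dots> = v \<boxplus> h (- 1) \<cdot> v" using vv by (simp add: c(2)[symmetric])
  also have "\<dots> = vzero" by (rule vadd_neg[OF vv])
  finally have "lin_comb d B = vzero" .
  moreover have "\<forall>w\<in>B. d w \<in> S" using c(1) m1 by (auto simp: d_def)
  ultimately have "d v = \<zero>" using B v unfolding is_free_basis_iff by blast
  then have "P \<otimes> c v \<oplus> h (- 1) = \<zero>" by (simp add: d_def)
  moreover have "\<one> \<oplus> h (- 1) = \<zero>" using h_add[of 1 "- 1"] by (simp add: h_one h_zero)
  ultimately have "P \<otimes> c v = \<one>" using c(1)[OF v]
    by (metis S_carrier add.right_cancel h_closed m_closed one_closed)
  then have "Pinv \<otimes> (P \<otimes> c v) = Pinv" by simp
  then have "c v = Pinv" using c(1)[OF v] by simp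
  then show False using c(1)[OF v] Pinv_nonmem by simp
qed

text \<open>
  Unimodular modules of rank r: free modules that are equal to their dual, formed in the subspace
  which they span.
\<close>

definition unimodular :: "(('n \<Rightarrow> 'k) \<Rightarrow> ('n \<Rightarrow> 'k) \<Rightarrow> 'k) \<Rightarrow> nat \<Rightarrow> ('n \<Rightarrow> 'k) set \<Rightarrow> bool" where
  "unimodular \<beta> r A \<longleftrightarrow> (\<exists>B. is_free_basis K S B A \<and> card B = r) \<and>
     A = {w \<in> lin_span K (carrier K) A. \<forall>x\<in>A. \<beta> x w \<in> S}"

lemma unimodularD:
  assumes "unimodular \<beta> r A" "A \<subseteq> vecs"
  shows unimodular_submod: "submod S A" and unimodular_integral: "x \<in> A \<Longrightarrow> y \<in> A \<Longrightarrow> \<beta> x y \<in> S"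
    and unimodular_mem: "c \<in> carrier K \<Longrightarrow> y \<in> A \<Longrightarrow> (\<And>x. x \<in> A \<Longrightarrow> \<beta> x (c \<cdot> y) \<in> S) \<Longrightarrow> c \<cdot> y \<in> A"
proof -
  show A: "submod S A" using assms free_basis_submod unfolding unimodular_def by blast
  have eq: "A = {w \<in> lin_span K (carrier K) A. \<forall>x\<in>A. \<beta> x w \<in> S}" using assms(1) by (simp add: unimodular_def)
  show "x \<in> A \<Longrightarrow> y \<in> A \<Longrightarrow> \<beta> x y \<in> S" using eq by blast
  assume c: "c \<in> carrier K" "y \<in> A" "\<And>x. x \<in> A \<Longrightarrow> \<beta> x (c \<cdot> y) \<in> S"
  have "c \<cdot> y \<boxplus> vzero \<in> lin_span K (carrier K) A" by (rule lin_span_step[OF c(1,2) lin_span_zero])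
  then have "c \<cdot> y \<in> lin_span K (carrier K) A" using c assms(2) by auto
  then show "c \<cdot> y \<in> A" using eq c(3) by blast
qed

lemma unimodular_cong:
  assumes "\<And>x y. x \<in> vecs \<Longrightarrow> y \<in> vecs \<Longrightarrow> \<beta>' x y \<in> S \<longleftrightarrow> \<beta> x y \<in> S" "A \<subseteq> vecs"
  shows "unimodular \<beta>' r A \<longleftrightarrow> unimodular \<beta> r A"
proof -
  have "lin_span K (carrier K) A \<subseteq> vecs" by (rule lin_span_vecs[OF assms(2)]) simp
  then have "{w \<in> lin_span K (carrier K) A. \<forall>x\<in>A. \<beta>' x w \<in> S} =
      {w \<in> lin_span K (carrier K) A. \<forall>x\<in>A. \<beta> x w \<in> S}"
    using assms by blast
  then show ?thesis unfolding unimodular_def by simp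
qed

lemma unimodular_rank_zero:
  assumes "unimodular \<beta> 0 A" shows "A = {vzero}"
proof -
  obtain B where B: "is_free_basis K S B A" "card B = 0" using assms unfolding unimodular_def by blast
  then have "B = {}" "lin_span K S B = A" unfolding is_free_basis_iff by auto
  then have "A = lin_span K S {}" by simp
  also have "\<dots> \<subseteq> {vzero}" by (rule lin_span_least) (auto simp: submod_def)
  finally show ?thesis using \<open>A = lin_span K S {}\<close> lin_span_zero by blast
qed

lemma unimodular_rank_pos:
  assumes "unimodular \<beta> r A" "A \<subseteq> vecs" "r > 0"
  obtains v where "v \<in> A" "Pinv \<cdot> v \<notin> A"
proof -
  obtain B where B: "is_free_basis K S B A" "card B = r" using assms unfolding unimodular_def by blast
  then obtain v where "v \<in> B" using assms(3) by fastforce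
  then show ?thesis using that free_basis_not_divisible[OF B(1) assms(2)] B(1) unfolding is_free_basis_iff by blast
qed

lemma free_basis_image:
  assumes B: "is_free_basis K S B A" and A: "A \<subseteq> vecs"
    and g: "inj_on g A" "g ` A \<subseteq> vecs" "g vzero = vzero"
      "\<And>x y. x \<in> A \<Longrightarrow> y \<in> A \<Longrightarrow> g (x \<boxplus> y) = g x \<boxplus> g y"
      "\<And>c x. c \<in> S \<Longrightarrow> x \<in> A \<Longrightarrow> g (c \<cdot> x) = c \<cdot> g x"
  shows "is_free_basis K S (g ` B) (g ` A)"
proof -
  note sub = free_basis_submod[OF B A]
  have fin: "finite B" and BA: "B \<subseteq> A" and sp: "lin_span K S B = A"
    and ind: "\<And>c. \<forall>v\<in>B. c v \<in> S \<Longrightarrow> lin_comb c B = vzero \<Longrightarrow> \<forall>v\<in>B. c v = \<zero>"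
    using B unfolding is_free_basis_iff by auto
  have span: "lin_span K S (g ` B) = g ` A"
    using lin_span_image[of A g S B] g sub BA sp by auto
  have glc: "lin_comb c C \<in> A \<and> g (lin_comb c C) = lin_comb (\<lambda>w. c (inv_into A g w)) (g ` C)"
    if "finite C" "C \<subseteq> B" "\<forall>v\<in>C. c v \<in> S" for c C
    using that
  proof (induction C rule: finite_induct)
    case empty
    then show ?case using g(3) submodD(2)[OF sub] by (simp add: lin_comb_empty)
  next
    case (insert v C)
    have vA: "v \<in> A" "C \<subseteq> A" using insert BA by auto
    have gv: "g v \<notin> g ` C" using insert(2) vA g(1) by (metis inj_on_image_mem_iff)
    have inv: "inv_into A g (g w) = w" if "w \<in> A" for w using that g(1) by simp
    have IH: "lin_comb c C \<in> A" "g (lin_comb c C) = lin_comb (\<lambda>w. c (inv_into A g w)) (g ` C)" using insert by auto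
    have gvv: "g w \<in> vecs" if "w \<in> A" for w using that by (rule subsetD[OF g(2) imageI])
    have eq: "lin_comb c (insert v C) = c v \<cdot> v \<boxplus> lin_comb c C"
      using insert(1,2,5) vA A by (intro lin_comb_insert) auto
    have "c v \<cdot> v \<in> A" using insert(5) vA submodD(4)[OF sub] by simp
    moreover have "lin_comb (\<lambda>w. c (inv_into A g w)) (g ` insert v C) = c v \<cdot> g v \<boxplus> lin_comb (\<lambda>w. c (inv_into A g w)) (g ` C)"
    proof -
      have "lin_comb (\<lambda>w. c (inv_into A g w)) (insert (g v) (g ` C)) =
          c (inv_into A g (g v)) \<cdot> g v \<boxplus> lin_comb (\<lambda>w. c (inv_into A g w)) (g ` C)"
        using insert(1,5) gv vA gvv inv by (intro lin_comb_insert) (auto simp: subset_iff)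
      then show ?thesis using inv vA by simp
    qed
    moreover have "g (c v \<cdot> v \<boxplus> lin_comb c C) = c v \<cdot> g v \<boxplus> g (lin_comb c C)"
      using g(4)[OF \<open>c v \<cdot> v \<in> A\<close> IH(1)] g(5)[OF _ vA(1), of "c v"] insert(5) by simp
    ultimately show ?case unfolding eq using IH submodD(3)[OF sub] by simp
  qed
  have "\<forall>v\<in>g ` B. c v = \<zero>" if c: "\<forall>v\<in>g ` B. c v \<in> S" "lin_comb c (g ` B) = vzero" for c
  proof -
    have "lin_comb (\<lambda>w. (c \<circ> g) (inv_into A g w)) (g ` B) = lin_comb c (g ` B)"
      by (rule lin_comb_cong) (use g(1,2) BA c(1) in \<open>auto simp: subset_iff\<close>)
    then have "g (lin_comb (c \<circ> g) B) = g vzero" and "lin_comb (c \<circ> g) B \<in> A"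
      using glc[OF fin subset_refl, of "c \<circ> g"] c g(3) by auto
    then have "lin_comb (c \<circ> g) B = vzero" using g(1) submodD(2)[OF sub] by (auto dest: inj_onD)
    then show ?thesis using ind[of "c \<circ> g"] c(1) by auto
  qed
  then show ?thesis unfolding is_free_basis_iff using fin BA span by blast
qed

text \<open>
  Unimodularity is preserved by isometries. As g is defined on A only, a vector in the span of the
  image is multiplied by a power of p first.
\<close>

lemma unimodular_image:
  assumes A: "unimodular (frm b) r A" "A \<subseteq> vecs"
    and g: "inj_on g A" "g ` A \<subseteq> vecs" "g vzero = vzero"
      "\<And>x y. x \<in> A \<Longrightarrow> y \<in> A \<Longrightarrow> g (x \<boxplus> y) = g x \<boxplus> g y"
      "\<And>c x. c \<in> S \<Longrightarrow> x \<in> A \<Longrightarrow> g (c \<cdot> x) = c \<cdot> g x"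
    and form: "\<And>x y. x \<in> A \<Longrightarrow> y \<in> A \<Longrightarrow> frm b' (g x) (g y) = frm b x y"
  shows "unimodular (frm b') r (g ` A)"
proof -
  note sub = unimodular_submod[OF A]
  obtain B where B: "is_free_basis K S B A" "card B = r" using A unfolding unimodular_def by blast
  note B' = free_basis_image[OF B(1) A(2) g]
  have sub': "submod S (g ` A)" by (rule free_basis_submod[OF B' g(2)])
  have "inj_on g B" using g(1) B(1) unfolding is_free_basis_iff by (meson inj_on_subset)
  then have card: "card (g ` B) = r" using B(2) by (simp add: card_image)
  have "g ` A = {w \<in> lin_span K (carrier K) (g ` A). \<forall>x\<in>g ` A. frm b' x w \<in> S}" (is "_ = ?D")
  proof
    show "g ` A \<subseteq> ?D"
      using lin_span_base[OF g(2) one_closed] form unimodular_integral[OF A] by auto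
    show "?D \<subseteq> g ` A"
    proof clarify
      fix w assume w: "w \<in> lin_span K (carrier K) (g ` A)" "\<forall>x\<in>g ` A. frm b' x w \<in> S"
      have wv: "w \<in> vecs" using w(1) lin_span_vecs[OF g(2), of "carrier K"] by auto
      obtain k where k: "h (of_nat p ^ k) \<cdot> w \<in> g ` A" using span_denominator[OF sub' w(1)] .
      let ?q = "of_nat p ^ k :: rat"
      have q0: "?q \<noteq> 0" using p_pos by simp
      have qS: "h ?q \<in> S" using h_nat[of "p ^ k"] by simp
      obtain u where u: "u \<in> A" "h ?q \<cdot> w = g u" using k by blast
      have uv: "u \<in> vecs" using u(1) A(2) by blast
      have "frm b x (h (1 / ?q) \<cdot> u) \<in> S" if x: "x \<in> A" for x
      proof -
        have xv: "x \<in> vecs" "g x \<in> vecs" using x A(2) g(2) by auto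
        have "frm b x (h (1 / ?q) \<cdot> u) = h (1 / ?q) \<otimes> frm b' (g x) (h ?q \<cdot> w)"
          using xv uv by (simp add: frm_smult_right u(2) form[OF x u(1)])
        also have "\<dots> = frm b' (g x) (h (1 / ?q) \<cdot> h ?q \<cdot> w)" using xv wv by (simp only: frm_smult_right vsmult_vecs h_closed)
        also have "\<dots> = frm b' (g x) w" using h_cancel[OF q0 wv] by simp
        finally show ?thesis using w(2) x by auto
      qed
      then have m: "h (1 / ?q) \<cdot> u \<in> A" by (intro unimodular_mem[OF A _ u(1)]) auto
      have "h ?q \<cdot> g (h (1 / ?q) \<cdot> u) = g u"
        using g(5)[OF qS m] h_cancel[OF q0 uv] by simp
      then have "h (1 / ?q) \<cdot> h ?q \<cdot> g (h (1 / ?q) \<cdot> u) = h (1 / ?q) \<cdot> h ?q \<cdot> w" using u(2) by simp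
      moreover have "g (h (1 / ?q) \<cdot> u) \<in> vecs" using m g(2) by blast
      ultimately have "g (h (1 / ?q) \<cdot> u) = w" using h_cancel(1)[OF q0] wv by metis
      then show "w \<in> g ` A" using m by blast
    qed
  qed
  then show ?thesis unfolding unimodular_def using B' card by blast
qed

subsection \<open>Jordan decompositions\<close>

text \<open>
  A Jordan decomposition with components A0, unimodular of rank r0, and A1, which is p times
  unimodular of rank r1.
\<close>

definition jordan :: "(rat ^ 'n::finite) set \<Rightarrow> (rat ^ 'n \<Rightarrow> rat ^ 'n \<Rightarrow> rat) \<Rightarrow> nat \<Rightarrow> nat \<Rightarrow>
    ('n \<Rightarrow> 'k) set \<Rightarrow> ('n \<Rightarrow> 'k) set \<Rightarrow> bool" where
  "jordan L b r0 r1 A0 A1 \<longleftrightarrow> A0 \<subseteq> ext_of L \<and> A1 \<subseteq> ext_of L \<and>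
     ext_of L = {x \<boxplus> y | x y. x \<in> A0 \<and> y \<in> A1} \<and> A0 \<inter> A1 = {vzero} \<and>
     (\<forall>x\<in>A0. \<forall>y\<in>A1. frm b x y = \<zero>) \<and>
     unimodular (frm b) r0 A0 \<and> unimodular (frm (\<lambda>x y. 1 / of_nat p * b x y)) r1 A1"

lemma frm_p_inverse: "frm (\<lambda>x y. 1 / of_nat p * (of_nat p * b x y)) = frm b"
  using p_pos by simp_all

lemma jordanD:
  assumes "jordan L b r0 r1 A0 A1"
  shows "A0 \<subseteq> vecs" "A1 \<subseteq> vecs" "submod S A0" "submod S A1"
    "x \<in> ext_of L \<Longrightarrow> \<exists>a0\<in>A0. \<exists>a1\<in>A1. x = a0 \<boxplus> a1" "a0 \<in> A0 \<Longrightarrow> a1 \<in> A1 \<Longrightarrow> a0 \<boxplus> a1 \<in> ext_of L"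
    "a0 \<in> A0 \<Longrightarrow> a0 \<in> ext_of L" "a1 \<in> A1 \<Longrightarrow> a1 \<in> ext_of L"
    "a0 \<in> A0 \<Longrightarrow> a1 \<in> A1 \<Longrightarrow> frm b a0 a1 = \<zero>"
    "x \<in> A0 \<Longrightarrow> y \<in> A0 \<Longrightarrow> frm b x y \<in> S" "x \<in> A1 \<Longrightarrow> y \<in> A1 \<Longrightarrow> Pinv \<otimes> frm b x y \<in> S"
    "y \<in> A0 \<Longrightarrow> c \<in> carrier K \<Longrightarrow> (\<And>x. x \<in> A0 \<Longrightarrow> frm b x (c \<cdot> y) \<in> S) \<Longrightarrow> c \<cdot> y \<in> A0"
    "y \<in> A1 \<Longrightarrow> c \<in> carrier K \<Longrightarrow> (\<And>x. x \<in> A1 \<Longrightarrow> Pinv \<otimes> frm b x (c \<cdot> y) \<in> S) \<Longrightarrow> c \<cdot> y \<in> A1"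
    "A0 \<inter> A1 = {vzero}"
proof -
  show A: "A0 \<subseteq> vecs" "A1 \<subseteq> vecs" using assms ext_vecs unfolding jordan_def by blast+
  have u: "unimodular (frm b) r0 A0" "unimodular (frm (\<lambda>x y. 1 / of_nat p * b x y)) r1 A1"
    using assms by (simp_all add: jordan_def)
  show "submod S A0" "submod S A1" by (rule unimodular_submod[OF u(1) A(1)], rule unimodular_submod[OF u(2) A(2)])
  show "x \<in> ext_of L \<Longrightarrow> \<exists>a0\<in>A0. \<exists>a1\<in>A1. x = a0 \<boxplus> a1" "a0 \<in> A0 \<Longrightarrow> a1 \<in> A1 \<Longrightarrow> a0 \<boxplus> a1 \<in> ext_of L"
    "a0 \<in> A0 \<Longrightarrow> a0 \<in> ext_of L" "a1 \<in> A1 \<Longrightarrow> a1 \<in> ext_of L"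
    "a0 \<in> A0 \<Longrightarrow> a1 \<in> A1 \<Longrightarrow> frm b a0 a1 = \<zero>" "A0 \<inter> A1 = {vzero}"
    using assms unfolding jordan_def by blast+
  show "x \<in> A0 \<Longrightarrow> y \<in> A0 \<Longrightarrow> frm b x y \<in> S" by (rule unimodular_integral[OF u(1) A(1)])
  have sc: "frm (\<lambda>x y. 1 / of_nat p * b x y) x y = Pinv \<otimes> frm b x y" if "x \<in> vecs" "y \<in> vecs" for x y
    by (rule frm_scaled[OF that])
  show "x \<in> A1 \<Longrightarrow> y \<in> A1 \<Longrightarrow> Pinv \<otimes> frm b x y \<in> S"
    using unimodular_integral[OF u(2) A(2), of x y] sc[of x y] A(2) by (metis subsetD)
  show "y \<in> A0 \<Longrightarrow> c \<in> carrier K \<Longrightarrow> (\<And>x. x \<in> A0 \<Longrightarrow> frm b x (c \<cdot> y) \<in> S) \<Longrightarrow> c \<cdot> y \<in> A0"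
    by (rule unimodular_mem[OF u(1) A(1)])
  show "y \<in> A1 \<Longrightarrow> c \<in> carrier K \<Longrightarrow> (\<And>x. x \<in> A1 \<Longrightarrow> Pinv \<otimes> frm b x (c \<cdot> y) \<in> S) \<Longrightarrow> c \<cdot> y \<in> A1"
    using unimodular_mem[OF u(2) A(2), of c y] sc A(2) by (metis subsetD vsmult_vecs)
qed

lemma jordan_isometric:
  assumes J: "jordan L b r0 r1 A0 A1" and f: "isometry L b M b' f"
  shows "jordan M b' r0 r1 (f ` A0) (f ` A1)"
proof -
  have A: "A0 \<subseteq> ext_of L" "A1 \<subseteq> ext_of L" using J unfolding jordan_def by blast+
  note D = jordanD[OF J]
  have mem: "x \<in> ext_of L" if "x \<in> A0 \<or> x \<in> A1" for x using that A by blast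
  have fv: "f x \<in> vecs" if "x \<in> ext_of L" for x using isometryD(7)[OF f that] by blast
  have form: "frm (\<lambda>x y. 1 / of_nat p * b' x y) (f x) (f y) = frm (\<lambda>x y. 1 / of_nat p * b x y) x y"
    if "x \<in> ext_of L" "y \<in> ext_of L" for x y
    using isometryD(6)[OF f that] fv that ext_vecs[OF that(1)] ext_vecs[OF that(2)] by (simp only: frm_scaled)
  have u0: "unimodular (frm b') r0 (f ` A0)"
  proof (rule unimodular_image)
    show "unimodular (frm b) r0 A0" using J by (simp add: jordan_def)
    show "inj_on f A0" using isometryD(2)[OF f] A(1) by (rule inj_on_subset)
  qed (use mem fv isometryD(4-6)[OF f] isometry_zero[OF f] D(1) in auto)
  have u1: "unimodular (frm (\<lambda>x y. 1 / of_nat p * b' x y)) r1 (f ` A1)"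
  proof (rule unimodular_image)
    show "unimodular (frm (\<lambda>x y. 1 / of_nat p * b x y)) r1 A1" using J by (simp add: jordan_def)
    show "inj_on f A1" using isometryD(2)[OF f] A(2) by (rule inj_on_subset)
  qed (use mem fv isometryD(4-6)[OF f] isometry_zero[OF f] form D(2) in auto)
  have "ext_of M = {x \<boxplus> y | x y. x \<in> f ` A0 \<and> y \<in> f ` A1}"
  proof -
    have add: "f (x \<boxplus> y) = f x \<boxplus> f y" if "x \<in> A0" "y \<in> A1" for x y
      using isometryD(4)[OF f] mem that by simp
    have "ext_of M = f ` {x \<boxplus> y | x y. x \<in> A0 \<and> y \<in> A1}" using J isometryD(3)[OF f] by (simp add: jordan_def)
    also have "\<dots> = {f (x \<boxplus> y) | x y. x \<in> A0 \<and> y \<in> A1}" by blast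
    also have "\<dots> = {f x \<boxplus> f y | x y. x \<in> A0 \<and> y \<in> A1}"
      by (rule Collect_cong) (metis add)
    also have "\<dots> = {x \<boxplus> y | x y. x \<in> f ` A0 \<and> y \<in> f ` A1}" by blast
    finally show ?thesis .
  qed
  moreover have "f ` A0 \<inter> f ` A1 = {vzero}"
  proof -
    have "f ` A0 \<inter> f ` A1 = f ` (A0 \<inter> A1)" by (rule inj_on_image_Int[OF isometryD(2)[OF f] A, symmetric])
    then show ?thesis using J isometry_zero[OF f] by (simp add: jordan_def)
  qed
  moreover have "\<forall>x\<in>f ` A0. \<forall>y\<in>f ` A1. frm b' x y = \<zero>"
    using isometryD(6)[OF f] mem D(9) by simp
  moreover have "f ` A0 \<subseteq> ext_of M" "f ` A1 \<subseteq> ext_of M" using image_mono[OF A(1), of f] image_mono[OF A(2), of f] isometryD(3)[OF f] by simp_all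
  ultimately show ?thesis unfolding jordan_def using u0 u1 by blast
qed

lemma jordan_partial_dual_other:
  assumes J: "jordan L b r0 r1 A0 A1" and L: "is_lattice (L, b)" "integral_lattice (L, b)"
    and q: "prime q" "q \<noteq> p"
  shows "jordan (pdual q L b) (\<lambda>x y. of_nat q * b x y) r0 r1 A0 A1"
proof -
  have q0: "q > 0" "(of_nat q :: rat) \<noteq> 0" using q(1) prime_gt_0_nat by auto
  have "padic_abs p (1 / of_nat q) \<le> 1" by (rule padic_abs_inverse_other[OF p q])
  then have inv: "h (1 / of_nat q) \<in> S" by (simp add: h_mem_iff)
  have unit: "h (of_nat q) \<otimes> c \<in> S \<longleftrightarrow> c \<in> S" if c: "c \<in> carrier K" for c
  proof
    assume "h (of_nat q) \<otimes> c \<in> S"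
    then have "h (1 / of_nat q) \<otimes> (h (of_nat q) \<otimes> c) \<in> S" using inv by blast
    moreover have "h (1 / of_nat q) \<otimes> (h (of_nat q) \<otimes> c) = c"
      using c q0 h_mult[of "1 / of_nat q" "of_nat q", symmetric] by (simp add: m_assoc[symmetric] h_one)
    ultimately show "c \<in> S" by simp
  qed auto
  have u: "unimodular (frm (\<lambda>x y. of_nat q * b' x y)) r A \<longleftrightarrow> unimodular (frm b') r A" if "A \<subseteq> vecs" for b' r A
    by (rule unimodular_cong[OF _ that]) (simp add: frm_scaled unit)
  have eq: "frm (\<lambda>x y. 1 / of_nat p * (of_nat q * b x y)) = frm (\<lambda>x y. of_nat q * (1 / of_nat p * b x y))"
    by (simp add: mult.commute)
  have "unimodular (frm (\<lambda>x y. 1 / of_nat p * (of_nat q * b x y))) r1 A1"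
    unfolding eq u[OF jordanD(2)[OF J], of "\<lambda>x y. 1 / of_nat p * b x y"]
    using J unfolding jordan_def by blast
  moreover have "unimodular (frm (\<lambda>x y. of_nat q * b x y)) r0 A0"
    using J u[OF jordanD(1)[OF J], of b] unfolding jordan_def by blast
  moreover have "frm (\<lambda>x y. of_nat q * b x y) x y = \<zero>" if xy: "x \<in> A0" "y \<in> A1" for x y
  proof -
    have "x \<in> vecs" "y \<in> vecs" using xy jordanD(1,2)[OF J] by auto
    then show ?thesis using jordanD(9)[OF J xy] by (simp add: frm_scaled)
  qed
  ultimately show ?thesis
    using J unfolding jordan_def ext_pdual_unit[OF L q0(1) inv] by blast
qed

lemma frm_jordan:
  assumes J: "jordan L b r0 r1 A0 A1" and b: "symmetric_bilinear b"
    and "a0 \<in> A0" "a1 \<in> A1" "c0 \<in> A0" "c1 \<in> A1"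
  shows "frm b (a0 \<boxplus> a1) (c0 \<boxplus> c1) = frm b a0 c0 \<oplus> frm b a1 c1"
proof -
  have v: "a0 \<in> vecs" "a1 \<in> vecs" "c0 \<in> vecs" "c1 \<in> vecs" using jordanD(1,2)[OF J] assms by auto
  have "frm b a1 c0 = \<zero>" using jordanD(9)[OF J assms(5,4)] frm_sym[OF b v(2,3)] by simp
  then show ?thesis using v jordanD(9)[OF J assms(3,6)] by (simp add: frm_add_left frm_add_right)
qed

text \<open>
  The partial dual at p exchanges the components: A0 becomes p times unimodular because the form
  is multiplied by p, and A1 is replaced by (1/p) A1, on which the new form is isometric to 1/p
  times the old form on A1.
\<close>

lemma jordan_partial_dual:
  assumes J: "jordan L b r0 r1 A0 A1" and L: "is_lattice (L, b)" "integral_lattice (L, b)"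
  shows "jordan (pdual p L b) (\<lambda>x y. of_nat p * b x y) r1 r0 ((\<lambda>x. Pinv \<cdot> x) ` A1) A0"
proof -
  have b: "symmetric_bilinear b" using L(1) by (simp add: is_lattice_def)
  note D = jordanD[OF J]
  have v: "x \<in> vecs" if "x \<in> A0 \<or> x \<in> A1" for x using that D(1,2) by blast
  have z: "vzero \<in> A0" "vzero \<in> A1" using submodD(2) D(3,4) by blast+
  have e: "ext_of (pdual p L b) = {x \<boxplus> y | x y. x \<in> (\<lambda>x. Pinv \<cdot> x) ` A1 \<and> y \<in> A0}" (is "_ = ?E")
  proof
    show "ext_of (pdual p L b) \<subseteq> ?E"
    proof
      fix x assume "x \<in> ext_of (pdual p L b)"
      then have x: "x \<in> vecs" "P \<cdot> x \<in> ext_of L" "\<And>y. y \<in> ext_of L \<Longrightarrow> frm b y x \<in> S" unfolding ext_pdual[OF L] by auto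
      obtain a0 a1 where a: "a0 \<in> A0" "a1 \<in> A1" "P \<cdot> x = a0 \<boxplus> a1" using D(5)[OF x(2)] by blast
      have "x = Pinv \<cdot> (P \<cdot> x)" using x(1) by simp
      also have "\<dots> = Pinv \<cdot> a0 \<boxplus> Pinv \<cdot> a1" unfolding a(3) using a v by (simp add: vsmult_vadd)
      finally have xeq: "x = Pinv \<cdot> a0 \<boxplus> Pinv \<cdot> a1" .
      have "Pinv \<cdot> a0 \<in> A0"
      proof (rule D(12)[OF a(1)])
        fix y assume y: "y \<in> A0"
        have "frm b y x = frm b y (Pinv \<cdot> a0)"
          unfolding xeq using y a v D(9)[OF y a(2)] by (simp add: frm_add_right frm_smult_right)
        then show "frm b y (Pinv \<cdot> a0) \<in> S" using x(3)[OF D(7)[OF y]] by simp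
      qed simp
      moreover have "x = Pinv \<cdot> a1 \<boxplus> Pinv \<cdot> a0" unfolding xeq using a v by (simp add: vadd_comm)
      ultimately show "x \<in> ?E" using a(2) by blast
    qed
    show "?E \<subseteq> ext_of (pdual p L b)"
    proof clarify
      fix x y assume xy: "x \<in> A1" "y \<in> A0"
      have "P \<cdot> (Pinv \<cdot> x \<boxplus> y) = P \<cdot> y \<boxplus> x" using xy v by (simp add: vsmult_vadd vadd_comm)
      moreover have "P \<cdot> y \<boxplus> x \<in> ext_of L" using xy D(6) submodD(4)[OF D(3)] by simp
      moreover have "frm b u (Pinv \<cdot> x \<boxplus> y) \<in> S" if u: "u \<in> ext_of L" for u
      proof -
        obtain a0 a1 where a: "a0 \<in> A0" "a1 \<in> A1" "u = a0 \<boxplus> a1" using D(5)[OF u] by blast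
        have uv: "u \<in> vecs" using u by blast
        have "frm b u x = frm b a1 x" "frm b u y = frm b a0 y"
          using frm_jordan[OF J b a(1,2) z(1) xy(1)] frm_jordan[OF J b a(1,2) xy(2) z(2)] a xy v by simp_all
        then have "frm b u (Pinv \<cdot> x \<boxplus> y) = Pinv \<otimes> frm b a1 x \<oplus> frm b a0 y"
          using uv xy v by (simp add: frm_add_right frm_smult_right)
        then show ?thesis using D(10)[OF a(1) xy(2)] D(11)[OF a(2) xy(1)] by simp
      qed
      ultimately show "Pinv \<cdot> x \<boxplus> y \<in> ext_of (pdual p L b)" unfolding ext_pdual[OF L] using xy v by auto
    qed
  qed
  have sub: "(\<lambda>x. Pinv \<cdot> x) ` A1 \<subseteq> ext_of (pdual p L b)" "A0 \<subseteq> ext_of (pdual p L b)"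
  proof -
    show "(\<lambda>x. Pinv \<cdot> x) ` A1 \<subseteq> ext_of (pdual p L b)"
    proof clarify
      fix x assume "x \<in> A1"
      then have "Pinv \<cdot> x \<boxplus> vzero \<in> ?E" using z(1) by blast
      then show "Pinv \<cdot> x \<in> ext_of (pdual p L b)" unfolding e using \<open>x \<in> A1\<close> v by simp
    qed
    show "A0 \<subseteq> ext_of (pdual p L b)"
    proof
      fix y assume "y \<in> A0"
      then have "Pinv \<cdot> vzero \<boxplus> y \<in> ?E" using z(2) by blast
      then show "y \<in> ext_of (pdual p L b)" unfolding e using \<open>y \<in> A0\<close> v by simp
    qed
  qed
  have int: "(\<lambda>x. Pinv \<cdot> x) ` A1 \<inter> A0 = {vzero}"
  proof
    show "(\<lambda>x. Pinv \<cdot> x) ` A1 \<inter> A0 \<subseteq> {vzero}"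
    proof clarify
      fix x assume x: "x \<in> A1" "Pinv \<cdot> x \<in> A0"
      then have "P \<cdot> Pinv \<cdot> x \<in> A0" by (intro submodD(4)[OF D(3) h_nat])
      then have "x \<in> A0 \<inter> A1" using x v by simp
      then show "Pinv \<cdot> x = vzero" using D(14) by simp
    qed
    have "Pinv \<cdot> vzero \<in> (\<lambda>x. Pinv \<cdot> x) ` A1" using z(2) by (rule imageI)
    then show "{vzero} \<subseteq> (\<lambda>x. Pinv \<cdot> x) ` A1 \<inter> A0" using z(1) by simp
  qed
  have u1: "unimodular (frm (\<lambda>x y. of_nat p * b x y)) r1 ((\<lambda>x. Pinv \<cdot> x) ` A1)"
  proof (rule unimodular_image)
    show "unimodular (frm (\<lambda>x y. 1 / of_nat p * b x y)) r1 A1" using J by (simp add: jordan_def)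
    show "inj_on (\<lambda>x. Pinv \<cdot> x) A1"
    proof (rule inj_onI)
      fix x y assume xy: "x \<in> A1" "y \<in> A1" "Pinv \<cdot> x = Pinv \<cdot> y"
      have xv: "x \<in> vecs" "y \<in> vecs" using xy v by simp_all
      have "x = P \<cdot> Pinv \<cdot> x" using xv by simp
      also have "\<dots> = P \<cdot> Pinv \<cdot> y" by (simp only: xy(3))
      also have "\<dots> = y" using xv by simp
      finally show "x = y" .
    qed
    fix x y assume "x \<in> A1" "y \<in> A1"
    then have xy: "x \<in> vecs" "y \<in> vecs" using v by blast+
    have "frm (\<lambda>x y. of_nat p * b x y) (Pinv \<cdot> x) (Pinv \<cdot> y) = P \<otimes> frm b (Pinv \<cdot> x) (Pinv \<cdot> y)"
      using xy by (intro frm_scaled) auto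
    also have "\<dots> = Pinv \<otimes> frm b x y" using xy by (simp add: frm_smult_left frm_smult_right)
    finally show "frm (\<lambda>x y. of_nat p * b x y) (Pinv \<cdot> x) (Pinv \<cdot> y) = frm (\<lambda>x y. 1 / of_nat p * b x y) x y"
      unfolding frm_scaled[OF xy, of "1 / of_nat p"] .
  qed (use v in \<open>auto simp: vsmult_vadd vsmult_comm\<close>)
  have u0: "unimodular (frm (\<lambda>x y. 1 / of_nat p * (of_nat p * b x y))) r0 A0"
    unfolding frm_p_inverse using J by (simp add: jordan_def)
  have orth: "\<forall>x\<in>(\<lambda>x. Pinv \<cdot> x) ` A1. \<forall>y\<in>A0. frm (\<lambda>x y. of_nat p * b x y) x y = \<zero>"
  proof clarify
    fix x y assume xy: "x \<in> A1" "y \<in> A0"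
    then have "frm b x y = \<zero>" using D(9)[OF xy(2,1)] frm_sym[OF b, of x y] v by simp
    then show "frm (\<lambda>x y. of_nat p * b x y) (Pinv \<cdot> x) y = \<zero>"
      using xy v by (simp add: frm_scaled frm_smult_left)
  qed
  show ?thesis unfolding jordan_def using e sub int u1 u0 orth by blast
qed

text \<open>
  The partial dual at p, taken twice, gives back the lattice, scaled by 1/p. One inclusion holds
  for every integral lattice; the other one is proved at p only, which suffices as p^2 times a
  vector of the left hand side lies in L.
\<close>

lemma pdual_pdual:
  assumes J: "jordan L b r0 r1 A0 A1" and L: "is_lattice (L, b)" "integral_lattice (L, b)"
  shows "pdual p (pdual p L b) (\<lambda>x y. of_nat p * b x y) = (\<lambda>x. (1 / of_nat p) *s x) ` L" (is "?D = _")
proof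
  have F: "full_rank_lattice L" using L by (simp add: is_lattice_def)
  show "(\<lambda>x. (1 / of_nat p) *s x) ` L \<subseteq> ?D" by (rule pdual_pdual_supset[OF L p_pos(1)])
  note D = jordanD[OF J]
  have L': "is_lattice (pdual p L b, \<lambda>x y. of_nat p * b x y)" "integral_lattice (pdual p L b, \<lambda>x y. of_nat p * b x y)"
    using is_lattice_partial_dual[OF L p_pos(1)] integral_partial_dual[OF L p_pos(1)] partial_dual_eq[OF p_pos(1)] by metis+
  have J': "jordan ?D (\<lambda>x y. of_nat p * (of_nat p * b x y)) r0 r1 ((\<lambda>x. Pinv \<cdot> x) ` A0) ((\<lambda>x. Pinv \<cdot> x) ` A1)"
    by (rule jordan_partial_dual[OF jordan_partial_dual[OF J L] L'])
  show "?D \<subseteq> (\<lambda>x. (1 / of_nat p) *s x) ` L"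
  proof
    fix u assume u: "u \<in> ?D"
    obtain a0 a1 where a: "a0 \<in> A0" "a1 \<in> A1" "emb u = Pinv \<cdot> a0 \<boxplus> Pinv \<cdot> a1"
      using jordanD(5)[OF J' ext_base[OF u]] by blast
    have "emb (of_nat p *s u) = P \<cdot> (Pinv \<cdot> a0 \<boxplus> Pinv \<cdot> a1)" unfolding emb_scale a(3) ..
    also have "\<dots> = a0 \<boxplus> a1" using a D(1,2) by (simp add: vsmult_vadd subset_iff)
    finally have "emb (of_nat p *s u) \<in> ext_of L" using D(6)[OF a(1,2)] by simp
    moreover have "of_nat (p ^ 1) *s (of_nat p *s u) \<in> L" using u by (simp add: pdual_def)
    ultimately have "of_nat p *s u \<in> L" by (rule rational_point_mem[OF F])
    then show "u \<in> (\<lambda>x. (1 / of_nat p) *s x) ` L"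
      using p_pos by (intro image_eqI[of _ _ "of_nat p *s u"]) auto
  qed
qed

text \<open>
  The second component of a Jordan decomposition is nonzero if and only if the lattice has a
  vector that is not divisible by p, but is orthogonal to the lattice modulo p.
\<close>

lemma jordan_rank1_pos_iff:
  assumes J: "jordan L b r0 r1 A0 A1" and L: "is_lattice (L, b)" "integral_lattice (L, b)"
  shows "r1 > 0 \<longleftrightarrow> (\<exists>x\<in>L. (1 / of_nat p) *s x \<notin> L \<and> (\<forall>y\<in>L. b y x / of_nat p \<in> \<int>))"
proof
  have b: "symmetric_bilinear b" and F: "full_rank_lattice L" using L by (simp_all add: is_lattice_def)
  note D = jordanD[OF J]
  have z: "vzero \<in> A0" "vzero \<in> A1" using submodD(2) D(3,4) by blast+
  {
    assume "r1 > 0"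
    then obtain x where x: "x \<in> A1" "Pinv \<cdot> x \<notin> A1"
      using unimodular_rank_pos[of _ r1 A1] J D(2) unfolding jordan_def by metis
    have xv: "x \<in> vecs" using x D(2) by blast
    have nd: "Pinv \<cdot> x \<notin> ext_of L"
    proof
      assume "Pinv \<cdot> x \<in> ext_of L"
      then obtain a0 a1 where a: "a0 \<in> A0" "a1 \<in> A1" "Pinv \<cdot> x = a0 \<boxplus> a1" using D(5) by blast
      have av: "a0 \<in> vecs" "a1 \<in> vecs" using a D(1,2) by auto
      have "x = P \<cdot> (Pinv \<cdot> x)" using xv by simp
      then have xeq: "x = P \<cdot> a0 \<boxplus> P \<cdot> a1" unfolding a(3) using av by (simp add: vsmult_vadd)
      have "h (- 1) \<in> S" using h_int[of "- 1"] by simp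
      then have m: "x \<boxplus> h (- 1) \<cdot> P \<cdot> a1 \<in> A1" using x a submodD(3,4)[OF D(4)] h_nat by simp
      have "x \<boxplus> h (- 1) \<cdot> P \<cdot> a1 = P \<cdot> a0 \<boxplus> (P \<cdot> a1 \<boxplus> h (- 1) \<cdot> P \<cdot> a1)"
        unfolding xeq using av by (simp add: vadd_assoc)
      also have "\<dots> = P \<cdot> a0" using av by (simp add: vadd_neg)
      finally have "P \<cdot> a0 \<in> A0 \<inter> A1" using m submodD(4)[OF D(3) h_nat a(1)] by simp
      then have "P \<cdot> a0 = vzero" using D(14) by simp
      then have "Pinv \<cdot> P \<cdot> a0 = vzero" by simp
      then have "a0 = vzero" using av by simp
      then have "Pinv \<cdot> x = a1" using a(3) av by simp
      then show False using x(2) a(2) by simp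
    qed
    obtain v y where v: "v \<in> L" "y \<in> ext_of L" "x = emb v \<boxplus> P \<cdot> y" using approximate_vector[OF F D(8)[OF x(1)]] .
    have yv: "y \<in> vecs" using v(2) by blast
    have "(1 / of_nat p) *s v \<notin> L"
    proof
      assume "(1 / of_nat p) *s v \<in> L"
      then have "Pinv \<cdot> emb v \<in> ext_of L" using ext_base emb_scale by metis
      then have "Pinv \<cdot> emb v \<boxplus> y \<in> ext_of L" using v(2) by (rule ext_add)
      then show False using nd yv unfolding v(3) by (simp add: vsmult_vadd)
    qed
    moreover have "b u v / of_nat p \<in> \<int>" if u: "u \<in> L" for u
    proof -
      obtain a0 a1 where a: "a0 \<in> A0" "a1 \<in> A1" "emb u = a0 \<boxplus> a1" using D(5)[OF ext_base[OF u]] by blast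
      have "frm b (emb u) (vzero \<boxplus> x) = frm b a0 vzero \<oplus> frm b a1 x"
        unfolding a(3) by (rule frm_jordan[OF J b a(1,2) z(1) x(1)])
      then have "Pinv \<otimes> frm b (emb u) x \<in> S" using D(11)[OF a(2) x(1)] xv a D(1,2) by (auto simp: subset_iff)
      moreover have "frm b (emb u) y \<in> S" by (rule frm_ext_integral[OF b L(2) ext_base[OF u] v(2)])
      moreover have "Pinv \<otimes> frm b (emb u) (emb v) = Pinv \<otimes> frm b (emb u) x \<oplus> h (- 1) \<otimes> frm b (emb u) y"
      proof -
        have "emb v = x \<boxplus> h (- 1) \<cdot> P \<cdot> y" unfolding v(3) using yv by (simp add: vadd_assoc vadd_neg)
        moreover have "Pinv \<otimes> (h (- 1) \<otimes> (P \<otimes> frm b (emb u) y)) = h (- 1) \<otimes> frm b (emb u) y"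
          using yv by (simp add: m_lcomm[of Pinv])
        ultimately show ?thesis using xv yv by (simp add: frm_add_right frm_smult_right r_distr)
      qed
      moreover have "h (- 1) \<in> S" using h_int[of "- 1"] by simp
      ultimately have "h (b u v / of_nat p ^ 1) \<in> S"
        using h_mult[of "1 / of_nat p" "b u v"] by (simp add: frm_emb[OF b])
      moreover have "b u v \<in> \<int>" using L(2) u v(1) by (simp add: integral_lattice_def)
      ultimately show ?thesis using integer_div_mem[of "b u v" 1] by simp
    qed
    ultimately show "\<exists>x\<in>L. (1 / of_nat p) *s x \<notin> L \<and> (\<forall>y\<in>L. b y x / of_nat p \<in> \<int>)" using v(1) by blast
  }
  assume "\<exists>x\<in>L. (1 / of_nat p) *s x \<notin> L \<and> (\<forall>y\<in>L. b y x / of_nat p \<in> \<int>)"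
  then obtain x where x: "x \<in> L" "(1 / of_nat p) *s x \<notin> L" "\<And>y. y \<in> L \<Longrightarrow> b y x / of_nat p \<in> \<int>" by blast
  show "r1 > 0"
  proof (rule ccontr)
    assume "\<not> r1 > 0"
    then have "A1 = {vzero}" using unimodular_rank_zero J unfolding jordan_def by blast
    then have A0: "ext_of L = A0" using D(5,7) D(1) by (auto simp: subset_iff)
    let ?x = "(1 / of_nat p) *s x"
    have "Pinv \<cdot> emb x \<in> A0"
    proof (rule D(12))
      show "emb x \<in> A0" using ext_base[OF x(1)] A0 by simp
      fix y assume "y \<in> A0"
      then have y: "y \<in> ext_of L" using A0 by simp
      have "frm b y (emb ?x) \<in> S"
      proof (rule frm_ext_mem[OF b _ _ _ _ _ y])
        show "emb ?x \<in> ext_of {?x}" by (rule ext_base) simp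
      qed (use x(3) in \<open>auto simp: sb_scale_right[OF b] intro!: h_Ints\<close>)
      then show "frm b y (Pinv \<cdot> emb x) \<in> S" by (simp only: emb_scale)
    qed simp
    then have "emb ?x \<in> ext_of L" using A0 by (simp add: emb_scale)
    moreover have "of_nat (p ^ 1) *s ?x \<in> L" using x(1) p_pos by simp
    ultimately have "?x \<in> L" by (rule rational_point_mem[OF F])
    then show False using x(2) by simp
  qed
qed

text \<open>
  The first component of a Jordan decomposition is zero if and only if the form on the lattice is
  divisible by p.
\<close>

lemma jordan_rank0_zero_iff:
  assumes J: "jordan L b r0 r1 A0 A1" and L: "is_lattice (L, b)" "integral_lattice (L, b)"
  shows "r0 = 0 \<longleftrightarrow> (\<forall>x\<in>L. \<forall>y\<in>L. b x y / of_nat p \<in> \<int>)"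
proof
  have b: "symmetric_bilinear b" and F: "full_rank_lattice L" using L by (simp_all add: is_lattice_def)
  note D = jordanD[OF J]
  {
    assume "r0 = 0"
    then have "A0 = {vzero}" using unimodular_rank_zero J unfolding jordan_def by blast
    then have A1: "ext_of L = A1" using D(5,8) D(2) by (auto simp: subset_iff)
    show "\<forall>x\<in>L. \<forall>y\<in>L. b x y / of_nat p \<in> \<int>"
    proof (intro ballI)
      fix x y assume xy: "x \<in> L" "y \<in> L"
      have "Pinv \<otimes> frm b (emb x) (emb y) \<in> S" using D(11) A1 ext_base xy by blast
      then have "h (b x y / of_nat p ^ 1) \<in> S"
        using h_mult[of "1 / of_nat p" "b x y"] by (simp add: frm_emb[OF b])
      moreover have "b x y \<in> \<int>" using L(2) xy by (simp add: integral_lattice_def)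
      ultimately show "b x y / of_nat p \<in> \<int>" using integer_div_mem[of "b x y" 1] by simp
    qed
  }
  assume div: "\<forall>x\<in>L. \<forall>y\<in>L. b x y / of_nat p \<in> \<int>"
  show "r0 = 0"
  proof (rule ccontr)
    assume "r0 \<noteq> 0"
    then obtain x where x: "x \<in> A0" "Pinv \<cdot> x \<notin> A0"
      using unimodular_rank_pos[of _ r0 A0] J D(1) unfolding jordan_def by (metis gr0I)
    have "symmetric_bilinear (\<lambda>x y. 1 / of_nat p * b x y)" by (rule symmetric_bilinear_scale[OF b])
    moreover have "integral_lattice (L, \<lambda>x y. 1 / of_nat p * b x y)" using div by (simp add: integral_lattice_def)
    ultimately have int: "frm (\<lambda>x y. 1 / of_nat p * b x y) u v \<in> S" if "u \<in> ext_of L" "v \<in> ext_of L" for u v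
      using frm_ext_integral that by blast
    have "Pinv \<cdot> x \<in> A0"
    proof (rule D(12)[OF x(1)])
      fix y assume y: "y \<in> A0"
      have v: "x \<in> vecs" "y \<in> vecs" using x y D(1) by auto
      then show "frm b y (Pinv \<cdot> x) \<in> S"
        using int[OF D(7)[OF y] D(7)[OF x(1)]] by (simp only: frm_scaled frm_smult_right h_closed)
    qed simp
    then show False using x(2) by simp
  qed
qed

lemma jordan_ranks_nonzero:
  fixes L :: "(rat ^ 'm::finite) set"
  assumes L: "full_rank_lattice L" shows "\<not> jordan L b 0 0 A0 A1"
proof
  assume J: "jordan L b 0 0 A0 A1"
  have A: "A0 = {vzero}" "A1 = {vzero}" using J unimodular_rank_zero unfolding jordan_def by blast+
  fix i :: 'm
  obtain m :: nat where m: "m > 0" "of_nat m *s (axis i 1 :: rat ^ 'm) \<in> L"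
    using full_rank_multiple[OF L] by blast
  have "emb (of_nat m *s (axis i 1 :: rat ^ 'm)) = vzero"
    using jordanD(5)[OF J ext_base[OF m(2)]] A by simp
  then have "h (of_nat m) = \<zero>" by (simp add: fun_eq_iff emb_def vzero_def axis_def split: if_splits)
  then have "h (1 / of_nat m * of_nat m) = \<zero>" by (simp only: h_mult r_null h_closed)
  then have "\<one> = \<zero>" using m(1) by (simp add: h_one)
  then have "Pinv = \<zero>" using l_one[of Pinv] by simp
  then show False using Pinv_nonmem by simp
qed

end


section \<open>Determinants in a genus\<close>

context padic_scalars
begin

text \<open>
  The images of a basis of L under a p-adic isometry are congruent modulo p^k to integral
  combinations of a basis of M. Comparing Gram determinants, t is the determinant of the integral
  matrix that describes these combinations.
\<close>

lemma gram_congruent: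
  fixes L M :: "(rat ^ 'n::finite) set"
  assumes L: "is_lattice (L, b)" "integral_lattice (L, b)" and M: "is_lattice (M, b')" "integral_lattice (M, b')"
    and f: "isometry L b M b' f" and e: "is_int_basis e L" and e': "is_int_basis e' M"
  shows "\<exists>t. int p ^ k dvd det (int_gram b e) - t\<^sup>2 * det (int_gram b' e')"
proof -
  have b: "symmetric_bilinear b" and b': "symmetric_bilinear b'" and FM: "full_rank_lattice M"
    using L M by (simp_all add: is_lattice_def)
  let ?q = "of_nat p ^ k :: rat"
  have q0: "?q \<noteq> 0" using p_pos by simp
  have qS: "h ?q \<in> S" using h_nat[of "p ^ k"] by simp
  have eL: "e i \<in> L" for i by (rule int_basis_mem[OF e])
  have "\<exists>v z. v \<in> M \<and> z \<in> ext_of M \<and> f (emb (e i)) = emb v \<boxplus> h ?q \<cdot> z" for i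
    using approximate_vector_power[OF FM isometryD(7)[OF f ext_base[OF eL[of i]]], of k] by metis
  then obtain y z where y: "\<And>i. y i \<in> M" and z: "\<And>i. z i \<in> ext_of M"
    and yz: "\<And>i. f (emb (e i)) = emb (y i) \<boxplus> h ?q \<cdot> z i" by metis
  have zv: "z i \<in> vecs" for i by (rule ext_vecs[OF z])
  have "int p ^ k dvd int_gram b e $ i $ j - int_gram b' y $ i $ j" for i j
  proof -
    define s where "s = frm b' (z i) (emb (y j)) \<oplus> (frm b' (emb (y i)) (z j) \<oplus> h ?q \<otimes> frm b' (z i) (z j))"
    have "frm b' u v \<in> S" if "u \<in> ext_of M" "v \<in> ext_of M" for u v
      by (rule frm_ext_integral[OF b' M(2) that])
    then have s: "s \<in> S" unfolding s_def using z ext_base[OF y] qS by (intro S_add S_mult) auto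
    have "h (b (e i) (e j)) = frm b' (f (emb (e i))) (f (emb (e j)))"
      using isometryD(6)[OF f ext_base[OF eL[of i]] ext_base[OF eL[of j]]] frm_emb[OF b] by simp
    also have "\<dots> = h (b' (y i) (y j)) \<oplus> h ?q \<otimes> s"
      unfolding yz s_def using zv
      by (simp add: frm_add_left frm_add_right frm_smult_left frm_smult_right frm_emb[OF b'] r_distr a_assoc)
    finally have eq: "h (b (e i) (e j)) = h (b' (y i) (y j)) \<oplus> h ?q \<otimes> s" .
    let ?d = "b (e i) (e j) - b' (y i) (y j)"
    have "h ?d = h (b (e i) (e j)) \<oplus> h (- b' (y i) (y j))" using h_add[of "b (e i) (e j)" "- b' (y i) (y j)"] by simp
    also have "\<dots> = h (- b' (y i) (y j)) \<oplus> h (b' (y i) (y j)) \<oplus> h ?q \<otimes> s"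
      unfolding eq using S_carrier[OF s] by (simp add: a_comm[of "h (- b' (y i) (y j))"] a_assoc[symmetric])
        (simp add: a_assoc a_comm[of "h ?q \<otimes> s"])
    also have "\<dots> = h ?q \<otimes> s" using S_carrier[OF s] h_add[of "- b' (y i) (y j)" "b' (y i) (y j)", symmetric]
      by (simp add: h_zero)
    finally have "h (?d / ?q) = h (1 / ?q) \<otimes> (h ?q \<otimes> s)" using h_mult[of "1 / ?q" ?d] by simp
    also have "\<dots> = h (1 / ?q * ?q) \<otimes> s" using S_carrier[OF s] by (simp only: h_mult m_assoc h_closed)
    also have "1 / ?q * ?q = 1" using q0 by (rule nonzero_eq_divide_eq[THEN iffD1, OF _ refl])
    also have "h 1 \<otimes> s = s" using S_carrier[OF s] by (simp add: h_one)
    finally have "h (?d / ?q) \<in> S" using s by simp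
    moreover have di: "?d = of_int (int_gram b e $ i $ j - int_gram b' y $ i $ j)"
      using int_gram_nth[OF L(2) eL eL] int_gram_nth[OF M(2) y y] by simp
    ultimately have "?d / ?q \<in> \<int>" by (intro integer_div_mem) auto
    then obtain m where "?d / ?q = of_int m" by (auto elim: Ints_cases)
    then have "?d = of_int (int p ^ k * m)" using q0 by (simp add: field_simps)
    then have "int_gram b e $ i $ j - int_gram b' y $ i $ j = int p ^ k * m" unfolding di of_int_eq_iff .
    then show ?thesis by simp
  qed
  then have "int p ^ k dvd det (int_gram b e) - det (int_gram b' y)" by (rule dvd_det_diff)
  moreover have "\<exists>t. det (int_gram b' y) = t\<^sup>2 * det (int_gram b' e')"
  proof -
    have "\<exists>c. y i = (\<Sum>j\<in>UNIV. of_int (c j) *s e' j)" for i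
      using y[of i] e' unfolding is_int_basis_iff by blast
    then obtain t where t: "\<And>i. y i = (\<Sum>j\<in>UNIV. of_int (t i j) *s e' j)" by metis
    have "of_int (det (int_gram b' y)) = (of_int ((det (\<chi> i j. t i j))\<^sup>2 * det (int_gram b' e')) :: rat)"
      using det_gram_transform[OF b' t] det_int_gram[OF M(2), of y] det_int_gram[OF M(2), of e'] y
        int_basis_mem[OF e'] by (simp add: det_int_matrix)
    then show ?thesis unfolding of_int_eq_iff by blast
  qed
  ultimately show ?thesis by auto
qed

end

lemma prime_int_eq_nat:
  assumes "prime (q :: int)" shows "\<exists>p. prime p \<and> q = int p"
proof -
  have "q = int (nat q)" using prime_ge_0_int[OF assms] by simp
  then show ?thesis using assms prime_nat_int_transfer[of "nat q"] by metis
qed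

lemma int_eq_of_congruent_squares:
  fixes a c :: int
  assumes nz: "a \<noteq> 0" "c \<noteq> 0"
    and ac: "\<And>p k. prime p \<Longrightarrow> \<exists>t. int p ^ k dvd a - t\<^sup>2 * c"
    and ca: "\<And>p k. prime p \<Longrightarrow> \<exists>t. int p ^ k dvd c - t\<^sup>2 * a"
  shows "a = c"
proof -
  have dvd: "x dvd y" if xy: "x \<noteq> 0" "y \<noteq> 0" "\<And>p k. prime p \<Longrightarrow> \<exists>t. int p ^ k dvd y - t\<^sup>2 * x" for x y :: int
  proof (rule multiplicity_le_imp_dvd[OF xy(1)])
    fix q :: int assume q: "prime q"
    obtain p where p: "prime p" "q = int p" using prime_int_eq_nat[OF q] by blast
    obtain t where t: "int p ^ multiplicity q x dvd y - t\<^sup>2 * x" using xy(3)[OF p(1)] by blast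
    have "q ^ multiplicity q x dvd t\<^sup>2 * x" by (simp add: multiplicity_dvd)
    then have "q ^ multiplicity q x dvd (y - t\<^sup>2 * x) + t\<^sup>2 * x" using t p(2) by (intro dvd_add) auto
    then show "multiplicity q x \<le> multiplicity q y"
      using xy(2) q by (intro multiplicity_geI) auto
  qed
  have "\<bar>a\<bar> = \<bar>c\<bar>" using dvd[OF nz(2,1) ac] dvd[OF nz ca] by (intro zdvd_antisym_abs) auto
  moreover have "a \<noteq> - c"
  proof
    assume eq: "a = - c"
    \<comment> \<open>cancelling the power of 3 in c, the congruence at 3 would make -1 a square modulo 3\<close>
    define k where "k = multiplicity 3 c"
    have p3: "prime (3::nat)" "prime (3::int)" by simp_all
    obtain t where t: "(3::int) ^ Suc k dvd a - t\<^sup>2 * c" using ac[OF p3(1), of "Suc k"] by auto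
    obtain c' where c': "c = 3 ^ k * c'" unfolding k_def using multiplicity_dvd by blast
    have nd: "\<not> 3 dvd c'"
    proof
      assume "3 dvd c'"
      then have "3 ^ Suc k dvd c" unfolding c' by (simp add: mult_dvd_mono mult.commute)
      then have "Suc k \<le> multiplicity 3 c" using nz(2) by (intro multiplicity_geI) auto
      then show False by (simp add: k_def)
    qed
    have "a - t\<^sup>2 * c = 3 ^ k * (- (c' * (1 + t\<^sup>2)))" unfolding eq c' by (simp add: algebra_simps)
    then have "3 ^ k * 3 dvd 3 ^ k * (- (c' * (1 + t\<^sup>2)))" using t by (simp add: mult.commute)
    then have "3 dvd c' * (1 + t\<^sup>2)" by simp
    then have "3 dvd 1 + t\<^sup>2" using nd prime_dvd_mult_iff[OF p3(2)] by blast
    moreover have "\<exists>m. 1 + t\<^sup>2 = 3 * m + 1 \<or> 1 + t\<^sup>2 = 3 * m + 2"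
    proof -
      have "\<exists>s. t = 3 * s \<or> t = 3 * s + 1 \<or> t = 3 * s + 2" by presburger
      then obtain s where "t = 3 * s \<or> t = 3 * s + 1 \<or> t = 3 * s + 2" by blast
      then have "1 + t\<^sup>2 = 3 * (3 * s\<^sup>2) + 1 \<or> 1 + t\<^sup>2 = 3 * (3 * s\<^sup>2 + 2 * s) + 2 \<or>
          1 + t\<^sup>2 = 3 * (3 * s\<^sup>2 + 4 * s + 1) + 2"
        by (elim disjE) (simp_all add: power2_eq_square algebra_simps)
      then show ?thesis by blast
    qed
    ultimately show False by presburger
  qed
  ultimately show ?thesis by linarith
qed

section \<open>Genera\<close>

lemma padic_scalars_padic:
  assumes p: "prime p" shows "padic_scalars (padic_field p) (padic_ints p) (padic_of_rat p) p"
proof -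
  interpret cring "padic_field p" by (rule cring_padic_field[OF p])
  have pc: "X \<in> cauchy_seqs p \<Longrightarrow> padic_class p X \<in> carrier (padic_field p)" for X
    by (rule padic_class_closed[OF p])
  show ?thesis
  proof
    show "padic_ints p \<subseteq> carrier (padic_field p)" by (auto simp: padic_ints_def)
    show "padic_of_rat p (of_int a) \<in> padic_ints p" for a
      using padic_of_rat_mem_ints[OF p] padic_abs_of_int_le[OF p] by blast
    show "\<exists>k. padic_of_rat p (of_nat p ^ k) \<otimes>\<^bsub>padic_field p\<^esub> c \<in> padic_ints p"
      if "c \<in> carrier (padic_field p)" for c using padic_bounded_denominator[OF p that] by metis
    show "\<exists>a. \<exists>d\<in>padic_ints p. c = padic_of_rat p (of_int a) \<oplus>\<^bsub>padic_field p\<^esub>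
        padic_of_rat p (of_nat p) \<otimes>\<^bsub>padic_field p\<^esub> d"
      if "c \<in> padic_ints p" for c using padic_ints_approximate[OF p that] by metis
  qed (use p padic_ints_add[OF p] padic_ints_mult[OF p] padic_of_rat_mem_ints[OF p]
      padic_class_add[OF p cauchy_seqs_const cauchy_seqs_const]
      padic_class_mult[OF p cauchy_seqs_const cauchy_seqs_const] padic_class_one[OF p] pc
      in \<open>auto simp: padic_of_rat_eq[OF p]\<close>)
qed

lemma scalar_extension_real: "scalar_extension real_field UNIV of_rat"
proof -
  interpret cring real_field
  proof (rule cringI)
    show "abelian_group real_field"
    proof (rule abelian_groupI)
      fix x assume "x \<in> carrier real_field"
      show "\<exists>y\<in>carrier real_field. y \<oplus>\<^bsub>real_field\<^esub> x = \<zero>\<^bsub>real_field\<^esub>"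
        by (intro bexI[of _ "- x"]) (auto simp: real_field_def)
    qed (auto simp: real_field_def)
    show "Group.comm_monoid real_field" by (rule comm_monoidI) (auto simp: real_field_def)
  qed (auto simp: real_field_def algebra_simps)
  show ?thesis by unfold_locales (auto simp: real_field_def of_rat_add of_rat_mult)
qed

lemma jordan_decomposition_iff:
  assumes p: "prime p"
  shows "jordan_decomposition p (L, b) r0 r1 \<longleftrightarrow>
    (\<exists>A0 A1. padic_scalars.jordan (padic_field p) (padic_ints p) (padic_of_rat p) p L b r0 r1 A0 A1)"
proof -
  interpret padic_scalars "padic_field p" "padic_ints p" "padic_of_rat p" p by (rule padic_scalars_padic[OF p])
  have unimodular: "padic_unimodular p \<beta> r A \<longleftrightarrow> unimodular \<beta> r A" for \<beta> r and A :: "('n \<Rightarrow> (nat \<Rightarrow> rat) set) set"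
    by (simp add: padic_unimodular_def unimodular_def)
  have form: "base_change_form (padic_field p) (padic_of_rat p) (rescale (1 / of_nat p) (L, b)) =
      frm (\<lambda>x y. 1 / of_nat p * b x y)"
    unfolding rescale_def prod.case base_change_form_eq ..
  show ?thesis
    unfolding jordan_decomposition_def jordan_def Let_def unimodular form base_change_form_eq base_change_eq
      vadd_def vzero_def ..
qed

lemma isometric_padic_iff:
  assumes p: "prime p"
  shows "isometric_padic p (L, b) (M, b') \<longleftrightarrow>
    (\<exists>f. scalar_extension.isometry (padic_field p) (padic_ints p) (padic_of_rat p) L b M b' f)"
proof -
  interpret padic_scalars "padic_field p" "padic_ints p" "padic_of_rat p" p by (rule padic_scalars_padic[OF p])
  show ?thesis unfolding isometric_padic_def by (rule isometric_over_iff)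
qed

lemma genus_rel_iff:
  "(X, Y) \<in> genus_rel \<longleftrightarrow> is_lattice X \<and> is_lattice Y \<and> (\<forall>p. prime p \<longrightarrow> isometric_padic p X Y) \<and>
    isometric_real X Y"
  by (simp add: genus_rel_def)

lemma genus_rel_equiv: "equiv {L :: 'n::finite lattice. is_lattice L} genus_rel"
proof (rule equivI)
  interpret R: scalar_extension real_field UNIV of_rat by (rule scalar_extension_real)
  have P: "scalar_extension (padic_field p) (padic_ints p) (padic_of_rat p)" if "prime p" for p
    using padic_scalars_padic[OF that] by (simp add: padic_scalars_def)
  have refl: "isometric_padic p X X" if "prime p" for p and X :: "'n lattice"
    unfolding isometric_padic_def
    by (cases X) (simp only: scalar_extension.isometric_over_refl[OF P[OF that]])
  have sym: "isometric_padic p Y X" if "prime p" "isometric_padic p X Y" for p and X Y :: "'n lattice"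
    using that(2) scalar_extension.isometric_over_sym[OF P[OF that(1)]]
    unfolding isometric_padic_def by (metis surj_pair)
  have trans: "isometric_padic p X Z" if "prime p" "isometric_padic p X Y" "isometric_padic p Y Z"
    for p and X Y Z :: "'n lattice"
    using that(2,3) scalar_extension.isometric_over_trans[OF P[OF that(1)]]
    unfolding isometric_padic_def by (metis surj_pair)
  have rrefl: "isometric_real X X" for X :: "'n lattice"
    unfolding isometric_real_def by (cases X) (simp only: R.isometric_over_refl)
  have rsym: "isometric_real Y X" if "isometric_real X Y" for X Y :: "'n lattice"
    using that R.isometric_over_sym unfolding isometric_real_def by (metis surj_pair)
  have rtrans: "isometric_real X Z" if "isometric_real X Y" "isometric_real Y Z" for X Y Z :: "'n lattice"
    using that R.isometric_over_trans unfolding isometric_real_def by (metis surj_pair)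
  show "genus_rel \<subseteq> {L :: 'n lattice. is_lattice L} \<times> {L. is_lattice L}" by (auto simp: genus_rel_def)
  show "refl_on {L :: 'n lattice. is_lattice L} genus_rel"
    by (rule refl_onI) (simp add: genus_rel_iff refl rrefl)
  show "sym (genus_rel :: ('n lattice \<times> 'n lattice) set)"
    by (rule symI) (use sym rsym in \<open>unfold genus_rel_iff, blast\<close>)
  show "trans (genus_rel :: ('n lattice \<times> 'n lattice) set)"
    by (rule transI) (use trans rtrans in \<open>unfold genus_rel_iff, blast\<close>)
qed

lemma genus_rel_iso:
  assumes "((L, b), (M, b')) \<in> genus_rel" "prime p"
  obtains f where "scalar_extension.isometry (padic_field p) (padic_ints p) (padic_of_rat p) L b M b' f"
  using assms isometric_padic_iff[OF assms(2), of L b M b'] unfolding genus_rel_iff by blast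

lemma genus_rel_sym: "(X, Y) \<in> genus_rel \<Longrightarrow> (Y, X) \<in> genus_rel"
  using genus_rel_equiv by (meson equivE symE)

lemma genus_rel_trans: "(X, Y) \<in> genus_rel \<Longrightarrow> (Y, Z) \<in> genus_rel \<Longrightarrow> (X, Z) \<in> genus_rel"
  using genus_rel_equiv by (meson equivE transE)

lemma genus_rel_refl: "is_lattice X \<Longrightarrow> (X, X) \<in> genus_rel"
  using genus_rel_equiv by (auto dest: equivE refl_onD)

lemma genus_rel_lattice: "(X, Y) \<in> genus_rel \<Longrightarrow> is_lattice X" "(X, Y) \<in> genus_rel \<Longrightarrow> is_lattice Y"
  by (auto simp: genus_rel_def)

lemma rat_integral_if_locally:
  assumes "\<And>p. prime p \<Longrightarrow> padic_abs p x \<le> 1" shows "x \<in> \<int>"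
proof -
  obtain a d where ad: "quotient_of x = (a, d)" by fastforce
  have d: "d > 0" and x: "x = of_int a / of_int d" and co: "coprime a d"
    using ad quotient_of_denom_pos quotient_of_div quotient_of_coprime by blast+
  have "d = 1"
  proof (rule ccontr)
    assume "d \<noteq> 1"
    then obtain q where q: "prime q" "q dvd d" using d prime_divisor_exists[of d] by auto
    obtain p where p: "prime p" "q = int p" using prime_int_eq_nat[OF q(1)] by blast
    obtain m :: int where m: "\<not> int p dvd m" "of_int m * x \<in> \<int>"
      using assms[OF p(1)] padic_abs_le_1_iff[OF p(1)] by blast
    obtain l where l: "of_int m * x = of_int l" using m(2) by (auto elim: Ints_cases)
    have "(of_int (m * a) :: rat) = of_int (l * d)" using l d x by (simp add: field_simps)
    then have "m * a = l * d" by (simp only: of_int_eq_iff)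
    then have "d dvd m * a" by simp
    then have "d dvd m" using co by (simp add: coprime_commute coprime_dvd_mult_left_iff)
    then show False using m(1) q(2) p(2) dvd_trans by blast
  qed
  then show ?thesis using x by simp
qed

text \<open>
  Integrality is a local property, as a rational number that is integral at all primes is an
  integer.
\<close>

lemma genus_rel_integral:
  assumes XY: "(X, Y) \<in> genus_rel" and X: "integral_lattice X" shows "integral_lattice Y"
proof -
  obtain L b M b' where eq: "X = (L, b)" "Y = (M, b')" by fastforce
  have b: "symmetric_bilinear b" and b': "symmetric_bilinear b'"
    using genus_rel_lattice[OF XY] by (simp_all add: eq is_lattice_def)
  have "b' v w \<in> \<int>" if vw: "v \<in> M" "w \<in> M" for v w
  proof (rule rat_integral_if_locally)
    fix p :: nat assume p: "prime p"
    interpret padic_scalars "padic_field p" "padic_ints p" "padic_of_rat p" p by (rule padic_scalars_padic[OF p])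
    obtain f where f: "isometry L b M b' f" by (rule genus_rel_iso[OF XY[unfolded eq] p])
    note g = isometry_inverse[OF f]
    have "frm b' (emb v) (emb w) \<in> padic_ints p"
      using isometryD(6,7)[OF g] frm_ext_integral[OF b, of L] X ext_base[OF vw(1)] ext_base[OF vw(2)] eq by metis
    then show "padic_abs p (b' v w) \<le> 1" by (simp add: frm_emb[OF b'] h_mem_iff)
  qed
  then show ?thesis by (simp add: eq integral_lattice_def)
qed

lemma genus_rel_jordan:
  assumes XY: "(X, Y) \<in> genus_rel" and p: "prime p" and J: "jordan_decomposition p X r0 r1"
  shows "jordan_decomposition p Y r0 r1"
proof -
  obtain L b M b' where eq: "X = (L, b)" "Y = (M, b')" by fastforce
  interpret padic_scalars "padic_field p" "padic_ints p" "padic_of_rat p" p by (rule padic_scalars_padic[OF p])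
  obtain f where f: "isometry L b M b' f" by (rule genus_rel_iso[OF XY[unfolded eq] p])
  show ?thesis
    using J jordan_isometric[OF _ f] unfolding eq jordan_decomposition_iff[OF p] by blast
qed

lemma genus_rel_partial_dual:
  assumes XY: "(X, Y) \<in> genus_rel" and X: "integral_lattice X" and q: "prime q"
  shows "(partial_dual q X, partial_dual q Y) \<in> genus_rel"
proof -
  obtain L b M b' where eq: "X = (L, b)" "Y = (M, b')" by fastforce
  have L: "is_lattice (L, b)" "integral_lattice (L, b)" and M: "is_lattice (M, b')" "integral_lattice (M, b')"
    using genus_rel_lattice[OF XY] genus_rel_integral[OF XY X] X by (simp_all add: eq)
  have q0: "q > 0" using q prime_gt_0_nat by blast
  interpret R: scalar_extension real_field UNIV of_rat by (rule scalar_extension_real)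
  have "isometric_real (partial_dual q (L, b)) (partial_dual q (M, b'))"
    using XY R.isometric_partial_dual_unit[OF L M q0] by (simp add: genus_rel_iff eq isometric_real_def)
  moreover have "isometric_padic p (partial_dual q (L, b)) (partial_dual q (M, b'))" if p: "prime p" for p
  proof -
    interpret padic_scalars "padic_field p" "padic_ints p" "padic_of_rat p" p by (rule padic_scalars_padic[OF p])
    have iso: "isometric_over (padic_field p) (padic_ints p) (padic_of_rat p) (L, b) (M, b')"
      using XY p by (simp add: genus_rel_iff eq isometric_padic_def)
    show ?thesis
    proof (cases "p = q")
      case True
      then show ?thesis using isometric_partial_dual_prime[OF L M iso] by (simp add: isometric_padic_def)
    next
      case False
      then have "padic_abs p (1 / of_nat q) \<le> 1" using padic_abs_inverse_other[OF p q] by blast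
      then show ?thesis using isometric_partial_dual_unit[OF L M q0 _ iso] h_mem_iff
        by (simp add: isometric_padic_def)
    qed
  qed
  ultimately show ?thesis
    using is_lattice_partial_dual[OF L q0] is_lattice_partial_dual[OF M q0] by (simp add: genus_rel_iff eq)
qed

lemma genus_rel_scaled:
  assumes L: "is_lattice (L, b)" and c: "c \<noteq> 0"
  shows "(((\<lambda>x. c *s x) ` L, \<lambda>x y. (1 / c)\<^sup>2 * b x y), (L, b)) \<in> genus_rel"
proof -
  interpret R: scalar_extension real_field UNIV of_rat by (rule scalar_extension_real)
  have P: "scalar_extension (padic_field p) (padic_ints p) (padic_of_rat p)" if "prime p" for p
    using padic_scalars_padic[OF that] by (simp add: padic_scalars_def)
  have "is_lattice ((\<lambda>x. c *s x) ` L, \<lambda>x y. (1 / c)\<^sup>2 * b x y)"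
    using L full_rank_scaled[of L c] symmetric_bilinear_scale[of b] c by (simp add: is_lattice_def)
  then show ?thesis
    unfolding genus_rel_iff isometric_padic_def isometric_real_def
    using L R.isometric_over_scaled[OF c] scalar_extension.isometric_over_scaled[OF P c] by blast
qed

lemma partial_dual_twice:
  assumes L: "is_lattice (L, b)" "integral_lattice (L, b)" and q: "prime q"
    and J: "jordan_decomposition q (L, b) r0 r1"
  shows "partial_dual q (partial_dual q (L, b)) =
    ((\<lambda>x. (1 / of_nat q) *s x) ` L, \<lambda>x y. (1 / (1 / of_nat q))\<^sup>2 * b x y)"
proof -
  interpret padic_scalars "padic_field q" "padic_ints q" "padic_of_rat q" q by (rule padic_scalars_padic[OF q])
  obtain A0 A1 where "jordan L b r0 r1 A0 A1" using J jordan_decomposition_iff[OF q] by blast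
  then show ?thesis
    using pdual_pdual[OF _ L] p_pos(1) by (simp add: partial_dual_eq power2_eq_square mult.assoc)
qed

subsection \<open>The determinant of a genus\<close>

text \<open>
  Positive definite integral lattices in the same genus have the same determinant. Applied to two
  bases of one such lattice, this also shows that its determinant is well defined.
\<close>

lemma genus_rel_det:
  fixes L M :: "(rat ^ 'n::finite) set"
  assumes g: "((L, b), (M, b')) \<in> genus_rel" and int: "integral_lattice (L, b)"
    and pos: "positive_definite (L, b)" "positive_definite (M, b')"
    and e: "is_int_basis e L" and e': "is_int_basis e' M"
  shows "det (int_gram b e) = det (int_gram b' e')"
proof (rule int_eq_of_congruent_squares)
  have L: "is_lattice (L, b)" "integral_lattice (L, b)" and M: "is_lattice (M, b')" "integral_lattice (M, b')"
    using genus_rel_lattice[OF g] genus_rel_integral[OF g int] int by simp_all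
  show "det (int_gram b e) \<noteq> 0"
    using det_gram_nonzero[OF L(1) pos(1) e] det_int_gram[OF L(2), of e] int_basis_mem[OF e] by auto
  show "det (int_gram b' e') \<noteq> 0"
    using det_gram_nonzero[OF M(1) pos(2) e'] det_int_gram[OF M(2), of e'] int_basis_mem[OF e'] by auto
  fix p k :: nat assume p: "prime p"
  interpret padic_scalars "padic_field p" "padic_ints p" "padic_of_rat p" p by (rule padic_scalars_padic[OF p])
  obtain f where f: "isometry L b M b' f" by (rule genus_rel_iso[OF g p])
  show "\<exists>t. int p ^ k dvd det (int_gram b e) - t\<^sup>2 * det (int_gram b' e')" by (rule gram_congruent[OF L M f e e'])
  show "\<exists>t. int p ^ k dvd det (int_gram b' e') - t\<^sup>2 * det (int_gram b e)"
    by (rule gram_congruent[OF M L isometry_inverse[OF f] e' e])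
qed

lemma lattice_det_eq:
  assumes L: "is_lattice (L, b)" "integral_lattice (L, b)" "positive_definite (L, b)" and e: "is_int_basis e L"
  shows "lattice_det (L, b) = of_int (det (int_gram b e))"
proof -
  have eq: "det (\<chi> i j. b (e' i) (e' j)) = of_int (det (int_gram b e))" if e': "is_int_basis e' L" for e'
  proof -
    have "det (int_gram b e') = det (int_gram b e)"
      by (rule genus_rel_det[OF genus_rel_refl[OF L(1)] L(2,3,3) e' e])
    then show ?thesis
      using det_int_gram[OF L(2), of e'] int_basis_mem[OF e'] by (simp add: gram_def)
  qed
  show ?thesis
    unfolding lattice_det_def prod.case
    by (rule the_equality) (use e eq in auto)
qed

text \<open>The prime divisors of the determinant of a genus, read off from a lattice in the genus.\<close>

lemma prime_divisors_genus_det: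
  assumes G: "G = genus_rel `` {X}" and X: "is_lattice X"
    and int: "integral_lattice X" and pos: "\<And>Y. Y \<in> G \<Longrightarrow> positive_definite Y"
  shows "finite (prime_divisors (genus_det G))"
    and "prime p \<Longrightarrow> jordan_decomposition p X r0 r1 \<Longrightarrow> p \<in> prime_divisors (genus_det G) \<longleftrightarrow> r1 > 0"
proof -
  obtain L b where eq: "X = (L, b)" by fastforce
  have L: "is_lattice (L, b)" "integral_lattice (L, b)" "positive_definite (L, b)"
    using X int pos genus_rel_refl[OF X] G eq by auto
  obtain e where e: "is_int_basis e L" using L(1) unfolding is_lattice_def full_rank_lattice_def by auto
  have "lattice_det Y = of_int (det (int_gram b e))" if Y: "Y \<in> G" for Y
  proof -
    obtain M b' where eq': "Y = (M, b')" by fastforce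
    have g: "((L, b), (M, b')) \<in> genus_rel" using Y by (simp add: G eq eq')
    have M: "is_lattice (M, b')" "integral_lattice (M, b')" "positive_definite (M, b')"
      using genus_rel_lattice[OF g] genus_rel_integral[OF g L(2)] pos[OF Y] eq' by auto
    obtain e' where e': "is_int_basis e' M" using M(1) unfolding is_lattice_def full_rank_lattice_def by auto
    show ?thesis unfolding eq' lattice_det_eq[OF M e'] genus_rel_det[OF g L(2,3) M(3) e e'] ..
  qed
  moreover have "X \<in> G" using genus_rel_refl[OF X] G by simp
  ultimately have gd: "genus_det G = of_int (det (int_gram b e))"
    unfolding genus_det_def by (intro the_equality) auto
  have pd: "p \<in> prime_divisors (genus_det G) \<longleftrightarrow> prime p \<and> int p dvd det (int_gram b e)" for p
  proof -
    have "rat_of_int (det (int_gram b e)) = of_nat p * of_int k \<longleftrightarrow> det (int_gram b e) = int p * k" for k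
      by (metis of_int_eq_iff of_int_mult of_int_of_nat_eq)
    then show ?thesis unfolding prime_divisors_def gd by (auto elim!: dvdE)
  qed
  have "det (int_gram b e) \<noteq> 0"
    using det_gram_nonzero[OF L(1,3) e] det_int_gram[OF L(2), of e] int_basis_mem[OF e] by auto
  then have "finite {k. k dvd det (int_gram b e)}" by (rule finite_divisors_int)
  then have "finite (nat ` {k. k dvd det (int_gram b e)})" by (rule finite_imageI)
  moreover have "prime_divisors (genus_det G) \<subseteq> nat ` {k. k dvd det (int_gram b e)}"
  proof
    fix p assume "p \<in> prime_divisors (genus_det G)"
    then show "p \<in> nat ` {k. k dvd det (int_gram b e)}"
      using pd[of p] by (intro image_eqI[of _ _ "int p"]) simp_all
  qed
  ultimately show "finite (prime_divisors (genus_det G))" by (rule rev_finite_subset)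
  assume p: "prime p" and J: "jordan_decomposition p X r0 r1"
  interpret padic_scalars "padic_field p" "padic_ints p" "padic_of_rat p" p by (rule padic_scalars_padic[OF p])
  obtain A0 A1 where "jordan L b r0 r1 A0 A1" using J jordan_decomposition_iff[OF p] eq by blast
  then show "p \<in> prime_divisors (genus_det G) \<longleftrightarrow> r1 > 0"
    using pd[of p] p jordan_rank1_pos_iff[OF _ L(1,2)] prime_dvd_gram_iff[OF p L(1,2) e] by blast
qed

subsection \<open>Primitive lattices\<close>

lemma primitive_lattice_iff:
  assumes L: "is_lattice (L, b)" "integral_lattice (L, b)"
  shows "primitive_lattice (L, b) \<longleftrightarrow> (\<forall>p. prime p \<longrightarrow> \<not> (\<forall>x\<in>L. \<forall>y\<in>L. b x y / of_nat p \<in> \<int>))"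
proof
  assume prim: "primitive_lattice (L, b)"
  show "\<forall>p. prime p \<longrightarrow> \<not> (\<forall>x\<in>L. \<forall>y\<in>L. b x y / of_nat p \<in> \<int>)"
  proof (intro allI impI notI)
    fix p :: nat assume p: "prime p" "\<forall>x\<in>L. \<forall>y\<in>L. b x y / of_nat p \<in> \<int>"
    let ?N = "(L, \<lambda>x y. 1 / of_nat p * b x y)"
    have "is_lattice ?N" by (rule is_lattice_rescale[OF L(1)])
    moreover have "integral_lattice ?N" using p(2) by (simp add: integral_lattice_def)
    moreover have "(L, b) = rescale (of_int (int p)) ?N" using p(1) by (simp add: rescale_def)
    moreover have "int p \<ge> 2" using prime_ge_2_nat[OF p(1)] by simp
    ultimately show False using prim unfolding primitive_lattice_def by blast
  qed
next
  assume np: "\<forall>p. prime p \<longrightarrow> \<not> (\<forall>x\<in>L. \<forall>y\<in>L. b x y / of_nat p \<in> \<int>)"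
  have False if a: "a \<ge> 2" "is_lattice N" "integral_lattice N" "(L, b) = rescale (of_int a) N" for a :: int and N
  proof -
    obtain b' where N: "N = (L, b')" "b = (\<lambda>x y. of_int a * b' x y)" using a(4) by (cases N) (auto simp: rescale_def)
    obtain p where p: "prime p" "p dvd nat a" using prime_factor_nat[of "nat a"] a(1) by force
    then obtain k where k: "a = int p * k" using a(1) by (metis dvdE int_dvd_int_iff nat_0_le order_trans zero_le_numeral)
    have "b x y / of_nat p = of_int k * b' x y" for x y
      using p(1) k by (simp add: N(2))
    then have "\<forall>x\<in>L. \<forall>y\<in>L. b x y / of_nat p \<in> \<int>" using a(3) N(1) by (simp add: integral_lattice_def)
    then show False using np p(1) by blast
  qed
  then show "primitive_lattice (L, b)" unfolding primitive_lattice_def using L(2) by blast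
qed

lemma jordan_decomposition_rank0:
  assumes p: "prime p" and J: "jordan_decomposition p (L, b) r0 r1" and L: "is_lattice (L, b)" "integral_lattice (L, b)"
  shows "r0 = 0 \<longleftrightarrow> (\<forall>x\<in>L. \<forall>y\<in>L. b x y / of_nat p \<in> \<int>)" and "r0 \<noteq> 0 \<or> r1 \<noteq> 0"
proof -
  interpret padic_scalars "padic_field p" "padic_ints p" "padic_of_rat p" p by (rule padic_scalars_padic[OF p])
  obtain A0 A1 where A: "jordan L b r0 r1 A0 A1" using J jordan_decomposition_iff[OF p] by blast
  show "r0 = 0 \<longleftrightarrow> (\<forall>x\<in>L. \<forall>y\<in>L. b x y / of_nat p \<in> \<int>)" by (rule jordan_rank0_zero_iff[OF A L])
  have "full_rank_lattice L" using L(1) by (simp add: is_lattice_def)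
  from jordan_ranks_nonzero[OF this, of b A0 A1] show "r0 \<noteq> 0 \<or> r1 \<noteq> 0"
    using A by (cases "r0 = 0"; cases "r1 = 0") simp_all
qed

lemma primitive_iff_rank0:
  assumes X: "is_lattice X" "integral_lattice X"
    and J: "\<And>p. prime p \<Longrightarrow> jordan_decomposition p X (r0 p) (r1 p)"
  shows "primitive_lattice X \<longleftrightarrow> (\<forall>p. prime p \<longrightarrow> r0 p > 0)"
proof -
  obtain L b where eq: "X = (L, b)" by fastforce
  show ?thesis
    using jordan_decomposition_rank0(1)[OF _ J[unfolded eq] X[unfolded eq]] primitive_lattice_iff[OF X[unfolded eq]]
    unfolding eq by (metis gr0I less_numeral_extra(3))
qed

section \<open>Iterated partial duals of square free lattices\<close>

text \<open>
  The lattices on which iterated partial duals are well behaved: integral and square free.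
\<close>

definition sf_integral :: "'n::finite lattice \<Rightarrow> bool" where
  "sf_integral X \<longleftrightarrow> is_lattice X \<and> integral_lattice X \<and> square_free_lattice X"

lemma sf_integral_genus_rel: "(X, Y) \<in> genus_rel \<Longrightarrow> sf_integral X \<Longrightarrow> sf_integral Y"
  using genus_rel_lattice genus_rel_integral genus_rel_jordan
  unfolding sf_integral_def square_free_lattice_def by blast

lemma partial_dual_jordan:
  assumes X: "is_lattice X" "integral_lattice X" and p: "prime p" and q: "prime q"
    and J: "jordan_decomposition p X r0 r1"
  shows "if p = q then jordan_decomposition p (partial_dual q X) r1 r0
    else jordan_decomposition p (partial_dual q X) r0 r1"
proof -
  obtain L b where eq: "X = (L, b)" by fastforce
  have q0: "q > 0" using q prime_gt_0_nat by blast
  interpret padic_scalars "padic_field p" "padic_ints p" "padic_of_rat p" p by (rule padic_scalars_padic[OF p])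
  obtain A0 A1 where A: "jordan L b r0 r1 A0 A1" using J jordan_decomposition_iff[OF p] eq by blast
  show ?thesis
    using jordan_partial_dual[OF A X[unfolded eq]] jordan_partial_dual_other[OF A X[unfolded eq] q]
    unfolding eq partial_dual_eq[OF q0] jordan_decomposition_iff[OF p] by auto
qed

lemma sf_integral_partial_dual:
  assumes "sf_integral X" "prime q" shows "sf_integral (partial_dual q X)"
proof -
  obtain L b where eq: "X = (L, b)" by fastforce
  have q0: "q > 0" using assms(2) prime_gt_0_nat by blast
  show ?thesis
    using assms is_lattice_partial_dual[OF _ _ q0] integral_partial_dual[OF _ _ q0] partial_dual_jordan
    unfolding sf_integral_def square_free_lattice_def eq by metis
qed

lemma partial_dual_twice_genus:
  assumes "sf_integral X" "prime q" shows "(partial_dual q (partial_dual q X), X) \<in> genus_rel"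
proof -
  obtain L b where eq: "X = (L, b)" by fastforce
  obtain r0 r1 where "jordan_decomposition q X r0 r1" using assms unfolding sf_integral_def square_free_lattice_def by blast
  then show ?thesis
    using assms partial_dual_twice[of L b q r0 r1] genus_rel_scaled[of L b "1 / of_nat q"] prime_gt_0_nat
    by (auto simp: sf_integral_def eq)
qed

lemma reflective_partial_dual_iff:
  assumes X: "sf_integral X" and q: "prime q" shows "reflective (partial_dual q X) \<longleftrightarrow> reflective X"
proof
  obtain L b where eq: "X = (L, b)" by fastforce
  have q0: "q > 0" "(of_nat q :: rat) \<noteq> 0" using q prime_gt_0_nat by auto
  have L: "is_lattice (L, b)" "integral_lattice (L, b)" using X by (auto simp: sf_integral_def eq)
  show "reflective X \<Longrightarrow> reflective (partial_dual q X)"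
    unfolding eq by (rule reflective_partial_dual[OF L(1) _ q0(1)])
  assume "reflective (partial_dual q X)"
  moreover have "is_lattice (partial_dual q X)" using sf_integral_partial_dual[OF X q] by (simp add: sf_integral_def)
  ultimately have r: "reflective (partial_dual q (partial_dual q X))" "is_lattice (partial_dual q (partial_dual q X))"
    using reflective_partial_dual[of "fst (partial_dual q X)" "snd (partial_dual q X)" q] q0(1)
      sf_integral_partial_dual[OF sf_integral_partial_dual[OF X q] q] by (simp_all add: sf_integral_def)
  obtain r0 r1 where J: "jordan_decomposition q (L, b) r0 r1"
    using X q unfolding sf_integral_def square_free_lattice_def eq by blast
  note tw = partial_dual_twice[OF L q J]
  have "(\<lambda>x. of_nat q *s x) ` (\<lambda>x. (1 / of_nat q) *s x) ` L = L"
    using q0(2) by (simp add: image_image)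
  moreover have "(\<lambda>x y. (1 / of_nat q)\<^sup>2 * ((1 / (1 / of_nat q))\<^sup>2 * b x y)) = b"
    using q0(2) by (simp add: power2_eq_square)
  ultimately show "reflective X"
    using reflective_scaled[of "(\<lambda>x. (1 / of_nat q) *s x) ` L" "\<lambda>x y. (1 / (1 / of_nat q))\<^sup>2 * b x y" "of_nat q"]
      r q0(2) unfolding eq tw by simp
qed

text \<open>
  Iterated partial duals along a list of primes. As the inverse operation takes the primes in the
  opposite order, commutation of partial duals is not needed.
\<close>

abbreviation partial_duals :: "nat list \<Rightarrow> 'n::finite lattice \<Rightarrow> 'n lattice" where
  "partial_duals \<equiv> foldr partial_dual"

lemma sf_integral_partial_duals: "sf_integral X \<Longrightarrow> \<forall>q\<in>set qs. prime q \<Longrightarrow> sf_integral (partial_duals qs X)"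
  by (induction qs) (auto intro: sf_integral_partial_dual)

lemma partial_duals_genus_rel:
  "(X, Y) \<in> genus_rel \<Longrightarrow> sf_integral X \<Longrightarrow> \<forall>q\<in>set qs. prime q \<Longrightarrow>
    (partial_duals qs X, partial_duals qs Y) \<in> genus_rel"
proof (induction qs)
  case (Cons q qs)
  then show ?case
    using genus_rel_partial_dual[of "partial_duals qs X" "partial_duals qs Y" q] sf_integral_partial_duals[of X qs]
    by (simp add: sf_integral_def)
qed simp

lemma partial_duals_inverse:
  "sf_integral X \<Longrightarrow> \<forall>q\<in>set qs. prime q \<Longrightarrow> (partial_duals (rev qs) (partial_duals qs X), X) \<in> genus_rel"
proof (induction qs)
  case Nil
  then show ?case by (simp add: sf_integral_def genus_rel_refl)
next
  case (Cons q qs)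
  have g: "sf_integral (partial_duals qs X)" by (rule sf_integral_partial_duals) (use Cons.prems in simp_all)
  have "(partial_duals (rev qs) (partial_dual q (partial_dual q (partial_duals qs X))),
      partial_duals (rev qs) (partial_duals qs X)) \<in> genus_rel"
    using Cons.prems partial_dual_twice_genus[OF g, of q] sf_integral_partial_dual[OF sf_integral_partial_dual[OF g]]
    by (intro partial_duals_genus_rel) auto
  moreover have "(partial_duals (rev qs) (partial_duals qs X), X) \<in> genus_rel"
    by (rule Cons.IH) (use Cons.prems in simp_all)
  ultimately have "(partial_duals (rev qs) (partial_dual q (partial_dual q (partial_duals qs X))), X) \<in> genus_rel"
    by (rule genus_rel_trans)
  then show ?case by simp
qed

lemma reflective_partial_duals_iff:
  "sf_integral X \<Longrightarrow> \<forall>q\<in>set qs. prime q \<Longrightarrow> reflective (partial_duals qs X) \<longleftrightarrow> reflective X"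
  by (induction qs) (simp_all add: reflective_partial_dual_iff sf_integral_partial_duals)

lemma partial_duals_jordan:
  assumes "sf_integral X" "\<forall>q\<in>set qs. prime q" "distinct qs" "prime p" "jordan_decomposition p X r0 r1"
  shows "if p \<in> set qs then jordan_decomposition p (partial_duals qs X) r1 r0
    else jordan_decomposition p (partial_duals qs X) r0 r1"
  using assms
proof (induction qs)
  case (Cons q qs)
  have g: "is_lattice (partial_duals qs X)" "integral_lattice (partial_duals qs X)"
    using sf_integral_partial_duals[of X qs] Cons.prems by (auto simp: sf_integral_def)
  have IH: "if p \<in> set qs then jordan_decomposition p (partial_duals qs X) r1 r0
    else jordan_decomposition p (partial_duals qs X) r0 r1" using Cons by simp
  have q: "prime q" "q \<notin> set qs" using Cons.prems by auto
  show ?case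
    using IH q(2) partial_dual_jordan[OF g \<open>prime p\<close> q(1), of r0 r1] partial_dual_jordan[OF g \<open>prime p\<close> q(1), of r1 r0]
    by (auto split: if_splits)
qed simp

lemma partial_dual_genus_eq:
  assumes X: "sf_integral X" and I: "finite I" "\<forall>q\<in>I. prime q"
  shows "partial_dual_genus I (genus_rel `` {X}) = genus_rel `` {partial_duals (sorted_list_of_set I) X}"
proof -
  have "genus_rel `` {partial_dual_set I Y} = genus_rel `` {partial_duals (sorted_list_of_set I) X}"
    if "(X, Y) \<in> genus_rel" for Y
  proof -
    have "(partial_duals (sorted_list_of_set I) X, partial_duals (sorted_list_of_set I) Y) \<in> genus_rel"
      by (rule partial_duals_genus_rel[OF that X]) (use I in simp)
    then show ?thesis unfolding partial_dual_set_def using equiv_class_eq[OF genus_rel_equiv] by blast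
  qed
  moreover have "(X, X) \<in> genus_rel" using X by (simp add: sf_integral_def genus_rel_refl)
  ultimately show ?thesis unfolding partial_dual_genus_def by blast
qed

lemma genus_cases:
  assumes "G \<in> genera" obtains X where "G = genus_rel `` {X}" "is_lattice X" "X \<in> G"
  using assms genus_rel_refl unfolding genera_def by (auto elim!: quotientE)

lemma genus_mem: "is_lattice X \<Longrightarrow> genus_rel `` {X} \<in> genera"
  unfolding genera_def by (rule quotientI) simp

text \<open>
  A lattice Y in the genus of an iterated partial dual of X is reflective, because its partial
  duals in the opposite order lead to the genus of X.
\<close>

lemma totally_reflective_partial_duals:
  assumes X: "sf_integral X" and qs: "\<forall>q\<in>set qs. prime q" and refl: "totally_reflective (genus_rel `` {X})"
  shows "totally_reflective (genus_rel `` {partial_duals qs X})"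
  unfolding totally_reflective_def
proof
  fix Y assume "Y \<in> genus_rel `` {partial_duals qs X}"
  then have Y: "(partial_duals qs X, Y) \<in> genus_rel" by (rule ImageE) simp
  have gY: "sf_integral Y" by (rule sf_integral_genus_rel[OF Y sf_integral_partial_duals[OF X qs]])
  have "(partial_duals (rev qs) (partial_duals qs X), partial_duals (rev qs) Y) \<in> genus_rel"
    by (rule partial_duals_genus_rel[OF Y sf_integral_partial_duals[OF X qs]]) (use qs in simp)
  then have "(X, partial_duals (rev qs) Y) \<in> genus_rel"
    using genus_rel_trans genus_rel_sym partial_duals_inverse[OF X qs] by blast
  then have "reflective (partial_duals (rev qs) Y)" using refl unfolding totally_reflective_def by blast
  then show "reflective Y" using reflective_partial_duals_iff[OF gY, of "rev qs"] qs by simp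
qed

lemma totally_reflective_imp:
  assumes "totally_reflective G"
  shows "positive_definite_genus G" "X \<in> G \<Longrightarrow> integral_lattice X"
  using assms by (auto simp: totally_reflective_def positive_definite_genus_def reflective_def)

theorem theorem4p3:
  assumes "CARD('n::finite) \<in> {3, 4}"
  shows "(\<Union>G \<in> {G \<in> (genera :: 'n lattice set set).
             positive_definite_genus G \<and> strongly_square_free_genus G \<and> totally_reflective G}.
          \<Union>I \<in> Pow (prime_divisors (genus_det G)). {partial_dual_genus I G}) =
         {G \<in> (genera :: 'n lattice set set).
             positive_definite_genus G \<and> square_free_genus G \<and> totally_reflective G \<and>
             primitive_genus G}" (is "?lhs = ?rhs")
proof
  show "?lhs \<subseteq> ?rhs"
  proof clarify
    fix G :: "'n lattice set" and I
    assume G: "G \<in> genera" "strongly_square_free_genus G" "totally_reflective G"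
      and I: "I \<subseteq> prime_divisors (genus_det G)"
    obtain X where X: "G = genus_rel `` {X}" "is_lattice X" "X \<in> G" using genus_cases[OF G(1)] .
    have Xint: "integral_lattice X" using totally_reflective_imp(2)[OF G(3) X(3)] .
    obtain r0 r1 where J: "\<And>p. prime p \<Longrightarrow> jordan_decomposition p X (r0 p) (r1 p) \<and> r0 p \<ge> r1 p"
      using G(2) X(3) unfolding strongly_square_free_genus_def strongly_square_free_lattice_def by metis
    then have gX: "sf_integral X" using X Xint by (auto simp: sf_integral_def square_free_lattice_def)
    note pd = prime_divisors_genus_det[OF X(1,2) Xint]
    have pos: "positive_definite Y" if "Y \<in> G" for Y
      using totally_reflective_imp(1)[OF G(3)] that by (simp add: positive_definite_genus_def)
    have finI: "finite I" using pd(1)[OF pos] I by (rule finite_subset[rotated])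
    have prI: "\<forall>q\<in>I. prime q" using I by (auto simp: prime_divisors_def)
    define qs where "qs = sorted_list_of_set I"
    have qs: "set qs = I" "distinct qs" "\<forall>q\<in>set qs. prime q" using finI prI by (simp_all add: qs_def)
    have H: "partial_dual_genus I G = genus_rel `` {partial_duals qs X}"
      unfolding X(1) qs_def by (rule partial_dual_genus_eq[OF gX finI prI])
    have gqs: "sf_integral (partial_duals qs X)" by (rule sf_integral_partial_duals[OF gX qs(3)])
    have refl: "totally_reflective (partial_dual_genus I G)"
      unfolding H using totally_reflective_partial_duals[OF gX qs(3)] G(3) X(1) by simp
    have good: "sf_integral Y" if "Y \<in> partial_dual_genus I G" for Y
      using that sf_integral_genus_rel[OF _ gqs] unfolding H by blast
    have "primitive_lattice Y" if Y: "Y \<in> partial_dual_genus I G" for Y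
    proof -
      \<comment> \<open>the ranks of Y at p\<close>
      define s0 where "s0 p = (if p \<in> I then r1 p else r0 p)" for p
      define s1 where "s1 p = (if p \<in> I then r0 p else r1 p)" for p
      have XY: "(partial_duals qs X, Y) \<in> genus_rel" using Y unfolding H by blast
      have "jordan_decomposition p Y (s0 p) (s1 p)" if p: "prime p" for p
      proof (rule genus_rel_jordan[OF XY p])
        show "jordan_decomposition p (partial_duals qs X) (s0 p) (s1 p)"
          using partial_duals_jordan[OF gX qs(3,2) p, of "r0 p" "r1 p"] J[OF p]
          unfolding s0_def s1_def qs(1) by (cases "p \<in> I") simp_all
      qed
      moreover have "s0 p > 0" if p: "prime p" for p
      proof (cases "p \<in> I")
        case True
        then show ?thesis using pd(2)[OF pos p, of "r0 p" "r1 p"] J[OF p] I by (auto simp: s0_def)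
      next
        case False
        then show ?thesis
          using jordan_decomposition_rank0(2)[OF p, of "fst X" "snd X" "r0 p" "r1 p"] J[OF p] X(2) Xint
          by (auto simp: s0_def)
      qed
      ultimately show ?thesis
        using primitive_iff_rank0[of Y s0 s1] good[OF Y] by (simp add: sf_integral_def)
    qed
    moreover have "partial_dual_genus I G \<in> genera" unfolding H using gqs by (intro genus_mem) (simp add: sf_integral_def)
    ultimately show "partial_dual_genus I G \<in> genera \<and> positive_definite_genus (partial_dual_genus I G) \<and>
        square_free_genus (partial_dual_genus I G) \<and> totally_reflective (partial_dual_genus I G) \<and>
        primitive_genus (partial_dual_genus I G)"
      using refl totally_reflective_imp(1)[OF refl] good
      by (simp add: square_free_genus_def primitive_genus_def sf_integral_def)
  qed
  show "?rhs \<subseteq> ?lhs"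
  proof clarify
    fix H :: "'n lattice set"
    assume H: "H \<in> genera" "square_free_genus H" "totally_reflective H" "primitive_genus H"
    obtain X where X: "H = genus_rel `` {X}" "is_lattice X" "X \<in> H" using genus_cases[OF H(1)] .
    have Xint: "integral_lattice X" using totally_reflective_imp(2)[OF H(3) X(3)] .
    have gX: "sf_integral X" using X Xint H(2) by (simp add: sf_integral_def square_free_genus_def)
    define I where "I = {p. prime p \<and> \<not> (\<exists>r0 r1. jordan_decomposition p X r0 r1 \<and> r0 \<ge> r1)}"
    have "\<exists>r0 r1. jordan_decomposition p X r0 r1 \<and> (p \<in> I \<longleftrightarrow> r0 < r1)" if p: "prime p" for p
    proof (cases "p \<in> I")
      case True
      obtain r0 r1 where "jordan_decomposition p X r0 r1" using gX p unfolding sf_integral_def square_free_lattice_def by blast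
      moreover have "\<not> r0 \<ge> r1" using True calculation unfolding I_def by blast
      ultimately show ?thesis using True by (intro exI[of _ r0] exI[of _ r1]) simp
    next
      case False
      then obtain r0 r1 where "jordan_decomposition p X r0 r1" "r0 \<ge> r1" using p unfolding I_def by blast
      then show ?thesis using False by (intro exI[of _ r0] exI[of _ r1]) simp
    qed
    then obtain r0 r1 where J: "\<And>p. prime p \<Longrightarrow> jordan_decomposition p X (r0 p) (r1 p)"
      and JI: "\<And>p. prime p \<Longrightarrow> p \<in> I \<longleftrightarrow> r0 p < r1 p" by metis
    have r0: "r0 p > 0" if "prime p" for p
      using primitive_iff_rank0[OF X(2) Xint J] H(4) X(3) that unfolding primitive_genus_def by blast
    have posH: "positive_definite Y" if "Y \<in> H" for Y
      using totally_reflective_imp(1)[OF H(3)] that by (simp add: positive_definite_genus_def)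
    have prI: "\<forall>q\<in>I. prime q" by (simp add: I_def)
    have "I \<subseteq> prime_divisors (genus_det H)"
    proof
      fix p assume p: "p \<in> I"
      then have pp: "prime p" using prI by blast
      show "p \<in> prime_divisors (genus_det H)"
        using prime_divisors_genus_det(2)[OF X(1,2) Xint posH pp J[OF pp]] JI[OF pp] p by simp
    qed
    then have finI: "finite I"
      using prime_divisors_genus_det(1)[OF X(1,2) Xint posH] by (rule finite_subset)
    define qs where "qs = sorted_list_of_set I"
    have qs: "set (rev qs) = I" "distinct (rev qs)" "\<forall>q\<in>set (rev qs). prime q" "\<forall>q\<in>set qs. prime q"
      using finI prI by (simp_all add: qs_def)
    \<comment> \<open>in the opposite order, so that the partial duals at I in the increasing order lead back to X\<close>
    define Z where "Z = partial_duals (rev qs) X"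
    define G where "G = genus_rel `` {Z}"
    have gZ: "sf_integral Z" unfolding Z_def by (rule sf_integral_partial_duals[OF gX qs(3)])
    have Z: "is_lattice Z" "integral_lattice Z" using gZ by (simp_all add: sf_integral_def)
    have JZ: "jordan_decomposition p Z (if p \<in> I then r1 p else r0 p) (if p \<in> I then r0 p else r1 p)"
      if p: "prime p" for p
      using partial_duals_jordan[OF gX qs(3,2) p J[OF p]] unfolding Z_def qs(1) by auto
    have G: "G \<in> genera" unfolding G_def using Z(1) by (rule genus_mem)
    have reflG: "totally_reflective G"
      unfolding G_def Z_def using totally_reflective_partial_duals[OF gX qs(3)] H(3) X(1) by simp
    have posG: "positive_definite Y" if "Y \<in> G" for Y
      using totally_reflective_imp(1)[OF reflG] that by (simp add: positive_definite_genus_def)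
    have "strongly_square_free_genus G"
      unfolding strongly_square_free_genus_def strongly_square_free_lattice_def
    proof (intro ballI allI impI)
      fix Y p assume Y: "Y \<in> G" and p: "prime (p :: nat)"
      have "jordan_decomposition p Y (if p \<in> I then r1 p else r0 p) (if p \<in> I then r0 p else r1 p)"
        using genus_rel_jordan[OF _ p JZ[OF p], of Y] Y unfolding G_def by blast
      moreover have "(if p \<in> I then r1 p else r0 p) \<ge> (if p \<in> I then r0 p else r1 p)" using JI[OF p] by auto
      ultimately show "\<exists>r0 r1. jordan_decomposition p Y r0 r1 \<and> r0 \<ge> r1" by blast
    qed
    moreover have "I \<subseteq> prime_divisors (genus_det G)"
    proof
      fix p assume p: "p \<in> I"
      then have pp: "prime p" using prI by blast
      show "p \<in> prime_divisors (genus_det G)"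
        using prime_divisors_genus_det(2)[OF G_def Z posG pp JZ[OF pp]] r0[OF pp] p by simp
    qed
    moreover have "H = partial_dual_genus I G"
    proof -
      have "(partial_duals qs Z, X) \<in> genus_rel"
        using partial_duals_inverse[OF gX qs(3)] unfolding Z_def by simp
      then have "genus_rel `` {partial_duals qs Z} = H"
        unfolding X(1) using equiv_class_eq[OF genus_rel_equiv] by blast
      then show ?thesis unfolding G_def partial_dual_genus_eq[OF gZ finI prI] qs_def by simp
    qed
    ultimately show "H \<in> ?lhs"
      using G reflG totally_reflective_imp(1)[OF reflG] by blast
  qed
qed

end
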